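(* The first-order system on $\mathbb{R}^+\!\cdot\mathrm{U}(3)$-structures on $6$-manifolds that defines quasi-integrability is not formally integrable. In particular, it is not involutive.
   Context: For an almost complex structure $J$ on $M^6$, $1$-forms $\alpha$ with $\alpha(Jv)=i\,\alpha(v)$ are of type $(1,0)$; the exterior derivative decomposes by type as $d=d^{2,-1}+\partial+\bar\partial+d^{-1,2}$. For a local $J$-linear coframing $\alpha=(\alpha^1,\alpha^2,\alpha^3)$ (a column of pointwise linearly independent $(1,0)$-forms), $N(\alpha)$ is the matrix function with $$d^{-1,2}\alpha=N(\alpha)\begin{pmatrix}\overline{\alpha^2\wedge\alpha^3}\\ \overline{\alpha^3\wedge\alpha^1}\\ \overline{\alpha^1\wedge\alpha^2}\end{pmatrix}.$$ An $\mathbb{R}^+\!\cdot\mathrm{U}(3)$-structure is a pair $(J,[\eta])$, with $J$ an almost complex structure and $[\eta]$ a positive real $(1,1)$-form up to multiplication by positive functions. A coframing $\alpha$ is conformally unitary if it is $J$-linear and $\eta=\mu\,\tfrac{i}{2}\sum_i\alpha^i\wedge\overline{\alpha^i}$ for some positive function $\mu$. The structure is quasi-integrable if $N(\alpha)$ is a (complex function) multiple of $I_3$ for every local conformally unitary coframing. Let $\mathsf{CU}(M)\to M$ be the bundle (fiber $\mathrm{GL}(6,\mathbb{R})/(\mathbb{R}^+\!\cdot\mathrm{U}(3))$) whose local sections are the local $\mathbb{R}^+\!\cdot\mathrm{U}(3)$-structures on $M$. The $1$-jets of local quasi-integrable structures form a smooth submanifold $Q\subset J^1(\mathsf{CU}(M))$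 of real codimension $16$; this is the first-order system in question. Its prolongations are $Q^{(k)}\subset J^{k+1}(\mathsf{CU}(M))$, obtained by adjoining the derivatives of the defining equations up to order $k$. Formal integrability means that each $Q^{(k)}$ is a smooth submanifold and each projection $Q^{(k+1)}\to Q^{(k)}$ is a surjective submersion (roughly: every differential equation of order $q$ satisfied by all solutions is derivable by differentiating the defining equations at most $q-1$ times). Involutive is in the sense of Cartan's theory; involutive systems are formally integrable. *)

theory Defs
  imports "HOL-Analysis.Analysis" "HOL-Library.Numeral_Type"
begin

section \<open>Smooth functions and submanifolds of finite-dimensional coordinate spaces\<close>

text \<open>
  The dimension of a space of \<open>k\<close>-jets depends on \<open>k\<close>, so it cannot be carried by a type.
  A finite set \<open>I\<close> of coordinates selects the copy \<open>coord_space I\<close> of \<open>\<real>\<^sup>I\<close> inside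
  \<open>'i \<Rightarrow> real\<close> (product topology).  For a finite type \<open>'n\<close>, the type \<open>'n \<Rightarrow> real\<close> itself is
  \<open>\<real>\<^sup>n\<close>, with \<open>I = UNIV\<close>.
\<close>

definition coord_space :: "'i set \<Rightarrow> ('i \<Rightarrow> real) set" where
  "coord_space I = {x. \<forall>i. i \<notin> I \<longrightarrow> x i = 0}"

definition partial :: "'i \<Rightarrow> (('i \<Rightarrow> real) \<Rightarrow> real) \<Rightarrow> ('i \<Rightarrow> real) \<Rightarrow> real" where
  "partial i f x = deriv (\<lambda>t. f (x(i := t))) (x i)"

primrec partials :: "'i list \<Rightarrow> (('i \<Rightarrow> real) \<Rightarrow> real) \<Rightarrow> ('i \<Rightarrow> real) \<Rightarrow> real" where
  "partials [] f = f"
| "partials (i # L) f = partial i (partials L f)"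

primrec Ck_on :: "nat \<Rightarrow> 'i set \<Rightarrow> ('i \<Rightarrow> real) set \<Rightarrow> (('i \<Rightarrow> real) \<Rightarrow> real) \<Rightarrow> bool" where
  "Ck_on 0 I U f \<longleftrightarrow> continuous_on U f"
| "Ck_on (Suc k) I U f \<longleftrightarrow> continuous_on U f \<and>
     (\<forall>i\<in>I. (\<forall>x\<in>U. (\<lambda>t. f (x(i := t))) differentiable (at (x i))) \<and> Ck_on k I U (partial i f))"

definition open_in_coord :: "'i set \<Rightarrow> ('i \<Rightarrow> real) set \<Rightarrow> bool" where
  "open_in_coord I U \<longleftrightarrow> openin (top_of_set (coord_space I)) U"

definition smooth_fn :: "'i set \<Rightarrow> ('i \<Rightarrow> real) set \<Rightarrow> (('i \<Rightarrow> real) \<Rightarrow> real) \<Rightarrow> bool" where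
  "smooth_fn I U f \<longleftrightarrow> open_in_coord I U \<and> (\<forall>k. Ck_on k I U f)"

definition smooth_map :: "'i set \<Rightarrow> ('i \<Rightarrow> real) set \<Rightarrow> (('i \<Rightarrow> real) \<Rightarrow> 'j \<Rightarrow> real) \<Rightarrow> bool" where
  "smooth_map I U h \<longleftrightarrow> (\<forall>j. smooth_fn I U (\<lambda>x. h x j))"

text \<open>Embedded submanifolds of \<open>\<real>\<^sup>I\<close>, by slice charts \<open>h\<close> with inverse \<open>g\<close>.\<close>

definition submanifold :: "'i set \<Rightarrow> ('i \<Rightarrow> real) set \<Rightarrow> bool" where
  "submanifold I S \<longleftrightarrow> S \<subseteq> coord_space I \<and>
     (\<forall>q\<in>S. \<exists>U V h g K. q \<in> U \<and> smooth_map I U h \<and> smooth_map I V g \<and>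
        h ` U = V \<and> (\<forall>x\<in>U. g (h x) = x) \<and> (\<forall>y\<in>V. h (g y) = y) \<and>
        K \<subseteq> I \<and> h ` (S \<inter> U) = V \<inter> coord_space K)"

text \<open>Velocities of curves in \<open>S\<close>; for embedded submanifolds this is the usual tangent space.\<close>

definition tangent_space :: "('i \<Rightarrow> real) set \<Rightarrow> ('i \<Rightarrow> real) \<Rightarrow> ('i \<Rightarrow> real) set" where
  "tangent_space S q = {v. \<exists>\<gamma> \<epsilon>. \<epsilon> > 0 \<and> (\<forall>t. \<bar>t\<bar> < \<epsilon> \<longrightarrow> \<gamma> t \<in> S) \<and> \<gamma> 0 = q \<and>
     (\<forall>i. ((\<lambda>t. \<gamma> t i) has_real_derivative v i) (at 0))}"


section \<open>Jets of sections and prolongations of first-order systems\<close>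

text \<open>
  Sections over open subsets of \<open>\<real>\<^sup>n\<close> of a bundle whose fibre \<open>F\<close> is embedded in \<open>\<real>\<^sup>m\<close>.
  Jet coordinates: \<open>Inl a\<close> is the base coordinate \<open>x\<^sup>a\<close>, and \<open>Inr (L, b)\<close> is the iterated
  derivative along \<open>L\<close> of the \<open>b\<close>-th fibre coordinate.  Derivatives in different orders
  are listed separately, so the space of \<open>k\<close>-jets of sections is an embedded submanifold of
  \<open>coord_space (jet_coords k)\<close> rather than an open subset.
\<close>

type_synonym ('n, 'm) jet = "'n + ('n list \<times> 'm) \<Rightarrow> real"

definition jet_coords :: "nat \<Rightarrow> ('n + ('n list \<times> 'm)) set" where
  "jet_coords k = range Inl \<union> {Inr (L, b) |L b. length L \<le> k}"

definition jet :: "nat \<Rightarrow> (('n \<Rightarrow> real) \<Rightarrow> 'm \<Rightarrow> real) \<Rightarrow> ('n \<Rightarrow> real) \<Rightarrow> ('n, 'm) jet" where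
  "jet k s x = (\<lambda>c. case c of
       Inl a \<Rightarrow> x a
     | Inr (L, b) \<Rightarrow> if length L \<le> k then partials L (\<lambda>y. s y b) x else 0)"

definition jet_proj :: "nat \<Rightarrow> ('n, 'm) jet \<Rightarrow> ('n, 'm) jet" where
  "jet_proj k j = (\<lambda>c. if c \<in> jet_coords k then j c else 0)"

definition local_section ::
    "('m \<Rightarrow> real) set \<Rightarrow> ('n \<Rightarrow> real) set \<Rightarrow> (('n \<Rightarrow> real) \<Rightarrow> 'm \<Rightarrow> real) \<Rightarrow> bool" where
  "local_section F W s \<longleftrightarrow> open W \<and> smooth_map UNIV W s \<and> (\<forall>y\<in>W. s y \<in> F)"

text \<open>
  For a first-order system \<open>Q\<close>, the \<open>k\<close>-th prolongation consists of \<open>(k+1)\<close>-jets: the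
  defining equations \<open>\<Phi> = 0\<close> range over all smooth functions near the given 1-jet that vanish
  on \<open>Q\<close>, and their derivatives of order up to \<open>k\<close> along the section are required to vanish.
\<close>

definition prolongation ::
    "('m \<Rightarrow> real) set \<Rightarrow> ('n \<Rightarrow> real) set \<Rightarrow> ('n, 'm) jet set \<Rightarrow> nat \<Rightarrow> ('n, 'm) jet set" where
  "prolongation F D Q k =
     {jet (k + 1) s x |s x. \<exists>W. W \<subseteq> D \<and> x \<in> W \<and> local_section F W s \<and> jet 1 s x \<in> Q \<and>
        (\<forall>U \<Phi>. smooth_fn (jet_coords 1) U \<Phi> \<and> jet 1 s x \<in> U \<and> (\<forall>q\<in>Q \<inter> U. \<Phi> q = 0) \<longrightarrow>
           (\<forall>L. length L \<le> k \<longrightarrow> partials L (\<lambda>y. \<Phi> (jet 1 s y)) x = 0))}"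

definition formally_integrable ::
    "('m \<Rightarrow> real) set \<Rightarrow> ('n \<Rightarrow> real) set \<Rightarrow> ('n, 'm) jet set \<Rightarrow> bool" where
  "formally_integrable F D Q \<longleftrightarrow>
     (\<forall>k. submanifold (jet_coords (k + 1)) (prolongation F D Q k)) \<and>
     (\<forall>k. jet_proj (k + 1) ` prolongation F D Q (k + 1) = prolongation F D Q k) \<and>
     (\<forall>k. \<forall>j \<in> prolongation F D Q (k + 1).
        jet_proj (k + 1) ` tangent_space (prolongation F D Q (k + 1)) j =
        tangent_space (prolongation F D Q k) (jet_proj (k + 1) j))"


section \<open>Involutivity\<close>

text \<open>
  A tableau is a linear subspace \<open>A\<close> of \<open>Hom(\<real>\<^sup>n, \<real>\<^sup>m)\<close>; here \<open>a $ i\<close> is the value of \<open>a\<close> on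
  the \<open>i\<close>-th basis vector, and \<open>v v* a\<close> its value on \<open>v\<close>.
\<close>

definition tableau_prolongation ::
    "(real^'m^'n) set \<Rightarrow> (real^'m^'n^'n) set" where
  "tableau_prolongation A = {P. (\<forall>i. P $ i \<in> A) \<and> (\<forall>i j. P $ i $ j = P $ j $ i)}"

text \<open>
  The dimension of the space of elements of \<open>A\<close> annihilating a generic
  \<open>k\<close>-dimensional subspace: this dimension is upper semicontinuous, so its generic value is
  its minimum.  The Cartan characters are \<open>s\<^sub>1, \<dots>, s\<^sub>n\<close>, where \<open>s\<^sub>1 + \<dots> + s\<^sub>k\<close> is the rank
  of the restriction of \<open>A\<close> to a generic \<open>k\<close>-dimensional subspace.
\<close>

definition generic_annihilator_dim :: "(real^'m^'n) set \<Rightarrow> nat \<Rightarrow> nat" where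
  "generic_annihilator_dim A k =
     Inf {dim {a \<in> A. \<forall>v\<in>E. v v* a = 0} |E. subspace E \<and> dim E = k}"

definition cartan_character :: "(real^'m^'n) set \<Rightarrow> nat \<Rightarrow> nat" where
  "cartan_character A k = generic_annihilator_dim A (k - 1) - generic_annihilator_dim A k"

definition involutive_tableau :: "(real^'m^'n) set \<Rightarrow> bool" where
  "involutive_tableau A \<longleftrightarrow>
     dim (tableau_prolongation A) = (\<Sum>k = 1..CARD('n). k * cartan_character A k)"

text \<open>The tableau of \<open>Q\<close> at \<open>q\<close>: the tangent vectors of \<open>Q\<close> vertical over the 0-jets.\<close>

definition vertical_vector :: "real^'m^'n \<Rightarrow> ('n, 'm) jet" where
  "vertical_vector a = (\<lambda>c. case c of Inl _ \<Rightarrow> 0 | Inr (L, b) \<Rightarrow> (case L of [i] \<Rightarrow> a $ i $ b | _ \<Rightarrow> 0))"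

definition tableau :: "('n, 'm) jet set \<Rightarrow> ('n, 'm) jet \<Rightarrow> (real^'m^'n) set" where
  "tableau Q q = {a. vertical_vector a \<in> tangent_space Q q}"

text \<open>
  Cartan's criterion for the contact system on \<open>Q\<close>, with the independence condition of the
  base: the tableau has constant rank, the torsion vanishes (there is an admissible integral
  element, i.e. a 2-jet in the first prolongation, over each point), and the tableau passes
  Cartan's test at each point.
\<close>

definition involutive ::
    "('m::finite \<Rightarrow> real) set \<Rightarrow> ('n::finite \<Rightarrow> real) set \<Rightarrow> ('n, 'm) jet set \<Rightarrow> bool" where
  "involutive F D Q \<longleftrightarrow>
     submanifold (jet_coords 1) Q \<and>
     (\<exists>r. \<forall>q\<in>Q. dim (tableau Q q) = r) \<and>
     jet_proj 1 ` prolongation F D Q 1 = Q \<and>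
     (\<forall>q\<in>Q. involutive_tableau (tableau Q q))"


section \<open>The bundle of conformal unitary structures\<close>

text \<open>\<open>\<eta>(v, w) = v \<bullet> (H *v w)\<close> is a positive real (1,1)-form for the complex structure \<open>J\<close>.\<close>

definition almost_complex :: "real^6^6 \<Rightarrow> bool" where
  "almost_complex J \<longleftrightarrow> J ** J = - mat 1"

definition positive_11 :: "real^6^6 \<Rightarrow> real^6^6 \<Rightarrow> bool" where
  "positive_11 J H \<longleftrightarrow> transpose H = - H \<and> transpose J ** H ** J = H \<and>
     (\<forall>v. v \<noteq> 0 \<longrightarrow> v \<bullet> (H *v (J *v v)) > 0)"

text \<open>Fibre coordinates: \<open>Inl (a, b)\<close> for the entries of \<open>J\<close> and \<open>Inr (a, b)\<close> for those of \<open>\<eta>\<close>.\<close>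

type_synonym cu_index = "(6 \<times> 6) + (6 \<times> 6)"
type_synonym pt = "6 \<Rightarrow> real"
type_synonym cu_section = "pt \<Rightarrow> cu_index \<Rightarrow> real"

definition J_of :: "(cu_index \<Rightarrow> real) \<Rightarrow> real^6^6" where
  "J_of u = (\<chi> a b. u (Inl (a, b)))"

definition eta_of :: "(cu_index \<Rightarrow> real) \<Rightarrow> real^6^6" where
  "eta_of u = (\<chi> a b. u (Inr (a, b)))"

text \<open>
  The fibre \<open>GL(6,\<real>)/(\<real>\<^sup>+\<cdot>U(3))\<close> is the set of pairs \<open>(J, [\<eta>])\<close>.  In a coordinate system, each
  ray \<open>[\<eta>]\<close> has exactly one representative with \<open>\<Sum> \<eta>\<^sub>a\<^sub>b\<^sup>2 = 6\<close> (the value taken by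
  \<open>dx\<^sup>1\<and>dy\<^sup>1 + dx\<^sup>2\<and>dy\<^sup>2 + dx\<^sup>3\<and>dy\<^sup>3\<close>), which embeds the fibre in \<open>\<real>\<^sup>7\<^sup>2\<close>.  Nothing below depends on
  the choice of the normalization.
\<close>

definition cu_fibre :: "(cu_index \<Rightarrow> real) set" where
  "cu_fibre = {u. almost_complex (J_of u) \<and> positive_11 (J_of u) (eta_of u) \<and>
     (\<Sum>a\<in>UNIV. \<Sum>b\<in>UNIV. (eta_of u $ a $ b)\<^sup>2) = 6}"

lemma ray_has_unique_normalized_representative:
  assumes "positive_11 J H"
  shows "\<exists>!\<mu>::real. \<mu> > 0 \<and> (\<Sum>a\<in>UNIV. \<Sum>b\<in>UNIV. ((\<mu> *\<^sub>R H) $ a $ b)\<^sup>2) = 6"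
proof -
  define S where "S = (\<Sum>a\<in>UNIV. \<Sum>b\<in>UNIV. (H $ a $ b)\<^sup>2)"
  have "H \<noteq> 0"
  proof
    assume "H = 0"
    with assms have "\<forall>v::real^6. v \<noteq> 0 \<longrightarrow> (0::real) > 0"
      by (simp add: positive_11_def)
    then show False
      using axis_eq_0_iff[of "1::6" "1::real"] by auto
  qed
  then obtain a b where ab: "H $ a $ b \<noteq> 0"
    by (auto simp: vec_eq_iff)
  have row: "0 < (\<Sum>b\<in>UNIV. (H $ a $ b)\<^sup>2)"
    by (rule sum_pos2[of UNIV b]) (use ab in auto)
  have S: "S > 0"
    unfolding S_def by (rule sum_pos2[of UNIV a]) (use row in \<open>auto intro: sum_nonneg\<close>)
  have eq: "(\<Sum>a\<in>UNIV. \<Sum>b\<in>UNIV. ((\<mu> *\<^sub>R H) $ a $ b)\<^sup>2) = \<mu>\<^sup>2 * S" for \<mu>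
    by (simp add: S_def power_mult_distrib sum_distrib_left)
  have "\<mu>\<^sup>2 * S = 6 \<longleftrightarrow> \<mu> = sqrt (6 / S)" if "\<mu> > 0" for \<mu>
    using S that by (auto simp: field_simps real_sqrt_unique intro!: real_sqrt_unique[symmetric])
  moreover have "sqrt (6 / S) > 0"
    using S by simp
  ultimately show ?thesis
    unfolding eq by blast
qed


section \<open>Quasi-integrability\<close>

text \<open>
  A complex 1-form has components \<open>\<alpha> y a\<close>; a complex 2-form \<open>\<beta>\<close> has components
  \<open>\<beta> a b = \<beta>(\<partial>\<^sub>a, \<partial>\<^sub>b)\<close>.
\<close>

definition cpartial :: "'n \<Rightarrow> (('n \<Rightarrow> real) \<Rightarrow> complex) \<Rightarrow> ('n \<Rightarrow> real) \<Rightarrow> complex" where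
  "cpartial a f x = Complex (partial a (\<lambda>y. Re (f y)) x) (partial a (\<lambda>y. Im (f y)) x)"

definition ext_deriv :: "(pt \<Rightarrow> 6 \<Rightarrow> complex) \<Rightarrow> pt \<Rightarrow> 6 \<Rightarrow> 6 \<Rightarrow> complex" where
  "ext_deriv \<alpha> x a b = cpartial a (\<lambda>y. \<alpha> y b) x - cpartial b (\<lambda>y. \<alpha> y a) x"

definition wedge :: "(6 \<Rightarrow> complex) \<Rightarrow> (6 \<Rightarrow> complex) \<Rightarrow> 6 \<Rightarrow> 6 \<Rightarrow> complex" where
  "wedge \<alpha> \<beta> a b = \<alpha> a * \<beta> b - \<alpha> b * \<beta> a"

text \<open>
  \<open>proj01 J\<close> is the matrix of the projection \<open>v \<mapsto> (v + i J v)/2\<close> onto the \<open>-i\<close>-eigenspace of \<open>J\<close>,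
  on which all (1,0)-forms vanish.  For a (1,0)-form \<open>\<alpha>\<close>, the form \<open>d\<^sup>-\<^sup>1\<^sup>,\<^sup>2\<alpha>\<close> is the (0,2)-part of
  \<open>d\<alpha>\<close>.
\<close>

definition proj01 :: "real^6^6 \<Rightarrow> 6 \<Rightarrow> 6 \<Rightarrow> complex" where
  "proj01 J c a = ((if c = a then 1 else 0) + \<i> * complex_of_real (J $ c $ a)) / 2"

definition part02 :: "real^6^6 \<Rightarrow> (6 \<Rightarrow> 6 \<Rightarrow> complex) \<Rightarrow> 6 \<Rightarrow> 6 \<Rightarrow> complex" where
  "part02 J \<beta> a b = (\<Sum>c\<in>UNIV. \<Sum>e\<in>UNIV. \<beta> c e * proj01 J c a * proj01 J e b)"

definition linear_coframing :: "cu_section \<Rightarrow> pt set \<Rightarrow> (3 \<Rightarrow> pt \<Rightarrow> 6 \<Rightarrow> complex) \<Rightarrow> bool" where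
  "linear_coframing s W \<alpha> \<longleftrightarrow> open W \<and>
     (\<forall>i a. smooth_fn UNIV W (\<lambda>y. Re (\<alpha> i y a)) \<and> smooth_fn UNIV W (\<lambda>y. Im (\<alpha> i y a))) \<and>
     (\<forall>y\<in>W. \<forall>i b. (\<Sum>a\<in>UNIV. \<alpha> i y a * complex_of_real (J_of (s y) $ a $ b)) = \<i> * \<alpha> i y b) \<and>
     (\<forall>y\<in>W. \<forall>c. (\<forall>a. (\<Sum>i\<in>UNIV. c i * \<alpha> i y a) = 0) \<longrightarrow> (\<forall>i. c i = 0))"

definition conformally_unitary ::
    "cu_section \<Rightarrow> pt set \<Rightarrow> (3 \<Rightarrow> pt \<Rightarrow> 6 \<Rightarrow> complex) \<Rightarrow> bool" where
  "conformally_unitary s W \<alpha> \<longleftrightarrow> linear_coframing s W \<alpha> \<and>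
     (\<exists>\<mu> :: pt \<Rightarrow> real. \<forall>y\<in>W. \<mu> y > 0 \<and>
        (\<forall>a b. complex_of_real (eta_of (s y) $ a $ b) =
           complex_of_real (\<mu> y) * (\<i> / 2) *
           (\<Sum>i\<in>UNIV. wedge (\<alpha> i y) (\<lambda>c. cnj (\<alpha> i y c)) a b)))"

text \<open>
  Indices in the type \<open>3\<close> are taken modulo 3, so \<open>(j + 1, j + 2)\<close> runs through
  \<open>(2,3), (3,1), (1,2)\<close> for \<open>j = 1, 2, 3\<close>.  The matrix \<open>N(\<alpha>)\<close> is determined by the equation since
  the \<open>cnj (\<alpha>\<^sup>j\<^sup>+\<^sup>1 \<and> \<alpha>\<^sup>j\<^sup>+\<^sup>2)\<close> are a basis of the (0,2)-forms.
\<close>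

definition N_matrix :: "cu_section \<Rightarrow> (3 \<Rightarrow> pt \<Rightarrow> 6 \<Rightarrow> complex) \<Rightarrow> pt \<Rightarrow> complex^3^3" where
  "N_matrix s \<alpha> x = (THE N. \<forall>i a b.
     part02 (J_of (s x)) (ext_deriv (\<alpha> i) x) a b =
     (\<Sum>j\<in>UNIV. N $ i $ j * cnj (wedge (\<alpha> (j + 1) x) (\<alpha> (j + 2) x) a b)))"

definition quasi_integrable_at :: "cu_section \<Rightarrow> pt set \<Rightarrow> pt \<Rightarrow> bool" where
  "quasi_integrable_at s W x \<longleftrightarrow>
     (\<forall>V \<alpha>. V \<subseteq> W \<and> x \<in> V \<and> conformally_unitary s V \<alpha> \<longrightarrow> (\<exists>c. N_matrix s \<alpha> x = mat c))"

definition quasi_integrable :: "cu_section \<Rightarrow> pt set \<Rightarrow> bool" where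
  "quasi_integrable s W \<longleftrightarrow> local_section cu_fibre W s \<and> (\<forall>x\<in>W. quasi_integrable_at s W x)"

text \<open>
  The first-order system over an open set \<open>D\<close>: the condition on the 1-jet at \<open>x\<close> is that \<open>N(\<alpha>)\<close> be
  a multiple of the identity at \<open>x\<close>.  A local structure is quasi-integrable exactly when all
  its 1-jets lie in this set.
\<close>

definition quasi_integrability_system :: "pt set \<Rightarrow> (6, cu_index) jet set" where
  "quasi_integrability_system D =
     {jet 1 s x |s x. \<exists>W. W \<subseteq> D \<and> x \<in> W \<and> local_section cu_fibre W s \<and> quasi_integrable_at s W x}"


section \<open>Smooth manifolds\<close>

definition smooth_manifold ::
    "'p topology \<Rightarrow> ('p set \<times> ('p \<Rightarrow> 'n::finite \<Rightarrow> real)) set \<Rightarrow> bool" where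
  "smooth_manifold X A \<longleftrightarrow> Hausdorff_space X \<and> second_countable X \<and>
     (\<Union>(U, \<phi>)\<in>A. U) = topspace X \<and>
     (\<forall>(U, \<phi>)\<in>A. openin X U \<and> open (\<phi> ` U) \<and>
        homeomorphic_map (subtopology X U) (top_of_set (\<phi> ` U)) \<phi>) \<and>
     (\<forall>(U, \<phi>)\<in>A. \<forall>(V, \<psi>)\<in>A. smooth_map UNIV (\<phi> ` (U \<inter> V)) (\<lambda>x. \<psi> (inv_into U \<phi> x)))"

text \<open>
  A chart \<open>(U, \<phi>)\<close> identifies the local structures on \<open>U\<close>, and hence the part of
  \<open>J\<^sup>k(CU(M))\<close> over \<open>U\<close> with its smooth structure, with those of the open set \<open>\<phi> ` U\<close>.  These parts
  form an open cover of \<open>J\<^sup>k(CU(M))\<close>, the system and its prolongations are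
  invariant under diffeomorphisms, and being a submanifold, a surjection onto the lower prolongation,
  a submersion, or involutive at each point are all local over \<open>M\<close>; so both properties
  are expressed in the charts of an atlas.
\<close>

definition quasi_integrability_formally_integrable :: "('p set \<times> ('p \<Rightarrow> pt)) set \<Rightarrow> bool" where
  "quasi_integrability_formally_integrable A \<longleftrightarrow>
     (\<forall>(U, \<phi>)\<in>A. formally_integrable cu_fibre (\<phi> ` U) (quasi_integrability_system (\<phi> ` U)))"

definition quasi_integrability_involutive :: "('p set \<times> ('p \<Rightarrow> pt)) set \<Rightarrow> bool" where
  "quasi_integrability_involutive A \<longleftrightarrow>
     (\<forall>(U, \<phi>)\<in>A. involutive cu_fibre (\<phi> ` U) (quasi_integrability_system (\<phi> ` U)))"

end

theory Submission
  imports Defs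
begin

text \<open>
  Lowering the Nijenhuis tensor with \<open>\<eta>\<close> gives a trilinear form \<open>tau\<close> on the (0,1)-vectors, and
  quasi-integrability says that \<open>tau\<close> is totally skew-symmetric.  This is first-order in \<open>J\<close>.  Five
  second derivatives of the corresponding equations can be combined such that all third derivatives
  of \<open>J\<close> cancel; what is left is a condition on the 2-jet.  An explicit family of orthogonal structures satisfies the equations
  along the coordinate axes, hence its 2-jet lies in the first prolongation, but violates that
  condition, hence its 2-jet does not lift to the second prolongation.

  Cartan's test fails at the flat 1-jet.  The symbol \<open>\<sigma>\<close> of the system takes values in an 8-dimensional
  complex space.  It is onto after one prolongation, so the prolonged tableau has the dimension
  \<open>21 t - 96\<close>, where \<open>t\<close> is the dimension of the fibre.  On a single covector \<open>\<zeta>\<close>, however, its image is a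
  proper subspace, since \<open>\<Sum>\<^sub>j N\<^sub>i\<^sub>j \<zeta>\<^sub>j = 0\<close>, so \<open>\<Sum>\<^sub>k k s\<^sub>k\<close> is at least \<open>21 t - 95\<close>.
\<close>

section \<open>Calculus of smooth functions\<close>

text \<open>To leading order each row of \<open>N\<close> is a curl in the conjugate directions, so
  its divergence is of lower order. If \<open>N\<close> is \<open>lambda\<close> times the identity,
  this determines the conjugate derivatives of \<open>lambda\<close> by lower-order data, and
  equality of its mixed derivatives becomes an equation on 2-jets. It appears only after two
  differentiations.

  The prolongation quantifies over all smooth functions vanishing on the system, and no generators
  of this ideal are computed. Membership in the first prolongation is therefore shown for every such
  function at once: a partial derivative sees only a coordinate line through the point, whence the
  condition along the axes. To leave the second prolongation, particular functions suffice, namely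
  the real and imaginary parts of \<open>psi\<close>.

  Non-involutivity is not deduced from the failure of formal integrability; Cartan's test is refuted
  directly. At a flat jet all first derivatives vanish, so the relations linear in them can be
  divided by the curve parameter, and the tableau is found from curves alone, without a manifold
  structure on the system.\<close>

lemma fun_upd_eventually:
  assumes "open_in_coord I U" "x \<in> U" "i \<in> I"
  shows "\<forall>\<^sub>F t in nhds (x i). x(i := t) \<in> U"
proof -
  obtain T where T: "open T" "U = coord_space I \<inter> T"
    using assms(1) by (auto simp: open_in_coord_def openin_open)
  have "continuous_on UNIV (\<lambda>t. x(i := t))"
    by (rule continuous_on_coordinatewise_then_product) (case_tac "ia = i"; simp)
  then have "open ((\<lambda>t. x(i := t)) -` T)"
    using T(1) by (simp add: continuous_on_open_vimage)
  moreover have "x i \<in> (\<lambda>t. x(i := t)) -` T"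
    using assms(2) T(2) by auto
  moreover have "x(i := t) \<in> coord_space I" for t
    using assms T(2) by (auto simp: coord_space_def)
  ultimately show ?thesis
    unfolding eventually_nhds T(2) by blast
qed

lemma partial_cong:
  assumes "open_in_coord I U" "x \<in> U" "i \<in> I" "\<And>y. y \<in> U \<Longrightarrow> f y = g y"
  shows "partial i f x = partial i g x"
  unfolding partial_def
  by (rule deriv_cong_ev) (use fun_upd_eventually[OF assms(1-3)] assms(4) in \<open>auto elim: eventually_mono\<close>)

lemma differentiable_upd_cong:
  fixes f g :: "('i \<Rightarrow> real) \<Rightarrow> real"
  assumes "open_in_coord I U" "x \<in> U" "i \<in> I" "\<And>y. y \<in> U \<Longrightarrow> f y = g y"
    and "(\<lambda>t. f (x(i := t))) differentiable (at (x i))"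
  shows "(\<lambda>t. g (x(i := t))) differentiable (at (x i))"
proof -
  obtain D where "((\<lambda>t. f (x(i := t))) has_real_derivative D) (at (x i))"
    using assms(5) by (auto simp: real_differentiable_def)
  moreover have "\<forall>\<^sub>F t in nhds (x i). f (x(i := t)) = g (x(i := t))"
    using fun_upd_eventually[OF assms(1-3)] assms(4) by (auto elim: eventually_mono)
  ultimately have "((\<lambda>t. g (x(i := t))) has_real_derivative D) (at (x i))"
    using DERIV_cong_ev[OF refl, of "\<lambda>t. f (x(i := t))" "\<lambda>t. g (x(i := t))" "x i" D D] by blast
  then show ?thesis by (auto simp: real_differentiable_def)
qed

lemma Ck_on_cong_imp:
  assumes "open_in_coord I U" "Ck_on k I U f" "\<And>y. y \<in> U \<Longrightarrow> f y = g y"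
  shows "Ck_on k I U g"
  using assms(2,3)
proof (induction k arbitrary: f g)
  case 0
  then show ?case by (simp cong: continuous_on_cong)
next
  case (Suc k)
  have "continuous_on U g" using Suc.prems by (simp cong: continuous_on_cong)
  moreover have "(\<lambda>t. g (x(i := t))) differentiable (at (x i))" if "i \<in> I" "x \<in> U" for i x
  proof (rule differentiable_upd_cong[OF assms(1) that(2,1) Suc.prems(2)])
    show "(\<lambda>t. f (x(i := t))) differentiable (at (x i))" using Suc.prems(1) that by simp
  qed
  moreover have "Ck_on k I U (partial i g)" if "i \<in> I" for i
    using Suc.IH[of "partial i f" "partial i g"] Suc.prems that
      partial_cong[OF assms(1) _ that Suc.prems(2)] by auto
  ultimately show ?case by simp
qed

lemma Ck_on_Suc_imp: "Ck_on (Suc k) I U f \<Longrightarrow> Ck_on k I U f"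
  by (induction k arbitrary: f) auto

lemma Ck_on_has_partial:
  assumes "Ck_on (Suc k) I U f" "i \<in> I" "x \<in> U"
  shows "((\<lambda>t. f (x(i := t))) has_real_derivative partial i f x) (at (x i))"
  using assms unfolding partial_def by (simp add: real_differentiable_def DERIV_deriv_iff_real_differentiable)

lemma Ck_on_SucI:
  assumes op: "open_in_coord I U" and "continuous_on U f"
    and d: "\<And>i x. i \<in> I \<Longrightarrow> x \<in> U \<Longrightarrow> ((\<lambda>t. f (x(i := t))) has_real_derivative f' i x) (at (x i))"
    and k: "\<And>i. i \<in> I \<Longrightarrow> Ck_on k I U (f' i)"
  shows "Ck_on (Suc k) I U f"
proof -
  have "partial i f x = f' i x" if "i \<in> I" "x \<in> U" for i x
    unfolding partial_def by (rule DERIV_imp_deriv) (use d that in auto)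
  then have "Ck_on k I U (partial i f)" if "i \<in> I" for i
    using that by (intro Ck_on_cong_imp[OF op k[OF that]]) simp
  moreover have "(\<lambda>t. f (x(i := t))) differentiable (at (x i))" if "i \<in> I" "x \<in> U" for i x
    using d[OF that] real_differentiable_def by blast
  ultimately show ?thesis using assms(2) by simp
qed

lemma Ck_on_continuous: "Ck_on k I U f \<Longrightarrow> continuous_on U f"
  by (cases k) auto

lemma Ck_on_add:
  assumes op: "open_in_coord I U"
  shows "Ck_on k I U f \<Longrightarrow> Ck_on k I U g \<Longrightarrow> Ck_on k I U (\<lambda>x. f x + g x)"
proof (induction k arbitrary: f g)
  case 0
  then show ?case by (auto intro: continuous_intros)
next
  case (Suc k)
  have cont: "continuous_on U f" "continuous_on U g"
    using Suc.prems Ck_on_continuous by blast+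
  show ?case
  proof (rule Ck_on_SucI[OF op, where f' = "\<lambda>i x. partial i f x + partial i g x"])
    show "continuous_on U (\<lambda>x. f x + g x)" using cont by (intro continuous_intros)
    show "((\<lambda>t. f (x(i := t)) + g (x(i := t))) has_real_derivative partial i f x + partial i g x) (at (x i))"
      if "i \<in> I" "x \<in> U" for i x
      by (intro DERIV_add Ck_on_has_partial[OF Suc.prems(1) that] Ck_on_has_partial[OF Suc.prems(2) that])
    show "Ck_on k I U (\<lambda>x. partial i f x + partial i g x)" if "i \<in> I" for i
      by (intro Suc.IH) (use Suc.prems that in auto)
  qed
qed

lemma Ck_on_mult:
  assumes op: "open_in_coord I U"
  shows "Ck_on k I U f \<Longrightarrow> Ck_on k I U g \<Longrightarrow> Ck_on k I U (\<lambda>x. f x * g x)"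
proof (induction k arbitrary: f g)
  case 0
  then show ?case by (auto intro: continuous_intros)
next
  case (Suc k)
  have cont: "continuous_on U f" "continuous_on U g"
    using Suc.prems Ck_on_continuous by blast+
  show ?case
  proof (rule Ck_on_SucI[OF op, where f' = "\<lambda>i x. partial i f x * g x + partial i g x * f x"])
    show "continuous_on U (\<lambda>x. f x * g x)" using cont by (intro continuous_intros)
    show "((\<lambda>t. f (x(i := t)) * g (x(i := t))) has_real_derivative partial i f x * g x + partial i g x * f x) (at (x i))"
      if "i \<in> I" "x \<in> U" for i x
      by (rule DERIV_cong[OF DERIV_mult[OF Ck_on_has_partial[OF Suc.prems(1) that] Ck_on_has_partial[OF Suc.prems(2) that]]])
        (simp only: fun_upd_triv)
    show "Ck_on k I U (\<lambda>x. partial i f x * g x + partial i g x * f x)" if "i \<in> I" for i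
      by (intro Ck_on_add[OF op] Suc.IH) (use Suc.prems that Ck_on_Suc_imp in auto)
  qed
qed

lemma continuous_on_coordinate: "continuous_on U (\<lambda>x::'i \<Rightarrow> real. x c)"
  by (rule continuous_on_subset[OF continuous_on_product_coordinates subset_UNIV])

lemma Ck_on_const:
  assumes "open_in_coord I U"
  shows "Ck_on k I U (\<lambda>x. c)"
proof (induction k arbitrary: c)
  case (Suc k)
  show ?case by (rule Ck_on_SucI[OF assms, where f' = "\<lambda>i x. 0"]) (auto intro: Suc)
qed auto

lemma Ck_on_coordinate:
  assumes "open_in_coord I U"
  shows "Ck_on k I U (\<lambda>x. x c)"
proof (cases k)
  case (Suc k)
  have "((\<lambda>t. (x(i := t)) c) has_real_derivative (if i = c then 1 else 0)) (at (x i))" for i x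
    by (cases "i = c") auto
  then show ?thesis unfolding Suc
    by (intro Ck_on_SucI[OF assms, where f' = "\<lambda>i x. if i = c then 1 else 0"])
      (auto intro: Ck_on_const assms continuous_on_coordinate)
qed (auto intro: continuous_on_coordinate)

text \<open>Inverse and square root satisfy first-order differential equations, so their derivative
  is an algebraic expression in the function itself. \<open>rep\<close> says that this expression
  inherits regularity of order k from the composite, which is just what the induction hypothesis
  supplies.\<close>

lemma Ck_on_chain:
  assumes op: "open_in_coord I U" and T: "\<And>x. x \<in> U \<Longrightarrow> f x \<in> T"
    and \<phi>: "\<And>k r. r \<in> T \<Longrightarrow> (\<phi> k has_real_derivative \<psi> k r) (at r)"
    and rep: "\<And>k f. (\<And>x. x \<in> U \<Longrightarrow> f x \<in> T) \<Longrightarrow> Ck_on k I U f \<Longrightarrow> Ck_on k I U (\<lambda>x. \<phi> 0 (f x)) \<Longrightarrow> Ck_on k I U (\<lambda>x. \<psi> 0 (f x))"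
    and f: "Ck_on k I U f"
  shows "Ck_on k I U (\<lambda>x. \<phi> (0::nat) (f x))"
  using f T
proof (induction k)
  case 0
  have "continuous_on T (\<phi> 0)"
    using \<phi> by (meson DERIV_isCont continuous_at_imp_continuous_on)
  then show ?case
    using 0 by (auto intro: continuous_on_compose2)
next
  case (Suc k)
  have "continuous_on T (\<phi> 0)"
    using \<phi> by (meson DERIV_isCont continuous_at_imp_continuous_on)
  then have c: "continuous_on U (\<lambda>x. \<phi> 0 (f x))"
    using Suc.prems Ck_on_continuous by (blast intro: continuous_on_compose2)
  show ?case
  proof (rule Ck_on_SucI[OF op c, where f' = "\<lambda>i x. \<psi> 0 (f x) * partial i f x"])
    show "((\<lambda>t. \<phi> 0 (f (x(i := t)))) has_real_derivative \<psi> 0 (f x) * partial i f x) (at (x i))"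
      if "i \<in> I" "x \<in> U" for i x
      by (rule DERIV_chain2[OF _ Ck_on_has_partial[OF Suc.prems(1) that]])
        (use \<phi> Suc.prems that in auto)
    show "Ck_on k I U (\<lambda>x. \<psi> 0 (f x) * partial i f x)" if "i \<in> I" for i
    proof (rule Ck_on_mult[OF op])
      have fk: "Ck_on k I U f" using Suc.prems Ck_on_Suc_imp by blast
      show "Ck_on k I U (\<lambda>x. \<psi> 0 (f x))"
        by (rule rep[OF Suc.prems(2) fk Suc.IH[OF fk Suc.prems(2)]])
      show "Ck_on k I U (partial i f)" using Suc.prems that by auto
    qed
  qed
qed

lemma Ck_on_inverse:
  assumes op: "open_in_coord I U" and "\<And>x. x \<in> U \<Longrightarrow> f x \<noteq> 0" "Ck_on k I U f"
  shows "Ck_on k I U (\<lambda>x. inverse (f x))"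
proof (rule Ck_on_chain[where T = "- {0}" and \<phi> = "\<lambda>_. inverse" and \<psi> = "\<lambda>_ r. - (inverse r * inverse r)", OF op])
  show "(inverse has_real_derivative - (inverse r * inverse r)) (at r)" if "r \<in> - {0}" for r :: real
    using DERIV_inverse[of r] that by (simp add: power2_eq_square)
  show "Ck_on k I U (\<lambda>x. - (inverse (f x) * inverse (f x)))" if "Ck_on k I U (\<lambda>x. inverse (f x))" for k and f :: "('a \<Rightarrow> real) \<Rightarrow> real"
    using Ck_on_mult[OF op Ck_on_const[OF op, of _ "-1"] Ck_on_mult[OF op that that]] by simp
qed (use assms in auto)

lemma Ck_on_sqrt:
  assumes op: "open_in_coord I U" and "\<And>x. x \<in> U \<Longrightarrow> f x > 0" "Ck_on k I U f"
  shows "Ck_on k I U (\<lambda>x. sqrt (f x))"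
proof (rule Ck_on_chain[where T = "{0<..}" and \<phi> = "\<lambda>_. sqrt" and \<psi> = "\<lambda>_ r. inverse (sqrt r) / 2", OF op])
  show "(sqrt has_real_derivative inverse (sqrt r) / 2) (at r)" if "r \<in> {0<..}" for r :: real
    using DERIV_real_sqrt[of r] that by simp
  show "Ck_on k I U (\<lambda>x. inverse (sqrt (f x)) / 2)" if "\<And>x. x \<in> U \<Longrightarrow> f x \<in> {0<..}" "Ck_on k I U (\<lambda>x. sqrt (f x))" for k and f :: "('a \<Rightarrow> real) \<Rightarrow> real"
    using Ck_on_mult[OF op Ck_on_inverse[OF op _ that(2)] Ck_on_const[OF op, of _ "1/2"]] that(1)
    by (simp add: less_imp_neq[symmetric] order_less_imp_not_eq2)
qed (use assms in auto)

lemma smooth_fn_open: "smooth_fn I U f \<Longrightarrow> open_in_coord I U"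
  by (simp add: smooth_fn_def)

lemma smooth_fn_partial: "smooth_fn I U f \<Longrightarrow> i \<in> I \<Longrightarrow> smooth_fn I U (partial i f)"
  unfolding smooth_fn_def by (metis Ck_on.simps(2))

lemma smooth_fn_cong: "smooth_fn I U f \<Longrightarrow> (\<And>y. y \<in> U \<Longrightarrow> f y = g y) \<Longrightarrow> smooth_fn I U g"
  unfolding smooth_fn_def using Ck_on_cong_imp by blast

lemma smooth_fn_const: "open_in_coord I U \<Longrightarrow> smooth_fn I U (\<lambda>x. c)"
  and smooth_fn_coordinate: "open_in_coord I U \<Longrightarrow> smooth_fn I U (\<lambda>x. x i)"
  and smooth_fn_add: "smooth_fn I U f \<Longrightarrow> smooth_fn I U g \<Longrightarrow> smooth_fn I U (\<lambda>x. f x + g x)"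
  and smooth_fn_mult: "smooth_fn I U f \<Longrightarrow> smooth_fn I U g \<Longrightarrow> smooth_fn I U (\<lambda>x. f x * g x)"
  and smooth_fn_inverse: "smooth_fn I U f \<Longrightarrow> (\<And>x. x \<in> U \<Longrightarrow> f x \<noteq> 0) \<Longrightarrow> smooth_fn I U (\<lambda>x. inverse (f x))"
  and smooth_fn_sqrt: "smooth_fn I U f \<Longrightarrow> (\<And>x. x \<in> U \<Longrightarrow> f x > 0) \<Longrightarrow> smooth_fn I U (\<lambda>x. sqrt (f x))"
  by (auto simp: smooth_fn_def Ck_on_const Ck_on_coordinate Ck_on_add Ck_on_mult Ck_on_inverse Ck_on_sqrt)

lemma smooth_fn_uminus: "smooth_fn I U f \<Longrightarrow> smooth_fn I U (\<lambda>x. - f x)"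
  using smooth_fn_mult[OF smooth_fn_const[OF smooth_fn_open], of I U f f "-1"] by simp

lemma smooth_fn_diff: "smooth_fn I U f \<Longrightarrow> smooth_fn I U g \<Longrightarrow> smooth_fn I U (\<lambda>x. f x - g x)"
  using smooth_fn_add[of I U f "\<lambda>x. - g x"] smooth_fn_uminus[of I U g] by simp

lemma smooth_fn_divide:
  "smooth_fn I U f \<Longrightarrow> smooth_fn I U g \<Longrightarrow> (\<And>x. x \<in> U \<Longrightarrow> g x \<noteq> 0) \<Longrightarrow> smooth_fn I U (\<lambda>x. f x / g x)"
  unfolding divide_inverse by (intro smooth_fn_mult smooth_fn_inverse)

lemma smooth_fn_sum:
  "open_in_coord I U \<Longrightarrow> (\<And>a. a \<in> A \<Longrightarrow> smooth_fn I U (f a)) \<Longrightarrow> smooth_fn I U (\<lambda>x. \<Sum>a\<in>A. f a x)"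
  by (induction A rule: infinite_finite_induct) (auto intro: smooth_fn_const smooth_fn_add)

lemma smooth_fn_prod:
  "open_in_coord I U \<Longrightarrow> (\<And>a. a \<in> A \<Longrightarrow> smooth_fn I U (f a)) \<Longrightarrow> smooth_fn I U (\<lambda>x. \<Prod>a\<in>A. f a x)"
  by (induction A rule: infinite_finite_induct) (auto intro: smooth_fn_const smooth_fn_mult)

lemma Ck_on_subset: "Ck_on k I U f \<Longrightarrow> V \<subseteq> U \<Longrightarrow> Ck_on k I V f"
  by (induction k arbitrary: f) (auto intro: continuous_on_subset)

lemma smooth_fn_subset: "smooth_fn I U f \<Longrightarrow> open_in_coord I V \<Longrightarrow> V \<subseteq> U \<Longrightarrow> smooth_fn I V f"
  unfolding smooth_fn_def using Ck_on_subset by blast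

lemma open_in_coord_UNIV [simp]: "open_in_coord UNIV W \<longleftrightarrow> open W"
  by (simp add: open_in_coord_def coord_space_def)

lemma smooth_fn_has_partial:
  "smooth_fn I U f \<Longrightarrow> i \<in> I \<Longrightarrow> x \<in> U \<Longrightarrow> ((\<lambda>t. f (x(i := t))) has_real_derivative partial i f x) (at (x i))"
  unfolding smooth_fn_def by (blast intro: Ck_on_has_partial)

lemma smooth_fn_continuous: "smooth_fn I U f \<Longrightarrow> continuous_on U f"
  unfolding smooth_fn_def using Ck_on_continuous by blast

lemma partial_const: "partial i (\<lambda>x. c) x = 0"
  by (simp add: partial_def)

lemma partial_coordinate: "partial i (\<lambda>x. x j) x = (if i = j then 1 else 0)"
  by (simp add: partial_def)

lemma partial_add: "smooth_fn I U f \<Longrightarrow> smooth_fn I U g \<Longrightarrow> i \<in> I \<Longrightarrow> x \<in> U \<Longrightarrow>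
    partial i (\<lambda>x. f x + g x) x = partial i f x + partial i g x"
  unfolding partial_def[of i "\<lambda>x. f x + g x"]
  by (intro DERIV_imp_deriv DERIV_add smooth_fn_has_partial)

lemma partial_mult: "smooth_fn I U f \<Longrightarrow> smooth_fn I U g \<Longrightarrow> i \<in> I \<Longrightarrow> x \<in> U \<Longrightarrow>
    partial i (\<lambda>x. f x * g x) x = partial i f x * g x + f x * partial i g x"
  unfolding partial_def[of i "\<lambda>x. f x * g x"]
  using DERIV_mult[OF smooth_fn_has_partial[of I U f i x] smooth_fn_has_partial[of I U g i x]]
  by (intro DERIV_imp_deriv) (simp add: algebra_simps)

lemma partial_uminus: "smooth_fn I U f \<Longrightarrow> i \<in> I \<Longrightarrow> x \<in> U \<Longrightarrow>
    partial i (\<lambda>x. - f x) x = - partial i f x"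
  unfolding partial_def[of i "\<lambda>x. - f x"]
  by (intro DERIV_imp_deriv DERIV_minus smooth_fn_has_partial)

lemma partial_diff: "smooth_fn I U f \<Longrightarrow> smooth_fn I U g \<Longrightarrow> i \<in> I \<Longrightarrow> x \<in> U \<Longrightarrow>
    partial i (\<lambda>x. f x - g x) x = partial i f x - partial i g x"
  unfolding partial_def[of i "\<lambda>x. f x - g x"]
  by (intro DERIV_imp_deriv DERIV_diff smooth_fn_has_partial)

lemma partial_sum:
  assumes "finite A" "open_in_coord I U" "\<And>a. a \<in> A \<Longrightarrow> smooth_fn I U (f a)" "i \<in> I" "x \<in> U"
  shows "partial i (\<lambda>x. \<Sum>a\<in>A. f a x) x = (\<Sum>a\<in>A. partial i (f a) x)"
  using assms(1,3)
  by (induction A rule: finite_induct)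
    (simp_all add: partial_const partial_add[OF _ smooth_fn_sum[OF assms(2)] assms(4,5)])

text \<open>The classical argument with a second difference: the mean value theorem, applied in
  either order, writes it as h * h times one or the other mixed derivative at a nearby point, and
  continuity of both gives equality at \<open>x\<close>.\<close>

lemma partial_commute:
  assumes f: "smooth_fn I U f" and ij: "i \<in> I" "j \<in> I" and x: "x \<in> U"
  shows "partial i (partial j f) x = partial j (partial i f) x"
proof (cases "i = j")
  case False
  define P where "P a b = x(i := a, j := b)" for a b
  have op: "open_in_coord I U" using f smooth_fn_open by blast
  then obtain T where T: "open T" "U = coord_space I \<inter> T"
    by (auto simp: open_in_coord_def openin_open)
  have cP: "continuous_on UNIV (\<lambda>(a, b). P a b)"
  proof (rule continuous_on_coordinatewise_then_product)
    show "continuous_on UNIV (\<lambda>p. (case p of (a, b) \<Rightarrow> P a b) c)" for c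
      by (cases "c = j"; cases "c = i")
        (auto simp: P_def case_prod_unfold intro: continuous_on_fst continuous_on_snd continuous_on_id continuous_on_const)
  qed
  have Pc: "P a b \<in> coord_space I" for a b
    using x T(2) ij by (auto simp: P_def coord_space_def)
  have Px: "P (x i) (x j) = x" using False by (auto simp: P_def)
  have Pi: "(P a b)(i := c) = P c b" and Pj: "(P a b)(j := c) = P a c"
    and Pii: "P a b i = a" and Pjj: "P a b j = b" for a b c
    using False by (auto simp: P_def)
  have "open ((\<lambda>(a, b). P a b) -` T)"
    using T(1) cP by (simp add: continuous_on_open_vimage)
  moreover have "(x i, x j) \<in> (\<lambda>(a, b). P a b) -` T"
    using x T(2) Px by simp
  ultimately obtain A B where "open A" "open B" "(x i, x j) \<in> A \<times> B" "A \<times> B \<subseteq> (\<lambda>(a, b). P a b) -` T"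
    by (rule open_prod_elim)
  then have AB: "open A" "open B" "x i \<in> A" "x j \<in> B" "\<And>a b. a \<in> A \<Longrightarrow> b \<in> B \<Longrightarrow> P a b \<in> T"
    by auto
  obtain e1 where e1: "e1 > 0" "\<And>a. \<bar>a - x i\<bar> < e1 \<Longrightarrow> a \<in> A"
    using AB(1,3) by (auto simp: open_dist dist_real_def)
  obtain e2 where e2: "e2 > 0" "\<And>a. \<bar>a - x j\<bar> < e2 \<Longrightarrow> a \<in> B"
    using AB(2,4) by (auto simp: open_dist dist_real_def)
  define e where "e = min e1 e2"
  have e: "e > 0" "\<And>a b. \<bar>a - x i\<bar> < e \<Longrightarrow> \<bar>b - x j\<bar> < e \<Longrightarrow> P a b \<in> U"
    using e1 e2 AB(5) Pc T(2) by (auto simp: e_def)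
  have di: "((\<lambda>s. g (P s b)) has_real_derivative partial i g (P a b)) (at a)"
    if "smooth_fn I U g" "P a b \<in> U" for g a b
    using smooth_fn_has_partial[OF that(1) ij(1) that(2)] by (simp add: Pi Pii)
  have dj: "((\<lambda>s. g (P a s)) has_real_derivative partial j g (P a b)) (at b)"
    if "smooth_fn I U g" "P a b \<in> U" for g a b
    using smooth_fn_has_partial[OF that(1) ij(2) that(2)] by (simp add: Pj Pjj)
  \<comment> \<open>The mixed second difference over a square of side h in the coordinate plane
    through \<open>x\<close>; it is symmetric in the two directions.\<close>
  define \<Delta> where "\<Delta> h = f (P (x i + h) (x j + h)) - f (P (x i + h) (x j))
      - f (P (x i) (x j + h)) + f (P (x i) (x j))" for h
  have ex1: "\<exists>a b. \<bar>a - x i\<bar> < h \<and> \<bar>b - x j\<bar> < h \<and> \<Delta> h = h * h * partial j (partial i f) (P a b)"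
    if h: "0 < h" "h < e" for h
  proof -
    have "\<exists>a>x i. a < x i + h \<and> (f (P (x i + h) (x j + h)) - f (P (x i + h) (x j))) - (f (P (x i) (x j + h)) - f (P (x i) (x j)))
       = (x i + h - x i) * (partial i f (P a (x j + h)) - partial i f (P a (x j)))"
      by (rule MVT2[where f = "\<lambda>s. f (P s (x j + h)) - f (P s (x j))"])
        (use h in \<open>auto intro!: DERIV_diff di f e\<close>)
    then obtain a where a: "x i < a" "a < x i + h"
      "\<Delta> h = h * (partial i f (P a (x j + h)) - partial i f (P a (x j)))"
      by (auto simp: \<Delta>_def algebra_simps)
    have "\<exists>b>x j. b < x j + h \<and> partial i f (P a (x j + h)) - partial i f (P a (x j))
       = (x j + h - x j) * partial j (partial i f) (P a b)"
      by (rule MVT2) (use h a in \<open>auto intro!: dj smooth_fn_partial f e ij\<close>)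
    then show ?thesis using a
      by (smt (verit) mult.assoc)
  qed
  have ex2: "\<exists>a b. \<bar>a - x i\<bar> < h \<and> \<bar>b - x j\<bar> < h \<and> \<Delta> h = h * h * partial i (partial j f) (P a b)"
    if h: "0 < h" "h < e" for h
  proof -
    have "\<exists>b>x j. b < x j + h \<and> (f (P (x i + h) (x j + h)) - f (P (x i) (x j + h))) - (f (P (x i + h) (x j)) - f (P (x i) (x j)))
       = (x j + h - x j) * (partial j f (P (x i + h) b) - partial j f (P (x i) b))"
      by (rule MVT2[where f = "\<lambda>s. f (P (x i + h) s) - f (P (x i) s)"])
        (use h in \<open>auto intro!: DERIV_diff dj f e\<close>)
    then obtain b where b: "x j < b" "b < x j + h"
      "\<Delta> h = h * (partial j f (P (x i + h) b) - partial j f (P (x i) b))"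
      by (auto simp: \<Delta>_def algebra_simps)
    have "\<exists>a>x i. a < x i + h \<and> partial j f (P (x i + h) b) - partial j f (P (x i) b)
       = (x i + h - x i) * partial i (partial j f) (P a b)"
      by (rule MVT2) (use h b in \<open>auto intro!: di smooth_fn_partial f e ij\<close>)
    then show ?thesis using b
      by (smt (verit) mult.assoc)
  qed
  have lim: "((\<lambda>p. g (P (fst p) (snd p))) \<longlongrightarrow> g x) (at (x i, x j))"
    if g: "smooth_fn I U g" for g
  proof -
    define V where "V = {p. \<bar>fst p - x i\<bar> < e \<and> \<bar>snd p - x j\<bar> < e}"
    have "open V" unfolding V_def by (auto intro!: open_Collect_conj open_Collect_less continuous_intros)
    have "continuous_on V (\<lambda>p. g (P (fst p) (snd p)))"
      by (rule continuous_on_compose2[OF smooth_fn_continuous[OF g]])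
        (use cP e in \<open>auto simp: V_def case_prod_unfold intro: continuous_on_subset\<close>)
    moreover have "(x i, x j) \<in> V" using e by (simp add: V_def)
    ultimately have "isCont (\<lambda>p. g (P (fst p) (snd p))) (x i, x j)"
      using \<open>open V\<close> continuous_on_eq_continuous_at by blast
    then show ?thesis by (simp add: isCont_def Px)
  qed
  have close: "\<exists>d>0. \<forall>a b. \<bar>a - x i\<bar> < d \<longrightarrow> \<bar>b - x j\<bar> < d \<longrightarrow> \<bar>g (P a b) - g x\<bar> < r"
    if g: "smooth_fn I U g" and r: "r > 0" for g r
  proof -
    obtain d where d: "d > 0" "\<And>p. p \<noteq> (x i, x j) \<Longrightarrow> dist p (x i, x j) < d \<Longrightarrow> dist (g (P (fst p) (snd p))) (g x) < r"
      using lim[OF g] r unfolding tendsto_iff eventually_at by (metis UNIV_I)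
    have "\<bar>g (P a b) - g x\<bar> < r" if "\<bar>a - x i\<bar> < d/2" "\<bar>b - x j\<bar> < d/2" for a b
    proof (cases "(a, b) = (x i, x j)")
      case True then show ?thesis using r Px by auto
    next
      case False
      have "dist (a, b) (x i, x j) \<le> \<bar>a - x i\<bar> + \<bar>b - x j\<bar>"
        by (simp add: dist_Pair_Pair dist_real_def sqrt_sum_squares_le_sum_abs)
      then show ?thesis using d(2)[OF False] that by (simp add: dist_real_def)
    qed
    then show ?thesis using d(1) by (intro exI[of _ "d/2"]) auto
  qed
  have "\<bar>partial i (partial j f) x - partial j (partial i f) x\<bar> < r" if r: "r > 0" for r
  proof -
    obtain d1 where d1: "d1 > 0" "\<And>a b. \<bar>a - x i\<bar> < d1 \<Longrightarrow> \<bar>b - x j\<bar> < d1 \<Longrightarrow> \<bar>partial i (partial j f) (P a b) - partial i (partial j f) x\<bar> < r/2"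
      using close[of "partial i (partial j f)" "r/2"] r smooth_fn_partial[OF smooth_fn_partial[OF f ij(2)] ij(1)] by auto
    obtain d2 where d2: "d2 > 0" "\<And>a b. \<bar>a - x i\<bar> < d2 \<Longrightarrow> \<bar>b - x j\<bar> < d2 \<Longrightarrow> \<bar>partial j (partial i f) (P a b) - partial j (partial i f) x\<bar> < r/2"
      using close[of "partial j (partial i f)" "r/2"] r smooth_fn_partial[OF smooth_fn_partial[OF f ij(1)] ij(2)] by auto
    define h where "h = min e (min d1 d2) / 2"
    have h: "0 < h" "h < e" "h < d1" "h < d2" using e d1 d2 by (auto simp: h_def)
    obtain a b where ab: "\<bar>a - x i\<bar> < h" "\<bar>b - x j\<bar> < h" "\<Delta> h = h * h * partial j (partial i f) (P a b)"
      using ex1 h by blast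
    obtain a' b' where ab': "\<bar>a' - x i\<bar> < h" "\<bar>b' - x j\<bar> < h" "\<Delta> h = h * h * partial i (partial j f) (P a' b')"
      using ex2 h by blast
    have "partial j (partial i f) (P a b) = partial i (partial j f) (P a' b')"
      using ab(3) ab'(3) h(1) by simp
    moreover have "\<bar>partial i (partial j f) (P a' b') - partial i (partial j f) x\<bar> < r/2"
      by (rule d1(2)) (use ab'(1,2) h in linarith)+
    moreover have "\<bar>partial j (partial i f) (P a b) - partial j (partial i f) x\<bar> < r/2"
      by (rule d2(2)) (use ab(1,2) h in linarith)+
    ultimately show ?thesis by linarith
  qed
  then show ?thesis
    by (metis abs_le_zero_iff eq_iff_diff_eq_0 linorder_not_less order_less_irrefl)
qed simp


section \<open>Complex-valued smooth functions and second-order product rules\<close>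

definition csmooth :: "'i set \<Rightarrow> ('i \<Rightarrow> real) set \<Rightarrow> (('i \<Rightarrow> real) \<Rightarrow> complex) \<Rightarrow> bool" where
  "csmooth I U f \<longleftrightarrow> smooth_fn I U (\<lambda>x. Re (f x)) \<and> smooth_fn I U (\<lambda>x. Im (f x))"

lemma csmooth_open: "csmooth I U f \<Longrightarrow> open_in_coord I U"
  using smooth_fn_open unfolding csmooth_def by blast

lemma csmooth_const: "open_in_coord I U \<Longrightarrow> csmooth I U (\<lambda>x. c)"
  and csmooth_of_real: "smooth_fn I U r \<Longrightarrow> csmooth I U (\<lambda>x. complex_of_real (r x))"
  and csmooth_add: "csmooth I U f \<Longrightarrow> csmooth I U g \<Longrightarrow> csmooth I U (\<lambda>x. f x + g x)"
  and csmooth_diff: "csmooth I U f \<Longrightarrow> csmooth I U g \<Longrightarrow> csmooth I U (\<lambda>x. f x - g x)"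
  and csmooth_uminus: "csmooth I U f \<Longrightarrow> csmooth I U (\<lambda>x. - f x)"
  and csmooth_mult: "csmooth I U f \<Longrightarrow> csmooth I U g \<Longrightarrow> csmooth I U (\<lambda>x. f x * g x)"
  and csmooth_cnj: "csmooth I U f \<Longrightarrow> csmooth I U (\<lambda>x. cnj (f x))"
  by (auto simp: csmooth_def smooth_fn_open intro!: smooth_fn_const smooth_fn_add smooth_fn_diff smooth_fn_uminus smooth_fn_mult)

lemma csmooth_sum:
  "open_in_coord I U \<Longrightarrow> (\<And>a. a \<in> A \<Longrightarrow> csmooth I U (f a)) \<Longrightarrow> csmooth I U (\<lambda>x. \<Sum>a\<in>A. f a x)"
  by (induction A rule: infinite_finite_induct) (auto intro: csmooth_const csmooth_add)

lemma csmooth_subset: "csmooth I U f \<Longrightarrow> open_in_coord I V \<Longrightarrow> V \<subseteq> U \<Longrightarrow> csmooth I V f"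
  unfolding csmooth_def using smooth_fn_subset by blast

lemma csmooth_cpartial: "csmooth I U f \<Longrightarrow> i \<in> I \<Longrightarrow> csmooth I U (cpartial i f)"
  unfolding csmooth_def cpartial_def by (auto intro: smooth_fn_partial)

lemma cpartial_cong:
  assumes "open_in_coord I U" "x \<in> U" "i \<in> I" "\<And>y. y \<in> U \<Longrightarrow> f y = g y"
  shows "cpartial i f x = cpartial i g x"
  unfolding cpartial_def using assms by (auto intro!: partial_cong[OF assms(1-3)])

lemma cpartial_const: "cpartial i (\<lambda>x. c) x = 0"
  and cpartial_of_real: "cpartial i (\<lambda>x. complex_of_real (r x)) x = complex_of_real (partial i r x)"
  by (auto simp: cpartial_def partial_const complex_eq_iff)

lemma cpartial_add: "csmooth I U f \<Longrightarrow> csmooth I U g \<Longrightarrow> i \<in> I \<Longrightarrow> x \<in> U \<Longrightarrow>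
    cpartial i (\<lambda>x. f x + g x) x = cpartial i f x + cpartial i g x"
  unfolding csmooth_def cpartial_def by (auto simp: complex_eq_iff partial_add[of I U])

lemma cpartial_diff: "csmooth I U f \<Longrightarrow> csmooth I U g \<Longrightarrow> i \<in> I \<Longrightarrow> x \<in> U \<Longrightarrow>
    cpartial i (\<lambda>x. f x - g x) x = cpartial i f x - cpartial i g x"
  unfolding csmooth_def cpartial_def by (auto simp: complex_eq_iff partial_diff[of I U])

lemma cpartial_uminus: "csmooth I U f \<Longrightarrow> i \<in> I \<Longrightarrow> x \<in> U \<Longrightarrow>
    cpartial i (\<lambda>x. - f x) x = - cpartial i f x"
  unfolding csmooth_def cpartial_def by (auto simp: complex_eq_iff partial_uminus[of I U])

lemma cpartial_mult: "csmooth I U f \<Longrightarrow> csmooth I U g \<Longrightarrow> i \<in> I \<Longrightarrow> x \<in> U \<Longrightarrow>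
    cpartial i (\<lambda>x. f x * g x) x = cpartial i f x * g x + f x * cpartial i g x"
  unfolding csmooth_def cpartial_def
  by (auto simp: complex_eq_iff partial_diff[of I U] partial_add[of I U] partial_mult[of I U] smooth_fn_mult)

lemma cpartial_cnj: "csmooth I U f \<Longrightarrow> i \<in> I \<Longrightarrow> x \<in> U \<Longrightarrow>
    cpartial i (\<lambda>x. cnj (f x)) x = cnj (cpartial i f x)"
  unfolding csmooth_def cpartial_def by (auto simp: complex_eq_iff partial_uminus[of I U])

lemma cpartial_cmult: "csmooth I U f \<Longrightarrow> i \<in> I \<Longrightarrow> x \<in> U \<Longrightarrow>
    cpartial i (\<lambda>x. c * f x) x = c * cpartial i f x"
  using cpartial_mult[OF csmooth_const[OF csmooth_open, of I U f c], of f i x]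
  by (simp add: cpartial_const)

lemma cpartial_sum:
  assumes "finite A" "open_in_coord I U" "\<And>a. a \<in> A \<Longrightarrow> csmooth I U (f a)" "i \<in> I" "x \<in> U"
  shows "cpartial i (\<lambda>x. \<Sum>a\<in>A. f a x) x = (\<Sum>a\<in>A. cpartial i (f a) x)"
  using assms(1,3)
  by (induction A rule: finite_induct)
    (simp_all add: cpartial_const cpartial_add[OF _ csmooth_sum[OF assms(2)] assms(4,5)])

lemma cpartial2_cong:
  assumes "open_in_coord I U" "x \<in> U" "i \<in> I" "j \<in> I" "\<And>y. y \<in> U \<Longrightarrow> f y = g y"
  shows "cpartial i (cpartial j f) x = cpartial i (cpartial j g) x"
  by (rule cpartial_cong[OF assms(1-3)]) (rule cpartial_cong[OF assms(1) _ assms(4)], use assms in auto)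

lemma cpartial2_mult:
  assumes f: "csmooth I U f" and g: "csmooth I U g" and ij: "i \<in> I" "j \<in> I" and x: "x \<in> U"
  shows "cpartial i (cpartial j (\<lambda>x. f x * g x)) x = cpartial i (cpartial j f) x * g x
    + cpartial i f x * cpartial j g x + cpartial j f x * cpartial i g x + f x * cpartial i (cpartial j g) x"
proof -
  have "cpartial i (cpartial j (\<lambda>x. f x * g x)) x
      = cpartial i (\<lambda>x. cpartial j f x * g x + f x * cpartial j g x) x"
    by (rule cpartial_cong[OF csmooth_open[OF f] x ij(1)]) (rule cpartial_mult[OF f g ij(2)])
  also have "\<dots> = cpartial i (\<lambda>x. cpartial j f x * g x) x + cpartial i (\<lambda>x. f x * cpartial j g x) x"
    by (rule cpartial_add[OF _ _ ij(1) x]) (intro csmooth_mult csmooth_cpartial f g ij)+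
  also have "cpartial i (\<lambda>x. cpartial j f x * g x) x = cpartial i (cpartial j f) x * g x + cpartial j f x * cpartial i g x"
    by (rule cpartial_mult[OF csmooth_cpartial[OF f ij(2)] g ij(1) x])
  also have "cpartial i (\<lambda>x. f x * cpartial j g x) x = cpartial i f x * cpartial j g x + f x * cpartial i (cpartial j g) x"
    by (rule cpartial_mult[OF f csmooth_cpartial[OF g ij(2)] ij(1) x])
  finally show ?thesis by (simp add: algebra_simps)
qed

lemma cpartial2_sum:
  assumes "finite A" "open_in_coord I U" "\<And>a. a \<in> A \<Longrightarrow> csmooth I U (f a)" "i \<in> I" "j \<in> I" "x \<in> U"
  shows "cpartial i (cpartial j (\<lambda>x. \<Sum>a\<in>A. f a x)) x = (\<Sum>a\<in>A. cpartial i (cpartial j (f a)) x)"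
proof -
  have "cpartial i (cpartial j (\<lambda>x. \<Sum>a\<in>A. f a x)) x = cpartial i (\<lambda>x. \<Sum>a\<in>A. cpartial j (f a) x) x"
    by (rule cpartial_cong[OF assms(2,6,4)]) (rule cpartial_sum; use assms in auto)
  also have "\<dots> = (\<Sum>a\<in>A. cpartial i (cpartial j (f a)) x)"
    by (rule cpartial_sum) (use assms csmooth_cpartial[OF _ assms(5)] in auto)
  finally show ?thesis .
qed

lemma cpartial2_add:
  assumes "csmooth I U f" "csmooth I U g" "i \<in> I" "j \<in> I" "x \<in> U"
  shows "cpartial i (cpartial j (\<lambda>x. f x + g x)) x = cpartial i (cpartial j f) x + cpartial i (cpartial j g) x"
proof -
  have "cpartial i (cpartial j (\<lambda>x. f x + g x)) x = cpartial i (\<lambda>x. cpartial j f x + cpartial j g x) x"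
    by (rule cpartial_cong[OF csmooth_open[OF assms(1)] assms(5,3)]) (rule cpartial_add[OF assms(1,2,4)])
  also have "\<dots> = cpartial i (cpartial j f) x + cpartial i (cpartial j g) x"
    by (rule cpartial_add) (use assms csmooth_cpartial in auto)
  finally show ?thesis .
qed

lemma cpartial2_cmult:
  assumes "csmooth I U f" "i \<in> I" "j \<in> I" "x \<in> U"
  shows "cpartial i (cpartial j (\<lambda>x. c * f x)) x = c * cpartial i (cpartial j f) x"
proof -
  have "cpartial i (cpartial j (\<lambda>x. c * f x)) x = cpartial i (\<lambda>x. c * cpartial j f x) x"
    by (rule cpartial_cong[OF csmooth_open[OF assms(1)] assms(4,2)]) (rule cpartial_cmult[OF assms(1,3)])
  also have "\<dots> = c * cpartial i (cpartial j f) x"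
    by (rule cpartial_cmult) (use assms csmooth_cpartial in auto)
  finally show ?thesis .
qed

text \<open>Intended for products of entries of \<open>J\<close>, \<open>dJ\<close> and
  \<open>eta\<close>: the first summand isolates the second derivative of the middle factor, the
  only place where third derivatives of \<open>J\<close> occur.\<close>

lemma cpartial2_triple:
  assumes "csmooth I U f" "csmooth I U g" "csmooth I U h" "i \<in> I" "j \<in> I" "x \<in> U"
  shows "cpartial i (cpartial j (\<lambda>x. f x * g x * h x)) x =
      f x * cpartial i (cpartial j g) x * h x + cpartial i (cpartial j f) x * g x * h x
    + f x * g x * cpartial i (cpartial j h) x
    + (cpartial i f x * cpartial j g x + cpartial j f x * cpartial i g x) * h x
    + (cpartial i f x * cpartial j h x + cpartial j f x * cpartial i h x) * g x
    + (cpartial i g x * cpartial j h x + cpartial j g x * cpartial i h x) * f x"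
  using assms
  by (simp add: cpartial2_mult[of I U] cpartial_mult[of I U] csmooth_mult) (simp add: algebra_simps)

section \<open>Almost Hermitian linear algebra\<close>

definition cm :: "real^6^6 \<Rightarrow> complex^6^6" where
  "cm A = (\<chi> a b. complex_of_real (A $ a $ b))"

definition bil :: "complex^6 \<Rightarrow> complex^6 \<Rightarrow> complex" where
  "bil u v = (\<Sum>a\<in>UNIV. u $ a * v $ a)"

definition vcnj :: "complex^6 \<Rightarrow> complex^6" where
  "vcnj v = (\<chi> a. cnj (v $ a))"

definition dirm :: "(6 \<Rightarrow> real^6^6) \<Rightarrow> complex^6 \<Rightarrow> complex^6^6" where
  "dirm D u = (\<chi> a b. \<Sum>c\<in>UNIV. u $ c * complex_of_real (D c $ a $ b))"

definition hb :: "real^6^6 \<Rightarrow> complex^6 \<Rightarrow> complex^6 \<Rightarrow> complex" where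
  "hb H u v = bil u (cm H *v v)"

text \<open>
  \<open>nij J D\<close> is the Nijenhuis tensor of \<open>J\<close> with \<open>D c\<close> in the role of the derivative of \<open>J\<close>
  along \<open>\<partial>\<^sub>c\<close>.  Quasi-integrability turns out to mean that \<open>tau\<close> is totally skew-symmetric.
\<close>

definition nij :: "real^6^6 \<Rightarrow> (6 \<Rightarrow> real^6^6) \<Rightarrow> complex^6 \<Rightarrow> complex^6 \<Rightarrow> complex^6" where
  "nij J D u v = dirm D (cm J *v u) *v v - dirm D (cm J *v v) *v u
     - cm J *v (dirm D u *v v - dirm D v *v u)"

definition tau :: "real^6^6 \<Rightarrow> real^6^6 \<Rightarrow> (6 \<Rightarrow> real^6^6) \<Rightarrow> complex^6 \<Rightarrow> complex^6 \<Rightarrow> complex^6 \<Rightarrow> complex" where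
  "tau J H D u v w = hb H (nij J D u v) w"

text \<open>\<open>tau\<close> is skew in its first two arguments by construction, so symmetrizing
  in the last two tests total skew-symmetry.\<close>

definition psi :: "real^6^6 \<Rightarrow> real^6^6 \<Rightarrow> (6 \<Rightarrow> real^6^6) \<Rightarrow> complex^6 \<Rightarrow> complex^6 \<Rightarrow> complex^6 \<Rightarrow> complex" where
  "psi J H D u v w = tau J H D u v w + tau J H D u w v"

lemma cm_mult: "cm (A ** B) = cm A ** cm B"
  by (simp add: cm_def matrix_matrix_mult_def vec_eq_iff)

lemma cm_mat [simp]: "cm (mat 1) = mat 1"
  by (simp add: cm_def mat_def vec_eq_iff)

lemma cm_uminus: "cm (- A) = - cm A"
  and cm_add: "cm (A + B) = cm A + cm B"
  by (simp_all add: cm_def vec_eq_iff)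

lemma mv_uminus: "(- A) *v x = - (A *v (x::'a::comm_ring_1^'n))"
  and mv_uminus_right: "A *v (- x) = - (A *v (x::'a::comm_ring_1^'n))"
  by (simp_all add: matrix_vector_mult_def vec_eq_iff sum_negf)

lemma mv_sum_right: "A *v (\<Sum>k\<in>K. f k) = (\<Sum>k\<in>K. A *v (f k :: 'a::comm_ring_1^'n))"
  by (induction K rule: infinite_finite_induct) (auto simp: matrix_vector_right_distrib)

lemma vcnj_simps [simp]:
  "vcnj (u + v) = vcnj u + vcnj v" "vcnj (u - v) = vcnj u - vcnj v" "vcnj (c *s u) = cnj c *s vcnj u"
  "vcnj (vcnj u) = u" "vcnj 0 = 0" "vcnj (- u) = - vcnj u"
  by (simp_all add: vcnj_def vec_eq_iff)

lemma vcnj_cm: "vcnj (cm A *v v) = cm A *v vcnj v"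
  by (simp add: vcnj_def cm_def matrix_vector_mult_def vec_eq_iff)

lemma vcnj_dirm: "vcnj (dirm D u *v v) = dirm D (vcnj u) *v vcnj v"
  by (simp add: vcnj_def dirm_def matrix_vector_mult_def vec_eq_iff)

lemma bil_simps:
  "bil (u + v) w = bil u w + bil v w" "bil u (v + w) = bil u v + bil u w"
  "bil (u - v) w = bil u w - bil v w" "bil u (v - w) = bil u v - bil u w"
  "bil (c *s u) w = c * bil u w" "bil u (c *s w) = c * bil u w"
  "bil (- u) w = - bil u w" "bil u (- w) = - bil u w"
  "bil 0 w = 0" "bil u 0 = 0"
  by (simp_all add: bil_def algebra_simps sum.distrib sum_subtractf sum_distrib_left sum_negf)

lemma bil_commute: "bil u v = bil v u"
  by (simp add: bil_def mult.commute)

lemma bil_cnj: "bil (vcnj u) (vcnj v) = cnj (bil u v)"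
  by (simp add: bil_def vcnj_def)

lemma bil_sum_left: "bil (\<Sum>k\<in>K. f k) w = (\<Sum>k\<in>K. bil (f k) w)"
  by (induction K rule: infinite_finite_induct) (auto simp: bil_simps)

lemma bil_axis [simp]: "bil (axis a 1) v = v $ a" "bil v (axis a 1) = v $ a"
  by (simp_all add: bil_def axis_def if_distrib[where f = "\<lambda>x. _ * x"] if_distrib[where f = "\<lambda>x. x * _"] cong: if_cong)

lemma bil_cm: "bil u (cm A *v v) = bil (cm (transpose A) *v u) v"
  unfolding bil_def cm_def matrix_vector_mult_def
  by (simp add: sum_distrib_left sum_distrib_right transpose_def mult_ac)
    (rule sum.swap)

lemma hb_simps:
  "hb H (u + v) w = hb H u w + hb H v w" "hb H u (v + w) = hb H u v + hb H u w"
  "hb H (u - v) w = hb H u w - hb H v w" "hb H u (v - w) = hb H u v - hb H u w"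
  "hb H (c *s u) w = c * hb H u w" "hb H u (c *s w) = c * hb H u w"
  "hb H (- u) w = - hb H u w" "hb H u (- w) = - hb H u w"
  "hb H 0 w = 0" "hb H u 0 = 0"
  by (simp_all add: hb_def bil_simps matrix_vector_right_distrib matrix_vector_mult_diff_distrib
      vector_scalar_commute mv_uminus_right)

lemma hb_cnj: "hb H (vcnj u) (vcnj v) = cnj (hb H u v)"
  unfolding hb_def using bil_cnj[of u "cm H *v v"] by (simp add: vcnj_cm)

lemma hb_sum_right: "hb H w (\<Sum>k\<in>K. f k) = (\<Sum>k\<in>K. hb H w (f k))"
  by (simp add: hb_def mv_sum_right bil_commute[of w] bil_sum_left)

lemma dirm_simps:
  "dirm D (u + v) = dirm D u + dirm D v" "dirm D (u - v) = dirm D u - dirm D v"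
  "dirm D (- u) = - dirm D u" "dirm D 0 = 0"
  "dirm D (c *s u) *v w = c *s (dirm D u *v w)"
  by (simp_all add: dirm_def vec_eq_iff algebra_simps sum.distrib sum_subtractf sum_negf
      matrix_vector_mult_def sum_distrib_left)

lemma dirm_mv: "dirm D u *v v = (\<Sum>c\<in>UNIV. u $ c *s (cm (D c) *v v))"
  unfolding dirm_def cm_def matrix_vector_mult_def vec_eq_iff
  by (auto simp: sum_distrib_right sum_distrib_left mult_ac intro: sum.swap)

lemmas mvs = matrix_vector_right_distrib matrix_vector_mult_diff_distrib vector_scalar_commute
  mv_uminus_right mv_uminus matrix_vector_mult_add_rdistrib matrix_vector_mult_diff_rdistrib dirm_simps

lemma vs_alg: "c *s (u + v) = c *s u + c *s v" "c *s (u - v) = c *s u - c *s v"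
   "c *s (- u) = - (c *s u)" "c *s (d *s u) = (c * d) *s u" "(- c) *s u = - (c *s u)"
  for u v :: "complex^'n"
  by (simp_all add: vec_eq_iff algebra_simps)

lemma nij_simps:
  "nij J D (u + v) w = nij J D u w + nij J D v w" "nij J D u (v + w) = nij J D u v + nij J D u w"
  "nij J D (c *s u) w = c *s nij J D u w" "nij J D u (c *s w) = c *s nij J D u w"
  by (simp_all add: nij_def mvs vs_alg algebra_simps)

lemma nij_zero: "nij J D 0 w = 0" "nij J D u 0 = 0"
  by (simp_all add: nij_def dirm_simps matrix_vector_mult_def vec_eq_iff dirm_def)

lemma nij_cnj: "nij J D (vcnj u) (vcnj v) = vcnj (nij J D u v)"
  by (simp add: nij_def vcnj_cm vcnj_dirm)

lemma psi_simps:
  "psi J H D (u + u') v w = psi J H D u v w + psi J H D u' v w"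
  "psi J H D u (v + v') w = psi J H D u v w + psi J H D u v' w"
  "psi J H D u v (w + w') = psi J H D u v w + psi J H D u v w'"
  "psi J H D (c *s u) v w = c * psi J H D u v w"
  "psi J H D u (c *s v) w = c * psi J H D u v w"
  "psi J H D u v (c *s w) = c * psi J H D u v w"
  "psi J H D 0 v w = 0" "psi J H D u 0 w = 0" "psi J H D u v 0 = 0"
  by (simp_all add: psi_def tau_def nij_simps hb_simps algebra_simps nij_zero)

lemma psi_sum:
  "psi J H D (\<Sum>k\<in>K. f k) v w = (\<Sum>k\<in>K. psi J H D (f k) v w)"
  "psi J H D u (\<Sum>k\<in>K. f k) w = (\<Sum>k\<in>K. psi J H D u (f k) w)"
  "psi J H D u v (\<Sum>k\<in>K. f k) = (\<Sum>k\<in>K. psi J H D u v (f k))"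
  by (induction K rule: infinite_finite_induct) (auto simp: psi_simps)

lemma psi_cnj: "psi J H D (vcnj u) (vcnj v) (vcnj w) = cnj (psi J H D u v w)"
  by (simp add: psi_def tau_def nij_cnj hb_cnj)

section \<open>Vectors of type (0,1) and (1,0), and the type decomposition of
  \<open>tau\<close>\<close>

definition T01 :: "real^6^6 \<Rightarrow> complex^6 \<Rightarrow> bool" where
  "T01 J v \<longleftrightarrow> cm J *v v = (- \<i>) *s v"

definition T10 :: "real^6^6 \<Rightarrow> complex^6 \<Rightarrow> bool" where
  "T10 J v \<longleftrightarrow> cm J *v v = \<i> *s v"

definition p01 :: "real^6^6 \<Rightarrow> complex^6 \<Rightarrow> complex^6" where
  "p01 J v = (1/2) *s (v + \<i> *s (cm J *v v))"

lemma T10_vcnj: "T10 J (vcnj v) \<longleftrightarrow> T01 J v" and T01_vcnj: "T01 J (vcnj v) \<longleftrightarrow> T10 J v"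
proof -
  have "T10 J (vcnj v)" if "T01 J v" for v
    using that by (simp add: T10_def T01_def vcnj_cm[symmetric] vs_alg)
  moreover have "T01 J (vcnj v)" if "T10 J v" for v
    using that by (simp add: T10_def T01_def vcnj_cm[symmetric] vs_alg)
  ultimately show "T10 J (vcnj v) \<longleftrightarrow> T01 J v" "T01 J (vcnj v) \<longleftrightarrow> T10 J v"
    by (metis vcnj_simps(4))+
qed

lemma T01_closed:
  "T01 J u \<Longrightarrow> T01 J v \<Longrightarrow> T01 J (u + v)" "T01 J u \<Longrightarrow> T01 J v \<Longrightarrow> T01 J (u - v)"
  "T01 J u \<Longrightarrow> T01 J (c *s u)" "T01 J 0"
  by (auto simp: T01_def mvs vs_alg mult.commute vec_eq_iff)

lemma T01_sum: "(\<And>k. k \<in> K \<Longrightarrow> T01 J (f k)) \<Longrightarrow> T01 J (\<Sum>k\<in>K. f k)"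
  by (induction K rule: infinite_finite_induct) (auto simp: T01_closed)

lemma psi_T01_span:
  fixes Z :: "3 \<Rightarrow> complex^6"
  assumes "\<And>v. T01 J v \<Longrightarrow> \<exists>c. v = (\<Sum>k\<in>UNIV. c k *s Z k)"
    and "\<And>k l m. psi J H D (Z k) (Z l) (Z m) = 0" "T01 J u" "T01 J v" "T01 J w"
  shows "psi J H D u v w = 0"
proof -
  obtain a b c where "u = (\<Sum>k\<in>UNIV. a k *s Z k)" "v = (\<Sum>k\<in>UNIV. b k *s Z k)" "w = (\<Sum>k\<in>UNIV. c k *s Z k)"
    using assms by meson
  then show ?thesis by (simp add: psi_sum psi_simps assms(2))
qed

locale hermitian_structure =
  fixes J H :: "real^6^6"
  assumes ac: "almost_complex J" and pos: "positive_11 J H"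
begin

lemma JJ: "cm J *v (cm J *v v) = - v"
proof -
  have "cm J ** cm J = - mat 1"
    using ac unfolding almost_complex_def by (metis cm_mult cm_uminus cm_mat)
  then show ?thesis by (simp add: matrix_vector_mul_assoc mv_uminus)
qed

lemma hb_skew: "hb H u v = - hb H v u"
proof -
  have "transpose H = - H" using pos by (simp add: positive_11_def)
  then have "hb H u v = bil (- (cm H *v u)) v"
    by (simp add: hb_def bil_cm cm_uminus mv_uminus)
  then show ?thesis by (simp add: hb_def bil_simps bil_commute)
qed

lemma hb_JJ: "hb H (cm J *v u) (cm J *v v) = hb H u v"
proof -
  have "transpose J ** H ** J = H" using pos by (simp add: positive_11_def)
  then have "cm (transpose J) *v (cm H *v (cm J *v v)) = cm H *v v"
    by (metis cm_mult matrix_vector_mul_assoc)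
  then show ?thesis
    unfolding hb_def using bil_cm[of "cm H *v (cm J *v v)" J u] by (simp add: bil_commute)
qed

lemma hb_J: "hb H (cm J *v u) v = - hb H u (cm J *v v)"
  using hb_JJ[of u "cm J *v v"] by (simp add: JJ hb_simps minus_equation_iff)

lemma hb_T01: "T01 J u \<Longrightarrow> T01 J v \<Longrightarrow> hb H u v = 0"
  using hb_JJ[of u v] by (simp add: T01_def hb_simps)

lemma hb_T10: "T10 J u \<Longrightarrow> T10 J v \<Longrightarrow> hb H u v = 0"
  using hb_JJ[of u v] by (simp add: T10_def hb_simps)

text \<open>The real and imaginary parts of \<open>v\<close> lie in the kernel of the real matrix
  \<open>H\<close>, which is trivial because eta(w, J w) > 0 for w nonzero.\<close>

lemma hb_nondeg:
  assumes "\<And>u. hb H u v = 0"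
  shows "v = 0"
proof -
  define x y where "x = (\<chi> a. Re (v $ a))" and "y = (\<chi> a. Im (v $ a))"
  have v: "cm H *v v = 0"
    using assms[of "axis _ 1"] by (simp add: hb_def vec_eq_iff)
  have "H *v x = 0" "H *v y = 0"
  proof -
    have "(H *v x) $ a = Re ((cm H *v v) $ a)" "(H *v y) $ a = Im ((cm H *v v) $ a)" for a
      by (simp_all add: cm_def matrix_vector_mult_def x_def y_def)
    then show "H *v x = 0" "H *v y = 0" using v by (simp_all add: vec_eq_iff)
  qed
  moreover have "w = 0" if w: "H *v w = 0" for w
  proof (rule ccontr)
    assume "w \<noteq> 0"
    then have "w \<bullet> (H *v (J *v w)) > 0" using pos by (simp add: positive_11_def)
    moreover have "w \<bullet> (H *v (J *v w)) = (transpose H *v w) \<bullet> (J *v w)"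
      by (simp add: dot_lmul_matrix[symmetric] )
    moreover have "transpose H *v w = - (H *v w)" using pos by (simp add: positive_11_def mv_uminus)
    ultimately show False using w by simp
  qed
  ultimately have "x = 0" "y = 0" by auto
  then show ?thesis by (simp add: x_def y_def vec_eq_iff complex_eq_iff)
qed

lemma hb_surj: "\<exists>E. \<forall>v. hb H v E = bil v \<alpha>"
proof -
  have "\<forall>x. cm H *v x = 0 \<longrightarrow> x = 0"
    using hb_nondeg by (metis hb_def bil_simps(10))
  then obtain B where "B ** cm H = mat 1"
    using matrix_left_invertible_ker by blast
  then have "cm H ** B = mat 1"
    using matrix_left_right_inverse by blast
  then have "cm H *v (B *v \<alpha>) = \<alpha>"
    by (simp add: matrix_vector_mul_assoc)
  then show ?thesis unfolding hb_def by metis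
qed

lemma T01_p01: "T01 J (p01 J v)"
  by (simp add: T01_def p01_def mvs JJ vs_alg)

lemma T01_T10_decomp: "\<exists>a b. v = a + b \<and> T01 J a \<and> T10 J b"
proof (intro exI conjI)
  show "v = p01 J v + vcnj (p01 J (vcnj v))"
    by (simp add: p01_def vcnj_cm) (simp add: vec_eq_iff algebra_simps)
  show "T01 J (p01 J v)" "T10 J (vcnj (p01 J (vcnj v)))" by (simp_all add: T01_p01 T10_vcnj)
qed

end

text \<open>\<open>DJ\<close> is the derivative of \<open>J ** J = - mat 1\<close>. Derivatives of
  eta are absent since the Nijenhuis tensor involves only those of \<open>J\<close>; eta enters
  \<open>tau\<close> to order zero.\<close>

locale hermitian_1jet = hermitian_structure +
  fixes D :: "6 \<Rightarrow> real^6^6"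
  assumes DJ: "D c ** J + J ** D c = 0"
begin

lemma dirm_J: "dirm D u *v (cm J *v v) = - (cm J *v (dirm D u *v v))"
proof -
  have "cm (D c) *v (cm J *v v) = - (cm J *v (cm (D c) *v v))" for c
  proof -
    have "D c ** J = - (J ** D c)" using DJ by (simp add: eq_neg_iff_add_eq_0)
    then have "cm (D c) ** cm J = - (cm J ** cm (D c))" by (metis cm_mult cm_uminus)
    then show ?thesis by (simp add: matrix_vector_mul_assoc mv_uminus)
  qed
  then show ?thesis
    by (simp add: dirm_mv mv_sum_right vector_scalar_commute vs_alg sum_negf)
qed

text \<open>\<open>D c\<close> anticommutes with \<open>J\<close> and hence sends (0,1)-vectors to
  (1,0)-vectors, so the two halves of the formula for \<open>nij\<close> contribute equally.\<close>

lemma nij_T01: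
  assumes "T01 J u" "T01 J v"
  shows "nij J D u v = (- 2 * \<i>) *s (dirm D u *v v - dirm D v *v u)"
proof -
  have 1: "cm J *v (dirm D a *v b) = \<i> *s (dirm D a *v b)" if "T01 J b" for a b
    using dirm_J[of a b] that by (simp add: T01_def mvs vs_alg)
  show ?thesis
    using assms 1[OF assms(1), of v] 1[OF assms(2), of u]
    by (simp add: nij_def T01_def mvs vs_alg) (simp add: vec_eq_iff algebra_simps)
qed

text \<open>The Nijenhuis tensor is antilinear in each argument with respect to \<open>J\<close>;
  arguments of opposite types force its value into both eigenspaces of \<open>J\<close>.\<close>

lemma nij_mixed:
  assumes "T01 J u" "T10 J v"
  shows "nij J D u v = 0" "nij J D v u = 0"
proof -
  have 1: "cm J *v (dirm D a *v u) = \<i> *s (dirm D a *v u)" for a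
    using dirm_J[of a u] assms by (simp add: T01_def mvs vs_alg)
  have 2: "cm J *v (dirm D a *v v) = - \<i> *s (dirm D a *v v)" for a
    using dirm_J[of a v] assms by (simp add: T10_def mvs vs_alg minus_equation_iff)
  show "nij J D u v = 0" "nij J D v u = 0"
    using assms 1[of v] 2[of u]
    by (simp_all add: nij_def T01_def T10_def mvs vs_alg)
qed

lemma nij_T10: "T01 J u \<Longrightarrow> T01 J v \<Longrightarrow> T10 J (nij J D u v)"
proof -
  assume uv: "T01 J u" "T01 J v"
  have 1: "cm J *v (dirm D a *v b) = \<i> *s (dirm D a *v b)" if "T01 J b" for a b
    using dirm_J[of a b] that by (simp add: T01_def mvs vs_alg)
  show ?thesis unfolding nij_T01[OF uv] T10_def
    using 1[OF uv(1), of v] 1[OF uv(2), of u] by (simp add: mvs vs_alg mult.commute)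
qed

lemma tau_mixed:
  assumes "T01 J u \<and> T01 J v \<and> T10 J w \<or> T01 J u \<and> T10 J v \<or> T10 J u \<and> T01 J v \<or> T10 J u \<and> T10 J v \<and> T01 J w"
  shows "tau J H D u v w = 0"
  using assms unfolding tau_def
proof (elim disjE conjE)
  assume *: "T10 J u" "T10 J v" "T01 J w"
  have "T01 J (nij J D u v)"
    using nij_T10[of "vcnj u" "vcnj v"] * by (simp add: T01_vcnj nij_cnj T10_vcnj)
  then show "hb H (nij J D u v) w = 0" using hb_T01 * by blast
qed (auto simp: nij_T10 hb_T10 nij_mixed hb_simps)

lemma psi_mixed:
  assumes "\<not> (T01 J u \<and> T01 J v \<and> T01 J w)" "\<not> (T10 J u \<and> T10 J v \<and> T10 J w)"
    "T01 J u \<or> T10 J u" "T01 J v \<or> T10 J v" "T01 J w \<or> T10 J w"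
  shows "psi J H D u v w = 0"
proof -
  have "tau J H D u v w = 0" "tau J H D u w v = 0" by (rule tau_mixed; use assms in blast)+
  then show ?thesis by (simp add: psi_def)
qed

text \<open>Arguments of mixed type contribute nothing by \<open>psi_mixed\<close>, and the values
  on (1,0)-vectors are conjugates of those on (0,1)-vectors.\<close>

lemma psi_vanishes:
  assumes 0: "\<And>u v w. T01 J u \<Longrightarrow> T01 J v \<Longrightarrow> T01 J w \<Longrightarrow> psi J H D u v w = 0"
  shows "psi J H D u v w = 0"
proof -
  have 1: "psi J H D u v w = 0" if "T10 J u" "T10 J v" "T10 J w" for u v w
    using 0[of "vcnj u" "vcnj v" "vcnj w"] that by (simp add: T01_vcnj psi_cnj)
  have 2: "psi J H D u v w = 0" if "T01 J u \<or> T10 J u" "T01 J v \<or> T10 J v" "T01 J w \<or> T10 J w" for u v w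
    using 0[of u v w] 1[of u v w] psi_mixed[of u v w] that by argo
  obtain a b where u: "u = a + b" "T01 J a" "T10 J b" using T01_T10_decomp by blast
  obtain c d where v: "v = c + d" "T01 J c" "T10 J d" using T01_T10_decomp by blast
  obtain e f where w: "w = e + f" "T01 J e" "T10 J f" using T01_T10_decomp by blast
  show ?thesis unfolding u v w by (simp add: psi_simps 2 u(2,3) v(2,3) w(2,3))
qed

text \<open>
  If the \<open>Z\<^sub>l\<close> are (0,1)-fields and \<open>dZ c l\<close> their derivatives, then differentiating
  \<open>J Z\<^sub>l = -i Z\<^sub>l\<close> expresses \<open>tau\<close> through the bracket \<open>[Z\<^sub>k, Z\<^sub>l]\<close>.
\<close>

lemma tau_bracket:
  assumes "\<And>l. T01 J (Z l)"
    and "\<And>c l. cm (D c) *v Z l + cm J *v dZ c l = (- \<i>) *s dZ c l"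
  shows "tau J H D (Z k) (Z l) (Z m) = - 4 * hb H (\<Sum>c\<in>UNIV. Z k $ c *s dZ c l - Z l $ c *s dZ c k) (Z m)"
proof -
  define w where "w = (\<Sum>c\<in>UNIV. Z k $ c *s dZ c l - Z l $ c *s dZ c k)"
  have h: "cm (D c) *v Z l = (- \<i>) *s dZ c l - cm J *v dZ c l" for c l
    using assms(2)[of c l] by (metis add_diff_cancel_right')
  have d: "dirm D (Z k) *v Z l = - (\<Sum>c\<in>UNIV. Z k $ c *s (cm J *v dZ c l + \<i> *s dZ c l))" for k l
    unfolding dirm_mv sum_negf[symmetric] h by (intro sum.cong refl) (simp add: vec_eq_iff algebra_simps)
  have "dirm D (Z k) *v Z l - dirm D (Z l) *v Z k = - (cm J *v w + \<i> *s w)"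
    unfolding d w_def
    by (simp add: mv_sum_right mvs vec_eq_iff sum_negf sum_subtractf sum.distrib sum_distrib_left algebra_simps)
  then have "tau J H D (Z k) (Z l) (Z m) = 2 * \<i> * hb H (cm J *v w + \<i> *s w) (Z m)"
    by (simp add: tau_def nij_T01 assms(1) hb_simps distrib_left mult.assoc)
  also have "hb H (cm J *v w) (Z m) = \<i> * hb H w (Z m)"
    using assms(1)[of m] by (simp add: hb_J T01_def hb_simps)
  ultimately have "tau J H D (Z k) (Z l) (Z m) = - 4 * hb H w (Z m)"
    by (simp add: hb_simps algebra_simps)
  then show ?thesis by (simp add: w_def)
qed

end

section \<open>Coframings and the matrix N\<close>

lemma exhaust_6: "(i::6) = 0 \<or> i = 1 \<or> i = 2 \<or> i = 3 \<or> i = 4 \<or> i = 5"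
proof (induct i)
  case (of_int z)
  then have "0 \<le> z" "z < 6" by simp_all
  then have "z = 0 \<or> z = 1 \<or> z = 2 \<or> z = 3 \<or> z = 4 \<or> z = 5" by arith
  then show ?case by auto
qed

lemma UNIV_6: "UNIV = {0, 1, 2, 3, 4, 5 :: 6}"
  using exhaust_6 by auto

lemma sum_6: "(\<Sum>i\<in>UNIV. f (i::6)) = f 0 + f 1 + f 2 + f 3 + f 4 + f 5"
  unfolding UNIV_6 by (simp add: add.assoc)

lemma add_3: "(1::3) + 1 = 2" "(1::3) + 2 = 3" "(2::3) + 1 = 3" "(2::3) + 2 = 1" "(3::3) + 1 = 1" "(3::3) + 2 = 2" "(0::3) = 3" "(4::3) = 1" "(5::3) = 2"
  by simp_all

lemma bil_zero: "(\<And>v. bil v w = 0) \<Longrightarrow> w = 0"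
  using bil_axis(1)[of _ w] by (simp add: vec_eq_iff)

context hermitian_structure
begin

text \<open>Raising the index of \<open>\<alpha> i\<close> with eta yields a (0,1)-vector. That
  these vectors also form the dual frame of the conjugate forms is where conformal unitarity enters;
  it lets the same frame evaluate both the 2-forms d alpha and \<open>tau\<close>.\<close>

lemma frame_exists:
  fixes \<alpha> :: "3 \<Rightarrow> complex^6" and \<mu> :: real
  assumes \<mu>: "\<mu> > 0"
    and lin: "\<And>i v. bil (cm J *v v) (\<alpha> i) = \<i> * bil v (\<alpha> i)"
    and indep: "\<And>c. (\<Sum>i\<in>UNIV. c i *s \<alpha> i) = 0 \<Longrightarrow> \<forall>i. c i = 0"
    and eta: "\<And>u v. hb H u v = complex_of_real \<mu> * (\<i> / 2) * (\<Sum>i\<in>UNIV. bil u (\<alpha> i) * bil v (vcnj (\<alpha> i)) - bil u (vcnj (\<alpha> i)) * bil v (\<alpha> i))"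
  shows "\<exists>E :: 3 \<Rightarrow> complex^6. (\<forall>i. T01 J (E i)) \<and>
    (\<forall>i j. bil (E i) (vcnj (\<alpha> j)) = (if i = j then 1 else 0)) \<and>
    (\<forall>i v. hb H v (E i) = complex_of_real \<mu> * (\<i> / 2) * bil v (\<alpha> i)) \<and>
    (\<forall>v. T01 J v \<longrightarrow> v = (\<Sum>k\<in>UNIV. bil v (vcnj (\<alpha> k)) *s E k))"
proof -
  define \<kappa> where "\<kappa> = complex_of_real \<mu> * (\<i> / 2)"
  have \<kappa>: "\<kappa> \<noteq> 0" using \<mu> by (simp add: \<kappa>_def)
  have "\<forall>i. \<exists>E. \<forall>v. hb H v E = bil v (\<kappa> *s \<alpha> i)" using hb_surj by blast
  then obtain E where E: "\<And>i v. hb H v (E i) = \<kappa> * bil v (\<alpha> i)" by (metis bil_simps(6))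
  have T: "T01 J (E i)" for i
  proof -
    have "hb H v (cm J *v E i - (- \<i>) *s E i) = 0" for v
      using hb_J[of v "E i"] lin by (simp add: hb_simps E) (metis add.commute ab_left_minus minus_equation_iff mult.left_commute)
    then show ?thesis using hb_nondeg unfolding T01_def by (metis eq_iff_diff_eq_0)
  qed
  have z: "bil v (\<alpha> j) = 0" if "T01 J v" for v j
    using lin[of v j] that by (simp add: T01_def bil_simps)
  \<comment> \<open>Expanding eta(v, E i) in the coframing writes \<open>\<alpha> i\<close> as a
    combination of the \<open>\<alpha> j\<close> whose coefficients are these pairings; independence
    identifies them.\<close>
  have d: "bil (E i) (vcnj (\<alpha> j)) = (if i = j then 1 else 0)" for i j
  proof -
    have "bil v (\<alpha> i) = (\<Sum>j\<in>UNIV. bil v (\<alpha> j) * bil (E i) (vcnj (\<alpha> j)))" for v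
    proof -
      have "hb H v (E i) = \<kappa> * (\<Sum>j\<in>UNIV. bil v (\<alpha> j) * bil (E i) (vcnj (\<alpha> j)))"
        unfolding eta \<kappa>_def by (simp add: z[OF T])
      then show ?thesis using \<kappa> by (simp add: E)
    qed
    note exp = this
    have "bil v (\<Sum>j\<in>UNIV. ((if i = j then 1 else 0) - bil (E i) (vcnj (\<alpha> j))) *s \<alpha> j) = 0" for v
    proof -
      have "bil v (\<Sum>j\<in>UNIV. ((if i = j then 1 else 0) - bil (E i) (vcnj (\<alpha> j))) *s \<alpha> j)
         = (\<Sum>j\<in>UNIV. (if i = j then bil v (\<alpha> j) else 0) - bil v (\<alpha> j) * bil (E i) (vcnj (\<alpha> j)))"
        unfolding bil_commute[of v] bil_sum_left bil_simps by (intro sum.cong refl) (auto simp: algebra_simps)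
      also have "\<dots> = 0" using exp[of v] by (simp add: sum_subtractf)
      finally show ?thesis .
    qed
    then have "(\<Sum>j\<in>UNIV. ((if i = j then 1 else 0) - bil (E i) (vcnj (\<alpha> j))) *s \<alpha> j) = 0"
      by (rule bil_zero)
    then have "\<forall>j. (if i = j then 1 else 0) - bil (E i) (vcnj (\<alpha> j)) = 0"
      by (rule indep)
    then show ?thesis by (metis eq_iff_diff_eq_0)
  qed
  have c: "v = (\<Sum>k\<in>UNIV. bil v (vcnj (\<alpha> k)) *s E k)" if v: "T01 J v" for v
  proof -
    define r where "r = v - (\<Sum>k\<in>UNIV. bil v (vcnj (\<alpha> k)) *s E k)"
    have Tr: "T01 J r" unfolding r_def by (intro T01_closed T01_sum v T)
    have br: "bil r (vcnj (\<alpha> k)) = 0" for k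
    proof -
      have "bil r (vcnj (\<alpha> k)) = bil v (vcnj (\<alpha> k)) - (\<Sum>j\<in>UNIV. if j = k then bil v (vcnj (\<alpha> j)) else 0)"
        unfolding r_def bil_simps bil_sum_left d by (intro arg_cong2[where f = "(-)"] sum.cong refl) auto
      then show ?thesis by simp
    qed
    have "hb H u r = 0" for u
      unfolding eta z[OF Tr] br by simp
    then have "r = 0" by (rule hb_nondeg)
    then show ?thesis unfolding r_def by (metis eq_iff_diff_eq_0)
  qed
  show ?thesis
    using T d E c unfolding \<kappa>_def by blast
qed

end

context hermitian_1jet
begin

text \<open>\<open>dal i u v\<close> is \<open>d\<alpha>\<^sup>i(u, v)\<close> when \<open>d\<alpha> c i\<close> is the derivative of \<open>\<alpha>\<^sup>i\<close> along \<open>\<partial>\<^sub>c\<close>.\<close>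

lemma tau_frame:
  fixes \<alpha> E :: "3 \<Rightarrow> complex^6" and \<mu> :: real and d\<alpha> :: "6 \<Rightarrow> 3 \<Rightarrow> complex^6"
  defines "dal i u v \<equiv> \<Sum>c\<in>UNIV. u $ c * bil v (d\<alpha> c i) - v $ c * bil u (d\<alpha> c i)"
  assumes d: "\<And>c i v. bil (cm J *v v) (d\<alpha> c i) + bil (cm (D c) *v v) (\<alpha> i) = \<i> * bil v (d\<alpha> c i)"
    and E: "\<And>i. T01 J (E i)" "\<And>i v. hb H v (E i) = complex_of_real \<mu> * (\<i> / 2) * bil v (\<alpha> i)"
  shows "tau J H D (E k) (E l) (E m) = 2 * \<i> * complex_of_real \<mu> * dal m (E k) (E l)"
proof -
  have 1: "bil (cm (D c) *v v) (\<alpha> i) = 2 * \<i> * bil v (d\<alpha> c i)" if "T01 J v" for v c i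
    using d[of v c i] that by (simp add: T01_def bil_simps algebra_simps)
  have 2: "bil (dirm D u *v v) (\<alpha> i) = 2 * \<i> * (\<Sum>c\<in>UNIV. u $ c * bil v (d\<alpha> c i))" if "T01 J v" for u v i
    by (simp add: dirm_mv bil_sum_left bil_simps 1[OF that] sum_distrib_left mult_ac)
  show ?thesis
    by (simp add: tau_def nij_T01[OF E(1,1)] E(2) bil_simps 2[OF E(1)] dal_def sum_subtractf algebra_simps)
qed

end

definition avec :: "(3 \<Rightarrow> pt \<Rightarrow> 6 \<Rightarrow> complex) \<Rightarrow> pt \<Rightarrow> 3 \<Rightarrow> complex^6" where
  "avec \<alpha> x i = (\<chi> a. \<alpha> i x a)"

definition dvec :: "(3 \<Rightarrow> pt \<Rightarrow> 6 \<Rightarrow> complex) \<Rightarrow> pt \<Rightarrow> 6 \<Rightarrow> 3 \<Rightarrow> complex^6" where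
  "dvec \<alpha> x c i = (\<chi> a. cpartial c (\<lambda>y. \<alpha> i y a) x)"

definition dal :: "(3 \<Rightarrow> pt \<Rightarrow> 6 \<Rightarrow> complex) \<Rightarrow> pt \<Rightarrow> 3 \<Rightarrow> complex^6 \<Rightarrow> complex^6 \<Rightarrow> complex" where
  "dal \<alpha> x i u v = (\<Sum>c\<in>UNIV. u $ c * bil v (dvec \<alpha> x c i) - v $ c * bil u (dvec \<alpha> x c i))"

definition dJ :: "cu_section \<Rightarrow> pt \<Rightarrow> 6 \<Rightarrow> real^6^6" where
  "dJ s x c = (\<chi> a b. partial c (\<lambda>y. s y (Inl (a, b))) x)"

lemma dal_simps:
  "dal \<alpha> x i (\<Sum>k\<in>K. f k) v = (\<Sum>k\<in>K. dal \<alpha> x i (f k) v)"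
  "dal \<alpha> x i u (\<Sum>k\<in>K. f k) = (\<Sum>k\<in>K. dal \<alpha> x i u (f k))"
  "dal \<alpha> x i (c *s u) v = c * dal \<alpha> x i u v"
  "dal \<alpha> x i u (c *s v) = c * dal \<alpha> x i u v"
proof -
  have a: "dal \<alpha> x i (u + u') v = dal \<alpha> x i u v + dal \<alpha> x i u' v" "dal \<alpha> x i v (u + u') = dal \<alpha> x i v u + dal \<alpha> x i v u'"
    "dal \<alpha> x i 0 v = 0" "dal \<alpha> x i v 0 = 0" for u u' v
    by (simp_all add: dal_def bil_simps algebra_simps sum.distrib sum_subtractf)
  show "dal \<alpha> x i (\<Sum>k\<in>K. f k) v = (\<Sum>k\<in>K. dal \<alpha> x i (f k) v)"
   "dal \<alpha> x i u (\<Sum>k\<in>K. f k) = (\<Sum>k\<in>K. dal \<alpha> x i u (f k))"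
    by (induction K rule: infinite_finite_induct) (simp_all add: a)
  show "dal \<alpha> x i (c *s u) v = c * dal \<alpha> x i u v"
    "dal \<alpha> x i u (c *s v) = c * dal \<alpha> x i u v"
    by (simp_all add: dal_def bil_simps sum_distrib_left algebra_simps)
qed

lemma dal_skew: "dal \<alpha> x i u v = - dal \<alpha> x i v u"
  by (simp add: dal_def sum_negf[symmetric])

lemma part02_dal: "part02 J (ext_deriv (\<alpha> i) x) a b = dal \<alpha> x i (p01 J (axis a 1)) (p01 J (axis b 1))"
proof -
  have p: "proj01 J c a = p01 J (axis a 1) $ c" for c a
    by (simp add: proj01_def p01_def cm_def matrix_vector_mult_def axis_def if_distrib[where f = "\<lambda>x. _ * x"] cong: if_cong)
  define u v where "u = p01 J (axis a 1)" and "v = p01 J (axis b 1)"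
  have "part02 J (ext_deriv (\<alpha> i) x) a b = (\<Sum>c\<in>UNIV. \<Sum>e\<in>UNIV. u $ c * (v $ e * cpartial c (\<lambda>y. \<alpha> i y e) x))
     - (\<Sum>c\<in>UNIV. \<Sum>e\<in>UNIV. u $ c * (v $ e * cpartial e (\<lambda>y. \<alpha> i y c) x))"
    by (simp add: part02_def ext_deriv_def p u_def v_def sum_subtractf[symmetric] algebra_simps)
  also have "(\<Sum>c\<in>UNIV. \<Sum>e\<in>UNIV. u $ c * (v $ e * cpartial e (\<lambda>y. \<alpha> i y c) x)) = (\<Sum>e\<in>UNIV. \<Sum>c\<in>UNIV. v $ e * (u $ c * cpartial e (\<lambda>y. \<alpha> i y c) x))"
    by (subst sum.swap) (simp add: algebra_simps)
  finally show ?thesis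
    by (simp add: dal_def dvec_def bil_def u_def v_def sum_subtractf sum_distrib_left)
qed

lemma local_section_csmooth:
  assumes "local_section F W s"
  shows "csmooth UNIV W (\<lambda>y. complex_of_real (s y b))"
  using assms by (auto simp: local_section_def smooth_map_def intro: csmooth_of_real)

lemma section_hermitian_1jet:
  assumes s: "local_section cu_fibre W s" and x: "x \<in> W"
  shows "hermitian_1jet (J_of (s x)) (eta_of (s x)) (dJ s x)"
proof
  have W: "open W" and F: "\<And>y. y \<in> W \<Longrightarrow> s y \<in> cu_fibre" and sm: "\<And>b. smooth_fn UNIV W (\<lambda>y. s y b)"
    using s by (auto simp: local_section_def smooth_map_def)
  show "almost_complex (J_of (s x))" "positive_11 (J_of (s x)) (eta_of (s x))"
    using F[OF x] by (auto simp: cu_fibre_def)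
  fix c
  have "(\<Sum>e\<in>UNIV. s y (Inl (a, e)) * s y (Inl (e, b))) = (if a = b then -1 else 0)" if "y \<in> W" for y a b
  proof -
    have "(J_of (s y) ** J_of (s y)) $ a $ b = (- mat 1 :: real^6^6) $ a $ b"
      using F[OF that] by (simp add: cu_fibre_def almost_complex_def)
    then show ?thesis by (simp add: J_of_def matrix_matrix_mult_def mat_def)
  qed
  then have "partial c (\<lambda>y. \<Sum>e\<in>UNIV. s y (Inl (a, e)) * s y (Inl (e, b))) x = partial c (\<lambda>y. if a = b then -1 else 0) x" for a b
    by (intro partial_cong[of UNIV W]) (use W x in auto)
  moreover have "partial c (\<lambda>y. \<Sum>e\<in>UNIV. s y (Inl (a, e)) * s y (Inl (e, b))) x
     = (\<Sum>e\<in>UNIV. partial c (\<lambda>y. s y (Inl (a, e))) x * s x (Inl (e, b)) + s x (Inl (a, e)) * partial c (\<lambda>y. s y (Inl (e, b))) x)" for a b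
    using W x sm by (simp add: partial_sum[of _ UNIV W] smooth_fn_mult partial_mult[of UNIV W])
  ultimately show "dJ s x c ** J_of (s x) + J_of (s x) ** dJ s x c = 0"
    by (simp add: vec_eq_iff matrix_matrix_mult_def dJ_def J_of_def sum.distrib partial_const)
qed

text \<open>Evaluating the forms d alpha on the dual frame produces the entries of \<open>N\<close>
  and, up to the common factor 2 i mu, the components of \<open>tau\<close>. Conditions on
  \<open>N\<close> for a given coframing thus become conditions on \<open>tau\<close>, which does
  not refer to a coframing.\<close>

lemma conformally_unitary_frame:
  assumes s: "local_section cu_fibre W s" and V: "V \<subseteq> W" "x \<in> V" and \<alpha>: "conformally_unitary s V \<alpha>"
  obtains \<mu> :: real and E :: "3 \<Rightarrow> complex^6" where "\<mu> > 0" "\<forall>i. T01 (J_of (s x)) (E i)"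
    "\<forall>v. T01 (J_of (s x)) v \<longrightarrow> (\<exists>c. v = (\<Sum>k\<in>UNIV. c k *s E k))"
    "\<forall>k l m. tau (J_of (s x)) (eta_of (s x)) (dJ s x) (E k) (E l) (E m) = 2 * \<i> * complex_of_real \<mu> * dal \<alpha> x m (E k) (E l)"
    "N_matrix s \<alpha> x = (\<chi> i j. dal \<alpha> x i (E (j + 1)) (E (j + 2)))"
proof -
  interpret hermitian_1jet "J_of (s x)" "eta_of (s x)" "dJ s x"
    using section_hermitian_1jet[OF s] V by auto
  let ?J = "J_of (s x)" let ?H = "eta_of (s x)"
  let ?a = "avec \<alpha> x"
  have Vo: "open V" and cs: "\<And>i a. csmooth UNIV V (\<lambda>y. \<alpha> i y a)"
    and lin: "\<And>y i b. y \<in> V \<Longrightarrow> (\<Sum>a\<in>UNIV. \<alpha> i y a * complex_of_real (J_of (s y) $ a $ b)) = \<i> * \<alpha> i y b"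
    and ind: "\<And>c. (\<forall>a. (\<Sum>i\<in>UNIV. c i * \<alpha> i x a) = 0) \<Longrightarrow> (\<forall>i. c i = 0)"
    using \<alpha> V by (auto simp: conformally_unitary_def linear_coframing_def csmooth_def)
  obtain \<mu> where \<mu>: "\<mu> > 0" and eta: "\<And>a b. complex_of_real (?H $ a $ b) =
           complex_of_real \<mu> * (\<i> / 2) * (\<Sum>i\<in>UNIV. wedge (\<alpha> i x) (\<lambda>c. cnj (\<alpha> i x c)) a b)"
    using \<alpha> V unfolding conformally_unitary_def by blast
  have bJ: "bil (cm A *v v) w = (\<Sum>b\<in>UNIV. v $ b * (\<Sum>a\<in>UNIV. w $ a * complex_of_real (A $ a $ b)))" for A v w
    unfolding bil_def cm_def matrix_vector_mult_def
    by (simp add: sum_distrib_left sum_distrib_right mult_ac) (rule sum.swap)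
  have lin': "bil (cm ?J *v v) (?a i) = \<i> * bil v (?a i)" for i v
    using lin[OF V(2)] by (simp add: bJ avec_def) (simp add: bil_def sum_distrib_left mult_ac)
  have ind': "\<forall>i. c i = 0" if "(\<Sum>i\<in>UNIV. c i *s ?a i) = 0" for c
    using ind that by (simp add: vec_eq_iff avec_def)
  have eta': "hb ?H u v = complex_of_real \<mu> * (\<i> / 2) * (\<Sum>i\<in>UNIV. bil u (?a i) * bil v (vcnj (?a i)) - bil u (vcnj (?a i)) * bil v (?a i))" for u v
  proof -
    have "hb ?H u v = (\<Sum>a\<in>UNIV. \<Sum>b\<in>UNIV. u $ a * v $ b * complex_of_real (?H $ a $ b))"
      by (simp add: hb_def bil_def cm_def matrix_vector_mult_def sum_distrib_left mult_ac)
    also have "\<dots> = complex_of_real \<mu> * (\<i> / 2) * (\<Sum>a\<in>UNIV. \<Sum>b\<in>UNIV. \<Sum>i\<in>UNIV. u $ a * v $ b * wedge (\<alpha> i x) (\<lambda>c. cnj (\<alpha> i x c)) a b)"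
      unfolding eta by (simp add: sum_distrib_left mult_ac)
    also have "(\<Sum>a\<in>UNIV. \<Sum>b\<in>UNIV. \<Sum>i\<in>UNIV. u $ a * v $ b * wedge (\<alpha> i x) (\<lambda>c. cnj (\<alpha> i x c)) a b)
       = (\<Sum>i\<in>UNIV. \<Sum>a\<in>UNIV. \<Sum>b\<in>UNIV. u $ a * v $ b * wedge (\<alpha> i x) (\<lambda>c. cnj (\<alpha> i x c)) a b)"
      by (subst sum.swap[of _ "UNIV :: 3 set" "UNIV :: 6 set"], intro sum.cong refl sum.swap)
    also have "\<dots> = (\<Sum>i\<in>UNIV. bil u (?a i) * bil v (vcnj (?a i)) - bil u (vcnj (?a i)) * bil v (?a i))"
      unfolding bil_def sum_product sum_subtractf[symmetric]
      by (intro sum.cong refl) (simp add: wedge_def avec_def vcnj_def algebra_simps)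
    finally show ?thesis .
  qed
  obtain E where E0: "\<forall>i. T01 ?J (E i)" "\<forall>i j. bil (E i) (vcnj (?a j)) = (if i = j then 1 else 0)"
    "\<forall>i v. hb ?H v (E i) = complex_of_real \<mu> * (\<i> / 2) * bil v (?a i)"
    "\<forall>v. T01 ?J v \<longrightarrow> v = (\<Sum>k\<in>UNIV. bil v (vcnj (?a k)) *s E k)"
    using frame_exists[of \<mu> ?a, OF \<mu> lin' ind' eta'] by blast
  note E = E0[rule_format]
  have der: "bil (cm ?J *v v) (dvec \<alpha> x c i) + bil (cm (dJ s x c) *v v) (?a i) = \<i> * bil v (dvec \<alpha> x c i)" for c i v
  proof -
    have sc: "csmooth UNIV V (\<lambda>y. complex_of_real (s y b))" for b
      using csmooth_subset[OF local_section_csmooth[OF s]] V Vo by simp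
    have "cpartial c (\<lambda>y. \<Sum>a\<in>UNIV. \<alpha> i y a * complex_of_real (s y (Inl (a, b)))) x = cpartial c (\<lambda>y. \<i> * \<alpha> i y b) x" for b
      by (rule cpartial_cong[of UNIV V]) (use lin Vo V in \<open>auto simp: J_of_def\<close>)
    moreover have "cpartial c (\<lambda>y. \<Sum>a\<in>UNIV. \<alpha> i y a * complex_of_real (s y (Inl (a, b)))) x
      = (\<Sum>a\<in>UNIV. cpartial c (\<lambda>y. \<alpha> i y a) x * complex_of_real (s x (Inl (a, b))) + \<alpha> i x a * complex_of_real (partial c (\<lambda>y. s y (Inl (a, b))) x))" for b
      using Vo V(2) sc cs by (simp add: cpartial_sum[of _ UNIV V] csmooth_mult cpartial_mult[of UNIV V] cpartial_of_real)
    moreover have "cpartial c (\<lambda>y. \<i> * \<alpha> i y b) x = \<i> * cpartial c (\<lambda>y. \<alpha> i y b) x" for b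
      by (rule cpartial_cmult[OF cs]) (use V in auto)
    ultimately have "(\<Sum>a\<in>UNIV. cpartial c (\<lambda>y. \<alpha> i y a) x * complex_of_real (?J $ a $ b)) + (\<Sum>a\<in>UNIV. \<alpha> i x a * complex_of_real (dJ s x c $ a $ b)) = \<i> * cpartial c (\<lambda>y. \<alpha> i y b) x" for b
      by (simp add: sum.distrib J_of_def dJ_def)
    then have "(\<Sum>b\<in>UNIV. v $ b * ((\<Sum>a\<in>UNIV. cpartial c (\<lambda>y. \<alpha> i y a) x * complex_of_real (?J $ a $ b)) + (\<Sum>a\<in>UNIV. \<alpha> i x a * complex_of_real (dJ s x c $ a $ b))))
        = (\<Sum>b\<in>UNIV. v $ b * (\<i> * cpartial c (\<lambda>y. \<alpha> i y b) x))" by simp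
    then show ?thesis
      by (simp add: bJ dvec_def avec_def distrib_left sum.distrib) (simp add: bil_def sum_distrib_left mult_ac)
  qed
  have tau: "tau ?J ?H (dJ s x) (E k) (E l) (E m) = 2 * \<i> * complex_of_real \<mu> * dal \<alpha> x m (E k) (E l)" for k l m
    unfolding dal_def by (rule tau_frame[OF der E(1,3)])
  define M where "M = (\<chi> i j. dal \<alpha> x i (E (j + 1)) (E (j + 2)))"
  have p: "p01 ?J (axis a 1) = (\<Sum>k\<in>UNIV. cnj (\<alpha> k x a) *s E k)" for a
  proof -
    have ra: "vcnj (axis a 1) = axis a 1" by (simp add: vcnj_def axis_def vec_eq_iff)
    have "bil (cm ?J *v axis a 1) (vcnj (?a k)) = - \<i> * cnj (\<alpha> k x a)" for k
      using bil_cnj[of "cm ?J *v axis a 1" "?a k"] lin'[of "axis a 1" k] by (simp add: vcnj_cm ra avec_def)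
    then have "bil (p01 ?J (axis a 1)) (vcnj (?a k)) = cnj (\<alpha> k x a)" for k
      by (simp add: p01_def bil_simps avec_def vcnj_def)
    then show ?thesis using E(4)[OF T01_p01, of "axis a 1"] by simp
  qed
  have M: "part02 ?J (ext_deriv (\<alpha> i) x) a b = (\<Sum>j\<in>UNIV. M $ i $ j * cnj (wedge (\<alpha> (j + 1) x) (\<alpha> (j + 2) x) a b))" for i a b
  proof -
    have z: "dal \<alpha> x i (E k) (E k) = 0" for k using dal_skew[of \<alpha> x i "E k" "E k"] by simp
    show ?thesis
      unfolding part02_dal p dal_simps
      by (simp add: M_def sum_3 add_3 wedge_def z dal_skew[of \<alpha> x i "E 3" "E 2"]
         dal_skew[of \<alpha> x i "E 2" "E 1"] dal_skew[of \<alpha> x i "E 3" "E 1"] algebra_simps)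
  qed
  have "N_matrix s \<alpha> x = M"
    unfolding N_matrix_def
  proof (rule the_equality)
    fix N assume N: "\<forall>i a b. part02 ?J (ext_deriv (\<alpha> i) x) a b = (\<Sum>j\<in>UNIV. N $ i $ j * cnj (wedge (\<alpha> (j + 1) x) (\<alpha> (j + 2) x) a b))"
    \<comment> \<open>Contraction with pairs of frame vectors turns the conjugate wedge products
      into Kronecker deltas, so every admissible matrix has the entries of \<open>M\<close>. This is
      the uniqueness that \<open>THE\<close> requires.\<close>
    have ev: "(\<Sum>a\<in>UNIV. \<Sum>b\<in>UNIV. E k $ a * E l $ b * cnj (wedge (\<alpha> p x) (\<alpha> q x) a b))
        = (if k = p then 1 else 0) * (if l = q then 1 else 0) - (if k = q then 1 else 0) * (if l = p then 1 else 0)" for k l p q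
    proof -
      have "(\<Sum>a\<in>UNIV. \<Sum>b\<in>UNIV. E k $ a * E l $ b * cnj (wedge (\<alpha> p x) (\<alpha> q x) a b))
        = bil (E k) (vcnj (?a p)) * bil (E l) (vcnj (?a q)) - bil (E k) (vcnj (?a q)) * bil (E l) (vcnj (?a p))"
        unfolding bil_def sum_product sum_subtractf[symmetric]
        by (intro sum.cong refl) (simp add: wedge_def avec_def vcnj_def algebra_simps)
      then show ?thesis by (simp add: E(2))
    qed
    have eq: "(\<Sum>j\<in>UNIV. N $ i $ j * cnj (wedge (\<alpha> (j + 1) x) (\<alpha> (j + 2) x) a b)) = (\<Sum>j\<in>UNIV. M $ i $ j * cnj (wedge (\<alpha> (j + 1) x) (\<alpha> (j + 2) x) a b))" for i a b
      using N M by metis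
    have ev2: "(\<Sum>a\<in>UNIV. \<Sum>b\<in>UNIV. E k $ a * E l $ b * (\<Sum>j\<in>UNIV. X $ i $ j * cnj (wedge (\<alpha> (j + 1) x) (\<alpha> (j + 2) x) a b)))
      = (\<Sum>j\<in>UNIV. X $ i $ j * (\<Sum>a\<in>UNIV. \<Sum>b\<in>UNIV. E k $ a * E l $ b * cnj (wedge (\<alpha> (j + 1) x) (\<alpha> (j + 2) x) a b)))" for k l i and X :: "complex^3^3"
      by (simp add: sum_3 sum_distrib_left sum.distrib algebra_simps)
    have "N $ i $ j = M $ i $ j" for i j
    proof -
      have "(\<Sum>j\<in>UNIV. N $ i $ j * (\<Sum>a\<in>UNIV. \<Sum>b\<in>UNIV. E k $ a * E l $ b * cnj (wedge (\<alpha> (j + 1) x) (\<alpha> (j + 2) x) a b))) =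
        (\<Sum>j\<in>UNIV. M $ i $ j * (\<Sum>a\<in>UNIV. \<Sum>b\<in>UNIV. E k $ a * E l $ b * cnj (wedge (\<alpha> (j + 1) x) (\<alpha> (j + 2) x) a b)))" for k l
        unfolding ev2[symmetric] eq ..
      from this[of 2 3] this[of 3 1] this[of 1 2] have "N $ i $ 1 = M $ i $ 1" "N $ i $ 2 = M $ i $ 2" "N $ i $ 3 = M $ i $ 3"
        by (simp_all add: ev sum_3 add_3)
      then show ?thesis using exhaust_3[of j] by auto
    qed
    then show "N = M" by (simp add: vec_eq_iff)
  qed (use M in blast)
  then have N: "N_matrix s \<alpha> x = (\<chi> i j. dal \<alpha> x i (E (j + 1)) (E (j + 2)))"
    by (simp add: M_def)
  have "\<forall>v. T01 ?J v \<longrightarrow> (\<exists>c. v = (\<Sum>k\<in>UNIV. c k *s E k))"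
    by (intro allI impI exI) (rule E(4))
  then show ?thesis
    by (rule that[OF \<mu> E0(1) _ _ N]) (simp add: tau)
qed

text \<open>A totally skew trilinear form in three dimensions is a multiple of the Levi-Civita
  symbol, and with the cyclic numbering of the columns of \<open>N\<close> this symbol is the
  identity matrix.\<close>

lemma quasi_integrable_atI:
  assumes s: "local_section cu_fibre W s" and x: "x \<in> W"
    and 0: "\<And>u v w. T01 (J_of (s x)) u \<Longrightarrow> T01 (J_of (s x)) v \<Longrightarrow> T01 (J_of (s x)) w \<Longrightarrow> psi (J_of (s x)) (eta_of (s x)) (dJ s x) u v w = 0"
  shows "quasi_integrable_at s W x"
  unfolding quasi_integrable_at_def
proof (intro allI impI, elim conjE)
  fix V \<alpha> assume V: "V \<subseteq> W" "x \<in> V" and \<alpha>: "conformally_unitary s V \<alpha>"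
  obtain \<mu> E where \<mu>: "\<mu> > 0" and E0: "\<forall>i. T01 (J_of (s x)) (E i)"
    "\<forall>v. T01 (J_of (s x)) v \<longrightarrow> (\<exists>c. v = (\<Sum>k\<in>UNIV. c k *s E k))"
    and tau0: "\<forall>k l m. tau (J_of (s x)) (eta_of (s x)) (dJ s x) (E k) (E l) (E m) = 2 * \<i> * complex_of_real \<mu> * dal \<alpha> x m (E k) (E l)"
    and N: "N_matrix s \<alpha> x = (\<chi> i j. dal \<alpha> x i (E (j + 1)) (E (j + 2)))"
    by (rule conformally_unitary_frame[OF s V \<alpha>])
  note E = E0[rule_format] and tau = tau0[rule_format]
  have sk: "dal \<alpha> x m (E k) (E l) + dal \<alpha> x l (E k) (E m) = 0" for k l m
    using 0[OF E(1) E(1) E(1), of k l m] \<mu> by (simp add: psi_def tau distrib_left[symmetric] del: distrib_left_numeral)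
  have sw: "dal \<alpha> x i (E k) (E l) = - dal \<alpha> x i (E l) (E k)" for i k l by (rule dal_skew)
  define c where "c = dal \<alpha> x 1 (E 2) (E 3)"
  have "N_matrix s \<alpha> x = mat c"
    unfolding N c_def using sk[of 1 2 1] sk[of 1 3 1] sk[of 2 1 2] sk[of 2 3 2] sk[of 3 1 3] sk[of 3 2 3]
      sk[of 2 3 1] sk[of 1 2 3] sw[of 1 1 2] sw[of 1 1 3] sw[of 2 1 2] sw[of 2 2 3] sw[of 3 3 1] sw[of 3 2 3] sw[of 1 2 3] sw[of 2 3 1] sw[of 3 1 2]
    by (simp add: vec_eq_iff mat_def forall_3 add_3 eq_neg_iff_add_eq_0) (metis add_right_cancel)
  then show "\<exists>c. N_matrix s \<alpha> x = mat c" ..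
qed

lemma quasi_integrable_atD:
  assumes s: "local_section cu_fibre W s" and V: "V \<subseteq> W" "x \<in> V" and \<alpha>: "conformally_unitary s V \<alpha>"
    and q: "quasi_integrable_at s W x"
  shows "psi (J_of (s x)) (eta_of (s x)) (dJ s x) u v w = 0"
proof -
  interpret hermitian_1jet "J_of (s x)" "eta_of (s x)" "dJ s x"
    using section_hermitian_1jet[OF s] V by auto
  obtain \<mu> E where \<mu>: "\<mu> > 0" and E0: "\<forall>i. T01 (J_of (s x)) (E i)"
    "\<forall>v. T01 (J_of (s x)) v \<longrightarrow> (\<exists>c. v = (\<Sum>k\<in>UNIV. c k *s E k))"
    and tau0: "\<forall>k l m. tau (J_of (s x)) (eta_of (s x)) (dJ s x) (E k) (E l) (E m) = 2 * \<i> * complex_of_real \<mu> * dal \<alpha> x m (E k) (E l)"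
    and N: "N_matrix s \<alpha> x = (\<chi> i j. dal \<alpha> x i (E (j + 1)) (E (j + 2)))"
    by (rule conformally_unitary_frame[OF s V \<alpha>])
  note E = E0[rule_format] and tau = tau0[rule_format]
  obtain c where c: "N_matrix s \<alpha> x = mat c" using q V \<alpha> unfolding quasi_integrable_at_def by blast
  have Nij: "dal \<alpha> x i (E (j + 1)) (E (j + 2)) = (if i = j then c else 0)" for i j
    using arg_cong[OF c, of "\<lambda>M. M $ i $ j"] unfolding N by (simp add: mat_def)
  have n: "dal \<alpha> x i (E 2) (E 3) = (if i = 1 then c else 0)" "dal \<alpha> x i (E 3) (E 1) = (if i = 2 then c else 0)"
    "dal \<alpha> x i (E 1) (E 2) = (if i = 3 then c else 0)" for i
    using Nij[of i 1] Nij[of i 2] Nij[of i 3] by (simp_all add: add_3)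
  have z: "dal \<alpha> x i (E k) (E k) = 0" for i k using dal_skew[of \<alpha> x i "E k" "E k"] by simp
  have n': "dal \<alpha> x i (E 3) (E 2) = (if i = 1 then - c else 0)" "dal \<alpha> x i (E 1) (E 3) = (if i = 2 then - c else 0)"
    "dal \<alpha> x i (E 2) (E 1) = (if i = 3 then - c else 0)" for i
    by (subst dal_skew, simp add: n)+
  have sk: "dal \<alpha> x m (E k) (E l) + dal \<alpha> x l (E k) (E m) = 0" for k l m
    using exhaust_3[of k] exhaust_3[of l] exhaust_3[of m]
    by (elim disjE) (simp_all add: n n' z)
  have p: "psi (J_of (s x)) (eta_of (s x)) (dJ s x) (E k) (E l) (E m) = 0" for k l m
    using sk[of m k l] by (simp add: psi_def tau distrib_left[symmetric] del: distrib_left_numeral)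
  show ?thesis
    by (rule psi_vanishes) (rule psi_T01_span[where Z = E, OF E(2) p])
qed

section \<open>The standard structure and unitary coframings\<close>

lemma forall_6: "(\<forall>i::6. P i) \<longleftrightarrow> P 0 \<and> P 1 \<and> P 2 \<and> P 3 \<and> P 4 \<and> P 5"
  by (metis exhaust_6)

definition rx :: "3 \<Rightarrow> 6" where
  "rx k = (if k = 1 then 0 else if k = 2 then 2 else 4)"

definition ry :: "3 \<Rightarrow> 6" where
  "ry k = (if k = 1 then 1 else if k = 2 then 3 else 5)"

text \<open>\<open>ee k\<close> is \<open>\<partial>/\<partial>z\<^sub>k-bar\<close> for \<open>z\<^sub>k = x (rx k) + i x (ry k)\<close>.\<close>

definition ee :: "3 \<Rightarrow> complex^6" where
  "ee k = (\<chi> a. if a = rx k then 1/2 else if a = ry k then \<i>/2 else 0)"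

definition J0 :: "real^6^6" where
  "J0 = (\<chi> a b. if (a, b) \<in> {(1, 0), (3, 2), (5, 4)} then 1 else if (a, b) \<in> {(0, 1), (2, 3), (4, 5)} then - 1 else 0)"

lemmas rxy = rx_def ry_def

lemma J0_J0: "J0 ** J0 = - mat 1"
  by (simp add: vec_eq_iff matrix_matrix_mult_def mat_def J0_def sum_6 forall_6)

lemma J0_skew: "transpose J0 = - J0"
  by (simp add: vec_eq_iff transpose_def J0_def forall_6)

lemma almost_complex_J0: "almost_complex J0"
  by (simp add: almost_complex_def J0_J0)

lemma T01_ee: "T01 J0 (ee k)"
  using exhaust_3[of k]
  by (elim disjE) (simp_all add: T01_def vec_eq_iff forall_6 matrix_vector_mult_def sum_6 cm_def J0_def ee_def rxy)

lemma bil_ee: "bil (ee k) (ee l) = 0" "bil (vcnj (ee k)) (ee l) = (if k = l then 1/2 else 0)"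
  using exhaust_3[of k] exhaust_3[of l]
  by (elim disjE; simp add: bil_def sum_6 ee_def vcnj_def rxy)+

lemma T01_J0_span:
  assumes "T01 J0 v"
  shows "v = (\<Sum>k\<in>UNIV. (2 * v $ rx k) *s ee k)"
proof -
  have "(cm J0 *v v) $ a = - \<i> * v $ a" for a
    using assms by (simp add: T01_def)
  from this[of 0] this[of 2] this[of 4]
  have "v $ 1 = \<i> * v $ 0" "v $ 3 = \<i> * v $ 2" "v $ 5 = \<i> * v $ 4"
    by (simp_all add: matrix_vector_mult_def sum_6 cm_def J0_def)
  then show ?thesis
    by (simp add: vec_eq_iff forall_6 sum_3 ee_def rxy)
qed

lemma almost_complex_mv: "almost_complex J \<Longrightarrow> J *v (J *v w) = - w"
  by (simp add: almost_complex_def matrix_vector_mul_assoc mv_uminus)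

text \<open>Applying a - b J to the given element produces (a * a + b * b) w, which would put
  \<open>w\<close> into the invariant subspace.\<close>

lemma span_insert_J_invariant:
  assumes J: "almost_complex J" and S: "\<And>x. x \<in> S \<Longrightarrow> J *v x \<in> S" "subspace S"
    and w: "w \<notin> S" and ab: "a *s w + b *s (J *v w) \<in> S"
  shows "a = 0 \<and> b = (0::real)"
proof (rule ccontr)
  assume *: "\<not> (a = 0 \<and> b = 0)"
  define r where "r = a * a + b * b"
  have n: "r \<noteq> 0" using * by (simp add: r_def sum_squares_eq_zero_iff)
  have JJ: "J *v (J *v w) = - w"
    by (rule almost_complex_mv[OF J])
  let ?X = "a *s w + b *s (J *v w)"
  have "a *s ?X - b *s (J *v ?X) \<in> S"
    using ab S unfolding scalar_mult_eq_scaleR by (intro subspace_diff subspace_scale) auto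
  also have "a *s ?X - b *s (J *v ?X) = r *s w"
    unfolding matrix_vector_right_distrib vector_scalar_commute JJ by (simp add: r_def vec_eq_iff algebra_simps)
  finally have "(1 / r) *\<^sub>R (r *\<^sub>R w) \<in> S"
    using S(2) unfolding scalar_mult_eq_scaleR by (rule subspace_scale[rotated])
  then show False using n w by simp
qed

text \<open>Three vectors are chosen successively outside the \<open>J\<close>-invariant span of the
  earlier ones; these vectors and their images under \<open>J\<close>, in alternating order, are the
  columns of \<open>g\<close>.\<close>

lemma almost_complex_normal_form:
  assumes J: "almost_complex J"
  obtains g where "det g \<noteq> 0" "J ** g = g ** J0"
proof -
  note JJ = almost_complex_mv[OF J]
  have nospan: "\<exists>w. w \<notin> span (set xs)" if "length xs < 6" for xs :: "(real^6) list"
  proof (rule ccontr)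
    let ?B = "set xs"
    assume "\<nexists>w. w \<notin> span ?B"
    then have "span ?B = UNIV" by auto
    moreover have "dim (UNIV :: (real^6) set) = 6" by simp
    ultimately have "dim ?B = 6" using dim_span[of ?B] by simp
    then show False using dim_le_card'[of ?B] card_length[of xs] that by simp
  qed
  define S0 :: "(real^6) set" where "S0 = {0}"
  obtain w1 :: "real^6" where w1: "w1 \<notin> S0" using nospan[of "[]"] by (auto simp: S0_def)
  define S1 where "S1 = span {w1, J *v w1}"
  have inv: "J *v x \<in> span B" if "x \<in> span B" "\<And>b. b \<in> B \<Longrightarrow> J *v b \<in> span B" for x and B :: "(real^6) set"
  proof -
    have "J *v x \<in> (*v) J ` span B" using that by auto
    also have "\<dots> = span ((*v) J ` B)" by (rule span_linear_image[symmetric]) simp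
    also have "\<dots> \<subseteq> span B" using that(2) by (intro span_minimal) auto
    finally show ?thesis .
  qed
  have S1: "\<And>x. x \<in> S1 \<Longrightarrow> J *v x \<in> S1" "subspace S1"
    unfolding S1_def by (rule inv) (auto simp: JJ intro: span_base intro!: span_neg)
  obtain w2 where w2: "w2 \<notin> S1" unfolding S1_def
    using nospan[of "[w1, J *v w1]"] by auto
  define S2 where "S2 = span {w1, J *v w1, w2, J *v w2}"
  have S2: "\<And>x. x \<in> S2 \<Longrightarrow> J *v x \<in> S2" "subspace S2"
    unfolding S2_def by (rule inv) (auto simp: JJ intro: span_base intro!: span_neg)
  obtain w3 where w3: "w3 \<notin> S2" unfolding S2_def
    using nospan[of "[w1, J *v w1, w2, J *v w2]"] by auto
  have in2: "w1 \<in> S2" "J *v w1 \<in> S2" "w2 \<in> S2" "J *v w2 \<in> S2" and in1: "w1 \<in> S1" "J *v w1 \<in> S1"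
    by (auto simp: S1_def S2_def intro: span_base)
  define g :: "real^6^6" where "g = (\<chi> a b. if b = 0 then w1 $ a else if b = 1 then (J *v w1) $ a else if b = 2 then w2 $ a
    else if b = 3 then (J *v w2) $ a else if b = 4 then w3 $ a else (J *v w3) $ a)"
  have "\<forall>c. (\<Sum>i\<in>UNIV. c i *s column i g) = 0 \<longrightarrow> (\<forall>i. c i = 0)"
  proof (intro allI impI)
    fix c i assume "(\<Sum>i\<in>UNIV. c i *s column i g) = 0"
    then have s: "c 0 *s w1 + c 1 *s (J *v w1) + c 2 *s w2 + c 3 *s (J *v w2) + (c 4 *s w3 + c 5 *s (J *v w3)) = 0"
      by (simp add: sum_6 column_def g_def vec_eq_iff add.assoc)
    have "- (c 0 *s w1 + c 1 *s (J *v w1) + c 2 *s w2 + c 3 *s (J *v w2)) \<in> S2"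
      unfolding scalar_mult_eq_scaleR using in2 S2(2) by (intro subspace_neg subspace_add subspace_scale)
    then have "c 4 *s w3 + c 5 *s (J *v w3) \<in> S2"
      using s by (metis add_eq_0_iff add.inverse_inverse)
    then have c45: "c 4 = 0 \<and> c 5 = 0"
      using span_insert_J_invariant[OF J _ S2(2) w3] S2(1) by blast
    then have s: "c 0 *s w1 + c 1 *s (J *v w1) + (c 2 *s w2 + c 3 *s (J *v w2)) = 0"
      using s by (simp add: add.assoc)
    have "- (c 0 *s w1 + c 1 *s (J *v w1)) \<in> S1"
      unfolding scalar_mult_eq_scaleR using in1 S1(2) by (intro subspace_neg subspace_add subspace_scale)
    then have "c 2 *s w2 + c 3 *s (J *v w2) \<in> S1"
      using s by (metis add_eq_0_iff add.inverse_inverse)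
    then have c23: "c 2 = 0 \<and> c 3 = 0"
      using span_insert_J_invariant[OF J _ S1(2) w2] S1(1) by blast
    then have "c 0 *s w1 + c 1 *s (J *v w1) \<in> S0" using s by (simp add: S0_def)
    then have c01: "c 0 = 0 \<and> c 1 = 0"
      using span_insert_J_invariant[OF J _ _ w1] by (auto simp: S0_def)
    show "c i = 0" using exhaust_6[of i] c01 c23 c45 by auto
  qed
  then obtain B where "B ** g = mat 1" using matrix_left_invertible_independent_columns by blast
  then have "invertible g" using invertible_def matrix_left_right_inverse by blast
  then have "det g \<noteq> 0" by (simp add: invertible_det_nz)
  moreover have "J ** g = g ** J0"
  proof -
    have "(J ** g) $ a $ b = (J *v column b g) $ a" for a b
      by (simp add: matrix_matrix_mult_def matrix_vector_mult_def column_def)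
    moreover have "column 0 g = w1" "column 1 g = J *v w1" "column 2 g = w2" "column 3 g = J *v w2" "column 4 g = w3" "column 5 g = J *v w3"
      by (simp_all add: column_def g_def vec_eq_iff)
    moreover have "(g ** J0) $ a $ 0 = (J *v w1) $ a" "(g ** J0) $ a $ 1 = - w1 $ a"
     "(g ** J0) $ a $ 2 = (J *v w2) $ a" "(g ** J0) $ a $ 3 = - w2 $ a" "(g ** J0) $ a $ 4 = (J *v w3) $ a" "(g ** J0) $ a $ 5 = - w3 $ a" for a
      by (simp_all add: matrix_matrix_mult_def sum_6 J0_def g_def)
    ultimately have "(J ** g) $ a $ b = (g ** J0) $ a $ b" for a b
      using exhaust_6[of b] by (elim disjE) (simp_all add: JJ)
    then show ?thesis by (simp add: vec_eq_iff)
  qed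
  ultimately show ?thesis by (rule that)
qed

section \<open>The Hermitian form on (0,1)-vectors, smooth frames and Gram-Schmidt\<close>

definition herm :: "real^6^6 \<Rightarrow> complex^6 \<Rightarrow> complex^6 \<Rightarrow> complex" where
  "herm H u v = - \<i> * hb H (vcnj u) v"

definition unitv :: "real^6^6 \<Rightarrow> complex^6 \<Rightarrow> complex^6" where
  "unitv H v = complex_of_real (inverse (sqrt (Re (herm H v v)))) *s v"

lemma herm_simps:
  "herm H u (v + w) = herm H u v + herm H u w" "herm H u (v - w) = herm H u v - herm H u w"
  "herm H u (c *s v) = c * herm H u v" "herm H (c *s u) v = cnj c * herm H u v"
  "herm H (u + v) w = herm H u w + herm H v w" "herm H (u - v) w = herm H u w - herm H v w"
  by (simp_all add: herm_def hb_simps algebra_simps)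

lemma herm_sum: "herm H u (\<Sum>k\<in>K. f k) = (\<Sum>k\<in>K. herm H u (f k))"
  by (simp add: herm_def hb_sum_right sum_distrib_left sum_negf)

context hermitian_structure
begin

lemma herm_cnj: "cnj (herm H u v) = herm H v u"
proof -
  have "hb H (vcnj v) u = - cnj (hb H (vcnj u) v)"
    using hb_cnj[of H "vcnj u" v] hb_skew[of "vcnj v" u] by simp
  then show ?thesis by (simp add: herm_def)
qed

text \<open>With the real vector W = v + conj v one has v = (W + i J W) / 2, and the form equals
  half of eta(W, J W). The factor -i in \<open>herm\<close> is what makes the sign positive.\<close>

lemma herm_pos:
  assumes v: "T01 J v" "v \<noteq> 0"
  shows "Re (herm H v v) > 0" "herm H v v = complex_of_real (Re (herm H v v))"
proof -
  define w where "w = (\<chi> a. 2 * Re (v $ a))"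
  define W where "W = (\<chi> a. complex_of_real (w $ a))"
  have W: "W = v + vcnj v" by (simp add: W_def w_def vcnj_def vec_eq_iff complex_eq_iff)
  have JW0: "cm J *v W = (- \<i>) *s v + \<i> *s vcnj v"
    using v T10_vcnj[of J v] by (simp add: W matrix_vector_right_distrib T01_def T10_def)
  have JW: "v = (1/2) *s (W + \<i> *s (cm J *v W))"
    unfolding JW0 by (simp add: W vec_eq_iff algebra_simps)
  have cW: "vcnj W = W" by (simp add: W add.commute)
  have z: "hb H W W = 0" "hb H (cm J *v W) W = - hb H W (cm J *v W)" "hb H (cm J *v W) (cm J *v W) = 0"
    using hb_skew[of W W] hb_J[of W W] hb_JJ[of W W] by simp_all
  have "vcnj v = (1/2) *s (W - \<i> *s (cm J *v W))"
    using arg_cong[OF JW, of vcnj] by (simp add: vcnj_cm cW vs_alg)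
  then have "herm H v v = - \<i> * hb H ((1/2) *s (W - \<i> *s (cm J *v W))) ((1/2) *s (W + \<i> *s (cm J *v W)))"
    unfolding herm_def using JW by metis
  then have h: "herm H v v = (1/2) * hb H W (cm J *v W)"
    by (simp add: hb_simps z)
  have "hb H W (cm J *v W) = complex_of_real (w \<bullet> (H *v (J *v w)))"
    by (simp add: hb_def bil_def cm_def matrix_vector_mult_def W_def inner_vec_def)
  moreover have "w \<noteq> 0"
  proof
    assume "w = 0" then have "W = 0" by (simp add: W_def vec_eq_iff)
    then show False using JW v(2) by simp
  qed
  then have "w \<bullet> (H *v (J *v w)) > 0" using pos by (simp add: positive_11_def)
  moreover have "herm H v v = complex_of_real ((w \<bullet> (H *v (J *v w))) / 2)"
    using h calculation(1) by simp
  ultimately show "Re (herm H v v) > 0" "herm H v v = complex_of_real (Re (herm H v v))"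
    by (simp_all only: Re_complex_of_real)
qed

lemma unitv:
  assumes v: "T01 J v" "v \<noteq> 0"
  shows "T01 J (unitv H v)" "herm H (unitv H v) (unitv H v) = 1" "\<exists>c. v = c *s unitv H v"
    "herm H u v = 0 \<Longrightarrow> herm H u (unitv H v) = 0"
proof -
  define n where "n = Re (herm H v v)"
  have n: "n > 0" "herm H v v = complex_of_real n" using herm_pos[OF v] by (auto simp: n_def)
  show "T01 J (unitv H v)" unfolding unitv_def by (rule T01_closed(3)[OF v(1)])
  have "complex_of_real (inverse (sqrt n)) * (complex_of_real (inverse (sqrt n)) * complex_of_real n) = 1"
    using n(1) unfolding of_real_mult[symmetric] by (simp add: field_simps)
  then show "herm H (unitv H v) (unitv H v) = 1"
    unfolding unitv_def n_def[symmetric] by (simp add: herm_simps n)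
  have "v = complex_of_real (sqrt n) *s unitv H v"
    unfolding unitv_def n_def[symmetric] using n(1) by (simp add: vs_alg)
  then show "\<exists>c. v = c *s unitv H v" ..
  show "herm H u v = 0 \<Longrightarrow> herm H u (unitv H v) = 0" by (simp add: unitv_def herm_simps)
qed

text \<open>Lowering a unitary frame with eta gives a coframing with eta = i times the sum of the
  alpha wedge conj alpha; compared with the normalization i/2 this is the conformal factor
  2.\<close>

lemma unitary_frame_eta:
  fixes E :: "3 \<Rightarrow> complex^6"
  assumes E: "\<And>i. T01 J (E i)" "\<And>i j. herm H (E i) (E j) = (if i = j then 1 else 0)"
    and span: "\<And>v. T01 J v \<Longrightarrow> \<exists>c. v = (\<Sum>k\<in>UNIV. c k *s E k)"
  defines "\<alpha> i \<equiv> cm H *v E i"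
  shows "complex_of_real (H $ a $ b) = complex_of_real 2 * (\<i> / 2) * (\<Sum>i\<in>UNIV. wedge (\<lambda>c. \<alpha> i $ c) (\<lambda>c. cnj (\<alpha> i $ c)) a b)"
    and "(\<And>a. (\<Sum>i\<in>UNIV. c i * \<alpha> i $ a) = 0) \<Longrightarrow> c i = 0"
    and "(\<Sum>a\<in>UNIV. \<alpha> i $ a * complex_of_real (J $ a $ b)) = \<i> * \<alpha> i $ b"
proof -
  have exp: "v = (\<Sum>k\<in>UNIV. herm H (E k) v *s E k)" if v: "T01 J v" for v
  proof -
    obtain c where c: "v = (\<Sum>k\<in>UNIV. c k *s E k)" using span[OF v] by blast
    have "herm H (E j) v = c j" for j
    proof -
      have "herm H (E j) v = (\<Sum>k\<in>UNIV. if j = k then c k else 0)"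
        unfolding c herm_sum herm_simps E(2) by (intro sum.cong) auto
      then show ?thesis by simp
    qed
    then show ?thesis using c by simp
  qed
  have \<alpha>: "\<alpha> i $ a = hb H (axis a 1) (E i)" for i a
    by (simp add: \<alpha>_def hb_def)
  define p where "p a = p01 J (axis a 1)" for a
  have Tp: "T01 J (p a)" for a unfolding p_def by (rule T01_p01)
  have ax: "axis a 1 = p a + vcnj (p a)" for a
  proof -
    have "vcnj (axis a 1) = axis a 1" by (simp add: vcnj_def axis_def vec_eq_iff)
    then show ?thesis by (simp add: p_def p01_def vcnj_cm) (simp add: vec_eq_iff algebra_simps)
  qed
  have hE: "herm H (E i) (p b) = \<i> * cnj (\<alpha> i $ b)" for i b
  proof -
    have "hb H (vcnj (E i)) (axis b 1) = hb H (vcnj (E i)) (p b)"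
      unfolding ax by (simp add: hb_simps hb_T10 T10_vcnj E(1) Tp)
    moreover have "hb H (vcnj (E i)) (axis b 1) = - cnj (\<alpha> i $ b)"
      using hb_cnj[of H "axis b 1" "E i"] hb_skew[of "vcnj (E i)" "axis b 1"]
      by (simp add: \<alpha>) (simp add: vcnj_def axis_def if_distrib vec_eq_iff cong: if_cong)
    ultimately have "hb H (vcnj (E i)) (p b) = - cnj (\<alpha> i $ b)" by simp
    then show ?thesis by (simp add: herm_def)
  qed
  have hp: "hb H (vcnj (p a)) (p b) = \<i> * (\<Sum>i\<in>UNIV. \<alpha> i $ a * cnj (\<alpha> i $ b))" for a b
  proof -
    have "herm H (p a) (p b) = (\<Sum>i\<in>UNIV. herm H (E i) (p b) * herm H (p a) (E i))"
      by (subst exp[OF Tp[of b]]) (simp add: herm_sum herm_simps)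
    also have "\<dots> = (\<Sum>i\<in>UNIV. \<alpha> i $ a * cnj (\<alpha> i $ b))"
      by (simp add: herm_cnj[of "E _" "p a", symmetric] hE mult_ac)
    finally show ?thesis by (simp add: herm_def algebra_simps sum_distrib_left) (metis (no_types) complex_i_mult_minus minus_minus mult.left_commute sum_distrib_left)
  qed
  have "complex_of_real (H $ a $ b) = hb H (axis a 1) (axis b 1)"
    by (simp add: hb_def cm_def) (simp add: matrix_vector_mult_def axis_def if_distrib cong: if_cong)
  also have "\<dots> = hb H (p a) (vcnj (p b)) + hb H (vcnj (p a)) (p b)"
    unfolding ax by (simp add: hb_simps hb_T01 hb_T10 Tp T10_vcnj)
  also have "hb H (p a) (vcnj (p b)) = - hb H (vcnj (p b)) (p a)" by (rule hb_skew)
  finally show "complex_of_real (H $ a $ b) = complex_of_real 2 * (\<i> / 2) * (\<Sum>i\<in>UNIV. wedge (\<lambda>c. \<alpha> i $ c) (\<lambda>c. cnj (\<alpha> i $ c)) a b)"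
    unfolding hp by (simp add: wedge_def sum_subtractf algebra_simps)
  show "c i = 0" if c: "\<And>a. (\<Sum>i\<in>UNIV. c i * \<alpha> i $ a) = 0" for c i
  proof -
    have "hb H v (\<Sum>i\<in>UNIV. c i *s E i) = 0" for v
    proof -
      have "cm H *v (\<Sum>i\<in>UNIV. c i *s E i) = (\<Sum>i\<in>UNIV. c i *s \<alpha> i)"
        by (simp add: mv_sum_right vector_scalar_commute \<alpha>_def)
      also have "\<dots> = 0" using c by (simp add: vec_eq_iff)
      finally show ?thesis by (simp add: hb_def bil_simps)
    qed
    then have "herm H (E i) (\<Sum>j\<in>UNIV. c j *s E j) = 0" by (simp add: herm_def)
    moreover have "herm H (E i) (\<Sum>j\<in>UNIV. c j *s E j) = (\<Sum>j\<in>UNIV. if i = j then c j else 0)"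
      unfolding herm_sum herm_simps E(2) by (intro sum.cong) auto
    ultimately show ?thesis by simp
  qed
  show "(\<Sum>a\<in>UNIV. \<alpha> i $ a * complex_of_real (J $ a $ b)) = \<i> * \<alpha> i $ b"
  proof -
    have "(\<Sum>a\<in>UNIV. \<alpha> i $ a * complex_of_real (J $ a $ b)) = bil (cm J *v axis b 1) (\<alpha> i)"
      by (simp add: bil_def cm_def matrix_vector_mult_def axis_def if_distrib mult.commute cong: if_cong)
    also have "\<dots> = hb H (cm J *v axis b 1) (E i)" by (simp add: hb_def \<alpha>_def)
    also have "\<dots> = \<i> * \<alpha> i $ b"
      using E(1)[of i] by (simp add: hb_J T01_def hb_simps \<alpha>)
    finally show ?thesis .
  qed
qed

end

lemma mm_simps:
  fixes A B C :: "real^'n^'n"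
  shows "(A + B) ** C = A ** C + B ** C" "C ** (A + B) = C ** A + C ** B"
  "(A - B) ** C = A ** C - B ** C" "C ** (A - B) = C ** A - C ** B"
  "(- A) ** C = - (A ** C)" "C ** (- A) = - (C ** A)"
  "(r *\<^sub>R A) ** C = r *\<^sub>R (A ** C)" "C ** (r *\<^sub>R A) = r *\<^sub>R (C ** A)"
  by (simp_all add: matrix_matrix_mult_def vec_eq_iff algebra_simps sum.distrib sum_subtractf sum_negf sum_distrib_left)

lemma matrix_inv_det:
  fixes A :: "real^'n^'n"
  assumes "det A \<noteq> 0"
  shows "A ** matrix_inv A = mat 1" "matrix_inv A ** A = mat 1"
proof -
  have "\<exists>B. A ** B = mat 1 \<and> B ** A = mat 1"
    using assms by (simp add: invertible_det_nz[symmetric] invertible_def)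
  then have "A ** matrix_inv A = mat 1 \<and> matrix_inv A ** A = mat 1"
    unfolding matrix_inv_def by (rule someI_ex)
  then show "A ** matrix_inv A = mat 1" "matrix_inv A ** A = mat 1" by auto
qed

definition vsmooth :: "pt set \<Rightarrow> (pt \<Rightarrow> complex^6) \<Rightarrow> bool" where
  "vsmooth V f \<longleftrightarrow> (\<forall>a. csmooth UNIV V (\<lambda>y. f y $ a))"

definition msmooth :: "pt set \<Rightarrow> (pt \<Rightarrow> real^6^6) \<Rightarrow> bool" where
  "msmooth V A \<longleftrightarrow> (\<forall>a b. smooth_fn UNIV V (\<lambda>y. A y $ a $ b))"

lemma vsmooth_open: "vsmooth V f \<Longrightarrow> open V"
  using csmooth_open unfolding vsmooth_def by (metis open_in_coord_UNIV)

lemma msmooth_open: "msmooth V A \<Longrightarrow> open V"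
  using smooth_fn_open unfolding msmooth_def by (metis open_in_coord_UNIV)

lemma vsmooth_diff: "vsmooth V f \<Longrightarrow> vsmooth V g \<Longrightarrow> vsmooth V (\<lambda>y. f y - g y)"
  and vsmooth_scale: "csmooth UNIV V c \<Longrightarrow> vsmooth V g \<Longrightarrow> vsmooth V (\<lambda>y. c y *s g y)"
  and vsmooth_cnj: "vsmooth V f \<Longrightarrow> vsmooth V (\<lambda>y. vcnj (f y))"
  and vsmooth_const: "open V \<Longrightarrow> vsmooth V (\<lambda>y. v)"
  by (auto simp: vsmooth_def vcnj_def intro: csmooth_diff csmooth_mult csmooth_cnj csmooth_const)

lemma vsmooth_mv:
  assumes "msmooth V A" "vsmooth V f" shows "vsmooth V (\<lambda>y. cm (A y) *v f y)"
proof -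
  have "csmooth UNIV V (\<lambda>y. complex_of_real (A y $ a $ b))" for a b
    using assms(1) by (auto simp: msmooth_def intro: csmooth_of_real)
  then show ?thesis
    using assms(2) msmooth_open[OF assms(1)]
    by (auto simp: vsmooth_def matrix_vector_mult_def cm_def intro!: csmooth_sum csmooth_mult)
qed

lemma csmooth_bil: "vsmooth V f \<Longrightarrow> vsmooth V g \<Longrightarrow> csmooth UNIV V (\<lambda>y. bil (f y) (g y))"
  using vsmooth_open[of V f] by (auto simp: vsmooth_def bil_def intro!: csmooth_sum csmooth_mult)

lemma csmooth_herm:
  "msmooth V H \<Longrightarrow> vsmooth V f \<Longrightarrow> vsmooth V g \<Longrightarrow> csmooth UNIV V (\<lambda>y. herm (H y) (f y) (g y))"
  unfolding herm_def hb_def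
  by (intro csmooth_mult csmooth_bil vsmooth_cnj vsmooth_mv csmooth_const) (simp_all add: msmooth_open)

lemma msmooth_const: "open V \<Longrightarrow> msmooth V (\<lambda>y. C)"
  and msmooth_add: "msmooth V A \<Longrightarrow> msmooth V B \<Longrightarrow> msmooth V (\<lambda>y. A y + B y)"
  and msmooth_diff: "msmooth V A \<Longrightarrow> msmooth V B \<Longrightarrow> msmooth V (\<lambda>y. A y - B y)"
  and msmooth_uminus: "msmooth V A \<Longrightarrow> msmooth V (\<lambda>y. - A y)"
  and msmooth_transpose: "msmooth V A \<Longrightarrow> msmooth V (\<lambda>y. transpose (A y))"
  and msmooth_scaleR: "smooth_fn UNIV V c \<Longrightarrow> msmooth V B \<Longrightarrow> msmooth V (\<lambda>y. c y *\<^sub>R B y)"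
  by (auto simp: msmooth_def transpose_def intro!: smooth_fn_const smooth_fn_add smooth_fn_diff smooth_fn_uminus smooth_fn_mult)

lemma msmooth_mult:
  assumes "msmooth V A" "msmooth V B" shows "msmooth V (\<lambda>y. A y ** B y)"
  using assms msmooth_open[OF assms(1)]
  by (auto simp: msmooth_def matrix_matrix_mult_def intro!: smooth_fn_sum smooth_fn_mult)

lemma msmooth_subset: "msmooth V A \<Longrightarrow> open U \<Longrightarrow> U \<subseteq> V \<Longrightarrow> msmooth U A"
  unfolding msmooth_def using smooth_fn_subset open_in_coord_UNIV by blast

lemma smooth_det:
  assumes "\<And>i j. smooth_fn UNIV V (\<lambda>y. A y $ i $ j)"
  shows "smooth_fn UNIV V (\<lambda>y. det (A y :: real^'n^'n))"
  unfolding det_def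
  by (intro smooth_fn_sum smooth_fn_mult smooth_fn_const smooth_fn_prod assms smooth_fn_open[OF assms])

text \<open>By Cramer's rule the entries of the inverse are quotients of determinants with smooth
  entries.\<close>

lemma msmooth_matrix_inv:
  assumes A: "msmooth V A" and d: "\<And>y. y \<in> V \<Longrightarrow> det (A y) \<noteq> 0"
  shows "msmooth V (\<lambda>y. matrix_inv (A y))"
  unfolding msmooth_def
proof (intro allI)
  fix k b
  define C where "C y = (\<chi> i j. if j = k then axis b 1 $ i else A y $ i $ j)" for y
  have e: "matrix_inv (A y) $ k $ b = det (C y) / det (A y)" if "y \<in> V" for y
  proof -
    have "A y ** matrix_inv (A y) = mat 1" using d[OF that] by (rule matrix_inv_det)
    then have "A y *v (matrix_inv (A y) *v axis b 1) = axis b 1" by (simp add: matrix_vector_mul_assoc)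
    then have "matrix_inv (A y) *v axis b 1 = (\<chi> k. det (\<chi> i j. if j = k then axis b 1 $ i else A y $ i $ j) / det (A y))"
      using cramer[OF d[OF that]] by blast
    then have "(matrix_inv (A y) *v axis b 1) $ k = det (C y) / det (A y)"
      by (simp add: C_def)
    then show ?thesis by (simp add: matrix_vector_mult_def axis_def if_distrib cong: if_cong)
  qed
  have o: "open V" using A by (rule msmooth_open)
  have "smooth_fn UNIV V (\<lambda>y. C y $ i $ j)" for i j
    using A o by (cases "j = k") (auto simp: C_def msmooth_def intro: smooth_fn_const)
  then have "smooth_fn UNIV V (\<lambda>y. det (C y) / det (A y))"
    using A d by (intro smooth_fn_divide smooth_det) (auto simp: msmooth_def)
  then show "smooth_fn UNIV V (\<lambda>y. matrix_inv (A y) $ k $ b)"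
    by (rule smooth_fn_cong) (simp add: e)
qed

lemma local_section_msmooth:
  assumes "local_section F W s"
  shows "msmooth W (\<lambda>y. J_of (s y))" "msmooth W (\<lambda>y. eta_of (s y))"
  using assms by (auto simp: local_section_def smooth_map_def msmooth_def J_of_def eta_of_def)

lemma vsmooth_unitv:
  assumes H: "msmooth V H" and f: "vsmooth V f" and p: "\<And>y. y \<in> V \<Longrightarrow> Re (herm (H y) (f y) (f y)) > 0"
  shows "vsmooth V (\<lambda>y. unitv (H y) (f y))"
proof -
  have "smooth_fn UNIV V (\<lambda>y. Re (herm (H y) (f y) (f y)))"
    using csmooth_herm[OF H f f] by (simp add: csmooth_def)
  then have "smooth_fn UNIV V (\<lambda>y. inverse (sqrt (Re (herm (H y) (f y) (f y)))))"
    by (intro smooth_fn_inverse smooth_fn_sqrt) (use p in \<open>auto simp: less_imp_neq[symmetric] order_less_imp_not_eq2\<close>)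
  then show ?thesis
    unfolding unitv_def by (intro vsmooth_scale csmooth_of_real f)
qed

lemma det_open:
  assumes "msmooth W A"
  shows "open {y \<in> W. det (A y) \<noteq> 0}"
proof -
  have "continuous_on W (\<lambda>y. det (A y))"
    by (rule smooth_fn_continuous[OF smooth_det]) (use assms in \<open>simp add: msmooth_def\<close>)
  then have "open ((\<lambda>y. det (A y)) -` (- {0}) \<inter> W)"
    using continuous_on_open_vimage[OF msmooth_open[OF assms]] by blast
  moreover have "(\<lambda>y. det (A y)) -` (- {0}) \<inter> W = {y \<in> W. det (A y) \<noteq> 0}" by auto
  ultimately show ?thesis by simp
qed

text \<open>\<open>quasi_integrable_at\<close> quantifies over coframings and would hold vacuously
  if there were none. A smooth frame of (0,1)-vectors near \<open>x\<close> is orthonormalized and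
  then lowered with eta.\<close>

lemma conformally_unitary_exists:
  assumes s: "local_section cu_fibre W s" and x: "x \<in> W"
  obtains V \<alpha> where "V \<subseteq> W" "x \<in> V" "conformally_unitary s V \<alpha>"
proof -
  have sf: "hermitian_structure (J_of (s y)) (eta_of (s y))" if "y \<in> W" for y
    using section_hermitian_1jet[OF s that] by (simp add: hermitian_1jet_def)
  let ?J = "\<lambda>y. J_of (s y)" let ?H = "\<lambda>y. eta_of (s y)"
  have ac: "almost_complex (?J y)" if "y \<in> W" for y using sf[OF that] by (simp add: hermitian_structure_def)
  obtain g where g: "det g \<noteq> 0" "?J x ** g = g ** J0"
    using almost_complex_normal_form[OF ac[OF x]] .
  \<comment> \<open>\<open>mat 1 - J_y ** J_x\<close> intertwines J_x with J_y and equals 2 at y =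
    x. So \<open>k y\<close> brings J_y into normal form, depends smoothly on y, and is invertible
    near \<open>x\<close> because \<open>k x = g\<close>.\<close>
  define k where "k y = (1/2) *\<^sub>R ((mat 1 - ?J y ** ?J x) ** g)" for y
  have JJ: "?J y ** ?J y = - mat 1" if "y \<in> W" for y using ac[OF that] by (simp add: almost_complex_def)
  have kx: "k x = g"
    using JJ[OF x] by (simp add: k_def scaleR_2[symmetric] mm_simps)
  have Jk: "?J y ** k y = k y ** J0" if y: "y \<in> W" for y
  proof -
    have "?J y ** ((mat 1 - ?J y ** ?J x) ** g) = (?J y + ?J x) ** g"
      using JJ[OF y] by (simp add: matrix_mul_assoc mm_simps)
    moreover have "((mat 1 - ?J y ** ?J x) ** g) ** J0 = (mat 1 - ?J y ** ?J x) ** (?J x ** g)"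
      by (simp add: g(2) matrix_mul_assoc)
    moreover have "(mat 1 - ?J y ** ?J x) ** (?J x ** g) = (?J x + ?J y) ** g"
    proof -
      have "(mat 1 - ?J y ** ?J x) ** ?J x = ?J x - ?J y ** (?J x ** ?J x)"
        by (simp add: matrix_mul_assoc mm_simps)
      also have "\<dots> = ?J x + ?J y" using JJ[OF x] by (simp add: mm_simps)
      finally show ?thesis by (simp add: matrix_mul_assoc)
    qed
    ultimately show ?thesis unfolding k_def mm_simps(7,8) by (simp add: add.commute)
  qed
  have ks: "msmooth W k" unfolding k_def
    by (intro msmooth_scaleR msmooth_mult msmooth_diff msmooth_const local_section_msmooth[OF s] smooth_fn_const)
      (use s in \<open>auto simp: local_section_def\<close>)
  define V where "V = {y \<in> W. det (k y) \<noteq> 0}"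
  have V: "V \<subseteq> W" "x \<in> V" "open V" using x g kx det_open[OF ks] by (auto simp: V_def)
  have Hs: "msmooth V ?H" and Js: "msmooth V ?J" and ks: "msmooth V k"
    using local_section_msmooth[OF s] V(1,3) ks msmooth_subset by blast+
  define F where "F i y = cm (k y) *v ee i" for i :: 3 and y
  have FT: "T01 (?J y) (F i y)" if "y \<in> V" for i y
  proof -
    have "cm (?J y) ** cm (k y) = cm (k y) ** cm J0" using Jk that V(1) by (metis cm_mult subsetD)
    then have "cm (?J y) *v F i y = cm (k y) *v (cm J0 *v ee i)"
      by (simp add: F_def matrix_vector_mul_assoc)
    then show ?thesis using T01_ee[of i] by (simp add: T01_def F_def vector_scalar_commute mv_uminus_right vs_alg)
  qed
  have inv: "cm (k y) ** cm (matrix_inv (k y)) = mat 1" "cm (matrix_inv (k y)) ** cm (k y) = mat 1" if "y \<in> V" for y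
    using matrix_inv_det[of "k y"] that by (simp_all add: cm_mult[symmetric] V_def)
  have Fspan: "\<exists>c. v = (\<Sum>i\<in>UNIV. c i *s F i y)" if y: "y \<in> V" and v: "T01 (?J y) v" for y v
    proof -
      define w where "w = cm (matrix_inv (k y)) *v v"
      have kw: "cm (k y) *v w = v" by (simp add: w_def matrix_vector_mul_assoc inv[OF y])
      have "cm (k y) ** cm J0 = cm (?J y) ** cm (k y)" using Jk y V(1) by (metis cm_mult subsetD)
      then have "cm (k y) *v (cm J0 *v w) = cm (?J y) *v v" by (metis kw matrix_vector_mul_assoc)
      then have "cm (k y) *v (cm J0 *v w) = cm (k y) *v ((- \<i>) *s w)"
        using v by (simp add: T01_def kw vector_scalar_commute mv_uminus_right vs_alg)
      then have "cm J0 *v w = (- \<i>) *s w"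
        by (metis inv(2)[OF y] matrix_vector_mul_assoc matrix_vector_mul_lid)
      then have "w = (\<Sum>k\<in>UNIV. (2 * w $ rx k) *s ee k)" by (intro T01_J0_span) (simp add: T01_def)
      then have "v = (\<Sum>i\<in>UNIV. (2 * w $ rx i) *s F i y)"
        unfolding F_def vector_scalar_commute[symmetric] mv_sum_right[symmetric] by (metis kw)
      then show ?thesis by - (rule exI, assumption)
    qed
  have Find: "c = (\<lambda>_. 0)" if y: "y \<in> V" and c: "(\<Sum>i\<in>UNIV. c i *s F i y) = 0" for y c
    proof
      fix j
      have z: "cm (k y) *v (\<Sum>i\<in>UNIV. c i *s ee i) = 0"
        using c by (simp add: F_def mv_sum_right vector_scalar_commute)
      have "cm (matrix_inv (k y)) *v (cm (k y) *v (\<Sum>i\<in>UNIV. c i *s ee i)) = 0"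
      unfolding z by (simp add: matrix_vector_mult_def vec_eq_iff)
    then have "(\<Sum>i\<in>UNIV. c i *s ee i) = 0"
        by (simp add: matrix_vector_mul_assoc inv(2)[OF y])
      then have "bil (\<Sum>i\<in>UNIV. c i *s ee i) (vcnj (ee j)) = 0" by (simp add: bil_simps)
      moreover have "bil (\<Sum>i\<in>UNIV. c i *s ee i) (vcnj (ee j)) = (\<Sum>i\<in>UNIV. if j = i then c i / 2 else 0)"
        unfolding bil_sum_left bil_simps by (intro sum.cong refl) (simp add: bil_commute[of "ee _" "vcnj _"] bil_ee)
      ultimately show "c j = 0" by simp
    qed
  \<comment> \<open>Gram-Schmidt written out for three vectors; the squared lengths are positive, so
    that dividing by their square roots preserves smoothness.\<close>
  define E1 where "E1 y = unitv (?H y) (F 1 y)" for y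
  define G2 where "G2 y = F 2 y - herm (?H y) (E1 y) (F 2 y) *s E1 y" for y
  define E2 where "E2 y = unitv (?H y) (G2 y)" for y
  define G3 where "G3 y = F 3 y - herm (?H y) (E1 y) (F 3 y) *s E1 y - herm (?H y) (E2 y) (F 3 y) *s E2 y" for y
  define E3 where "E3 y = unitv (?H y) (G3 y)" for y
  define E where "E i y = (if i = (1::3) then E1 y else if i = 2 then E2 y else E3 y)" for i y
  have pt: "Re (herm (?H y) (F 1 y) (F 1 y)) > 0 \<and> Re (herm (?H y) (G2 y) (G2 y)) > 0 \<and> Re (herm (?H y) (G3 y) (G3 y)) > 0
     \<and> (\<forall>i. T01 (?J y) (E i y)) \<and> (\<forall>i j. herm (?H y) (E i y) (E j y) = (if i = j then 1 else 0))
     \<and> (\<forall>v. T01 (?J y) v \<longrightarrow> (\<exists>c. v = (\<Sum>k\<in>UNIV. c k *s E k y)))" if y: "y \<in> V" for y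
  proof -
    interpret hermitian_structure "?J y" "?H y" using sf y V(1) by blast
    note T = FT[OF y]
    have F1: "F 1 y \<noteq> 0"
    proof
      assume "F 1 y = 0"
      then have "(\<Sum>i\<in>UNIV. (if i = 1 then 1 else 0) *s F i y) = 0" by (simp add: sum_3)
      from fun_cong[OF Find[OF y this], of 1] show False by simp
    qed
    note U1 = unitv[OF T F1, folded E1_def]
    obtain a where a: "F 1 y = a *s E1 y" using U1(3) by blast
    obtain a' where a': "E1 y = a' *s F 1 y" unfolding E1_def unitv_def by blast
    have TG2: "T01 (?J y) (G2 y)" unfolding G2_def by (intro T01_closed T U1(1))
    have G2: "G2 y \<noteq> 0"
    proof
      assume "G2 y = 0"
      then have "(\<Sum>i\<in>UNIV. (if i = 1 then - herm (?H y) (E1 y) (F 2 y) * a' else if i = 2 then 1 else 0) *s F i y) = 0"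
        by (simp add: sum_3 G2_def a' vs_alg)
      from fun_cong[OF Find[OF y this], of 2] show False by simp
    qed
    note U2 = unitv[OF TG2 G2, folded E2_def]
    obtain b where b: "G2 y = b *s E2 y" using U2(3) by blast
    obtain b' where b': "E2 y = b' *s G2 y" unfolding E2_def unitv_def by blast
    have o12: "herm (?H y) (E1 y) (G2 y) = 0" by (simp add: G2_def herm_simps U1(2))
    then have o12: "herm (?H y) (E1 y) (E2 y) = 0" by (rule U2(4))
    then have o21: "herm (?H y) (E2 y) (E1 y) = 0" using herm_cnj[of "E1 y" "E2 y"] by simp
    have TG3: "T01 (?J y) (G3 y)" unfolding G3_def by (intro T01_closed T U1(1) U2(1))
    have G3: "G3 y \<noteq> 0"
    proof
      assume "G3 y = 0"
      then have "F 3 y - herm (?H y) (E1 y) (F 3 y) *s (a' *s F 1 y) - herm (?H y) (E2 y) (F 3 y) *s (b' *s (F 2 y - herm (?H y) (E1 y) (F 2 y) *s (a' *s F 1 y))) = 0"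
        unfolding G3_def by (metis a' b' G2_def)
      then have "(\<Sum>i\<in>UNIV. (if i = 1 then - herm (?H y) (E1 y) (F 3 y) * a' + herm (?H y) (E2 y) (F 3 y) * b' * herm (?H y) (E1 y) (F 2 y) * a'
          else if i = 2 then - herm (?H y) (E2 y) (F 3 y) * b' else 1) *s F i y) = 0"
        by (simp add: sum_3 vec_eq_iff algebra_simps)
      from fun_cong[OF Find[OF y this], of 3] show False by simp
    qed
    note U3 = unitv[OF TG3 G3, folded E3_def]
    obtain c where c: "G3 y = c *s E3 y" using U3(3) by blast
    have "herm (?H y) (E1 y) (G3 y) = 0" "herm (?H y) (E2 y) (G3 y) = 0" by (simp_all add: G3_def herm_simps U1(2) U2(2) o12 o21)
    then have o3: "herm (?H y) (E1 y) (E3 y) = 0" "herm (?H y) (E2 y) (E3 y) = 0" by (auto intro: U3(4))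
    then have o3': "herm (?H y) (E3 y) (E1 y) = 0" "herm (?H y) (E3 y) (E2 y) = 0"
      using herm_cnj[of "E1 y" "E3 y"] herm_cnj[of "E2 y" "E3 y"] by simp_all
    have "\<exists>c. v = (\<Sum>k\<in>UNIV. c k *s E k y)" if "T01 (?J y) v" for v
    proof -
      obtain d where d: "v = (\<Sum>i\<in>UNIV. d i *s F i y)" using Fspan[OF y \<open>T01 (?J y) v\<close>] by blast
      define h where "h = herm (?H y) (E1 y) (F 2 y)"
      define h1 where "h1 = herm (?H y) (E1 y) (F 3 y)"
      define h2 where "h2 = herm (?H y) (E2 y) (F 3 y)"
      have F2: "F 2 y = b *s E2 y + h *s E1 y" using b by (simp add: G2_def h_def algebra_simps)
      have F3: "F 3 y = c *s E3 y + h1 *s E1 y + h2 *s E2 y" using c by (simp add: G3_def h1_def h2_def algebra_simps)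
      have "v = (\<Sum>k\<in>UNIV. (if k = 1 then d 1 * a + d 2 * h + d 3 * h1 else if k = 2 then d 2 * b + d 3 * h2 else d 3 * c) *s E k y)"
        unfolding d by (simp add: sum_3 E_def a F2 F3 vec_eq_iff algebra_simps)
      then show ?thesis by - (rule exI, assumption)
    qed
    moreover have "T01 (?J y) (E i y)" for i by (simp add: E_def U1(1) U2(1) U3(1))
    moreover have "herm (?H y) (E i y) (E j y) = (if i = j then 1 else 0)" for i j
      using exhaust_3[of i] exhaust_3[of j] by (elim disjE) (simp_all add: E_def U1(2) U2(2) U3(2) o12 o21 o3 o3')
    ultimately show ?thesis using herm_pos(1)[OF T F1] herm_pos(1)[OF TG2 G2] herm_pos(1)[OF TG3 G3] by blast
  qed
  have Fs: "vsmooth V (F i)" for i unfolding F_def by (intro vsmooth_mv ks vsmooth_const V(3))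
  have E1s: "vsmooth V E1" unfolding E1_def by (rule vsmooth_unitv[OF Hs Fs]) (use pt in blast)
  have G2s: "vsmooth V G2" unfolding G2_def by (intro vsmooth_diff vsmooth_scale csmooth_herm Fs E1s Hs)
  have E2s: "vsmooth V E2" unfolding E2_def by (rule vsmooth_unitv[OF Hs G2s]) (use pt in blast)
  have G3s: "vsmooth V G3" unfolding G3_def by (intro vsmooth_diff vsmooth_scale csmooth_herm Fs E1s E2s Hs)
  have E3s: "vsmooth V E3" unfolding E3_def by (rule vsmooth_unitv[OF Hs G3s]) (use pt in blast)
  have Es: "vsmooth V (E i)" for i unfolding E_def using E1s E2s E3s by (cases "i = 1"; cases "i = 2") simp_all
  define \<alpha> where "\<alpha> i y a = (cm (?H y) *v E i y) $ a" for i :: 3 and y a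
  have "vsmooth V (\<lambda>y. cm (?H y) *v E i y)" for i by (intro vsmooth_mv Hs Es)
  then have sm: "smooth_fn UNIV V (\<lambda>y. Re (\<alpha> i y a))" "smooth_fn UNIV V (\<lambda>y. Im (\<alpha> i y a))" for i a
    by (auto simp: vsmooth_def csmooth_def \<alpha>_def)
  have "conformally_unitary s V \<alpha>"
    unfolding conformally_unitary_def linear_coframing_def
  proof (intro conjI allI ballI impI exI[of _ "\<lambda>_. 2"])
    fix y assume y: "y \<in> V"
    interpret hermitian_structure "?J y" "?H y" using sf y V(1) by blast
    have p: "\<And>i. T01 (?J y) (E i y)" "\<And>i j. herm (?H y) (E i y) (E j y) = (if i = j then 1 else 0)"
      "\<And>v. T01 (?J y) v \<Longrightarrow> \<exists>c. v = (\<Sum>k\<in>UNIV. c k *s E k y)"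
      using pt[OF y] by auto
    show "(\<Sum>a\<in>UNIV. \<alpha> i y a * complex_of_real (?J y $ a $ b)) = \<i> * \<alpha> i y b" for i b
      unfolding \<alpha>_def by (rule unitary_frame_eta(3)[of "\<lambda>i. E i y"]) (rule p, assumption?)+
    show "c i = 0" if "\<forall>a. (\<Sum>i\<in>UNIV. c i * \<alpha> i y a) = 0" for c i
      using that unfolding \<alpha>_def
      by (intro unitary_frame_eta(2)[of "\<lambda>i. E i y" c i]) (rule p, assumption?, (rule p, assumption?)+, blast)
    show "complex_of_real (?H y $ a $ b) = complex_of_real 2 * (\<i> / 2) * (\<Sum>i\<in>UNIV. wedge (\<alpha> i y) (\<lambda>c. cnj (\<alpha> i y c)) a b)" for a b
      unfolding \<alpha>_def by (rule unitary_frame_eta(1)[of "\<lambda>i. E i y"]) (rule p, assumption?)+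
  qed (use sm V in auto)
  then show ?thesis using that V by blast
qed

text \<open>The quantifier over coframings is traded for polynomial equations in the 1-jet, the form
  in which the system can be differentiated.\<close>

lemma quasi_integrable_at_iff:
  assumes s: "local_section cu_fibre W s" and x: "x \<in> W"
  shows "quasi_integrable_at s W x \<longleftrightarrow> (\<forall>u v w. psi (J_of (s x)) (eta_of (s x)) (dJ s x) u v w = 0)"
  using quasi_integrable_atI[OF s x] conformally_unitary_exists[OF s x] quasi_integrable_atD[OF s]
  by metis

section \<open>Orthogonal almost complex structures\<close>

text \<open>For orthogonal \<open>J\<close> the form with matrix \<open>- J\<close> is the
  fundamental form of the Euclidean metric: eta(v, J v) = |v|^2.\<close>

lemma positive_11_uminus:
  assumes JJ: "J ** J = - mat 1" and T: "transpose J = - J"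
  shows "positive_11 J (- J)"
  unfolding positive_11_def
proof (intro conjI allI impI)
  have "transpose (- J) = - transpose J" by (simp add: transpose_def vec_eq_iff)
  then show "transpose (- J) = - (- J)" by (simp add: T)
  show "transpose J ** - J ** J = - J" unfolding T mm_simps JJ by simp
  fix v :: "real^6" assume "v \<noteq> 0"
  moreover have "almost_complex J" using JJ by (simp add: almost_complex_def)
  then have "(- J) *v (J *v v) = v" unfolding mv_uminus by (simp add: almost_complex_mv)
  ultimately show "v \<bullet> (- J *v (J *v v)) > 0" by simp
qed

lemma positive_11_J0: "positive_11 J0 (- J0)"
  by (rule positive_11_uminus[OF J0_J0 J0_skew])

interpretation std: hermitian_structure J0 "- J0"
  by unfold_locales (simp_all add: almost_complex_J0 positive_11_J0)

lemma hb_uminus: "hb (- A) u v = - hb A u v"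
  by (simp add: hb_def cm_uminus mv_uminus bil_simps)

lemma ee_basis: "\<exists>c d. v = (\<Sum>k\<in>UNIV. c k *s ee k) + (\<Sum>k\<in>UNIV. d k *s vcnj (ee k))"
proof -
  obtain a b where ab: "v = a + b" "T01 J0 a" "T10 J0 b" using std.T01_T10_decomp by blast
  have "vcnj b = (\<Sum>k\<in>UNIV. (2 * vcnj b $ rx k) *s ee k)"
    using ab(3) by (intro T01_J0_span) (simp add: T01_vcnj)
  then have "b = vcnj (\<Sum>k\<in>UNIV. (2 * vcnj b $ rx k) *s ee k)" by (metis vcnj_simps(4))
  then have "b = (\<Sum>k\<in>UNIV. cnj (2 * vcnj b $ rx k) *s vcnj (ee k))"
    by (metis (no_types, lifting) sum.cong sum_3 vcnj_simps(1,3))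
  then show ?thesis unfolding ab(1) using T01_J0_span[OF ab(2)] by metis
qed

text \<open>A real matrix commutes with conjugation, so it also kills the conjugates of the
  \<open>ee k\<close>; together they span.\<close>

lemma cm_eq_0:
  assumes "\<And>k. cm A *v ee k = 0"
  shows "A = 0"
proof -
  have "cm A *v vcnj (ee k) = 0" for k using arg_cong[OF assms[of k], of vcnj] by (simp add: vcnj_cm)
  then have "cm A *v v = 0" for v
    using ee_basis[of v] assms by (auto simp: matrix_vector_right_distrib mv_sum_right vector_scalar_commute)
  from this[of "axis _ 1"] have "complex_of_real (A $ a $ b) = 0" for a b
    by (simp add: vec_eq_iff matrix_vector_mult_def cm_def axis_def if_distrib cong: if_cong)
  then show ?thesis by (simp add: vec_eq_iff)
qed

text \<open>\<open>Smat B\<close> is the antilinear endomorphism mapping \<open>ee l\<close> to \<open>- \<Sum>\<^sub>q B q l *s vcnj (ee q)\<close>.\<close>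

definition Smat :: "(3 \<Rightarrow> 3 \<Rightarrow> complex) \<Rightarrow> real^6^6" where
  "Smat B = (\<chi> a b. - 4 * Re (\<Sum>q\<in>UNIV. \<Sum>l\<in>UNIV. B q l * (cnj (ee q $ a) * cnj (ee l $ b))))"

lemma bil_ee': "bil (ee k) (vcnj (ee l)) = (if k = l then 1/2 else 0)" "bil (vcnj (ee k)) (vcnj (ee l)) = 0"
  using bil_ee(2)[of l k] bil_cnj[of "ee k" "ee l"] by (auto simp: bil_commute[of "ee k"] bil_ee)

lemma Smat_ee: "cm (Smat B) *v ee m = - (\<Sum>q\<in>UNIV. B q m *s vcnj (ee q))"
proof -
  have "(cm (Smat B) *v ee m) $ a = - (\<Sum>q\<in>UNIV. B q m *s vcnj (ee q)) $ a" for a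
  proof -
    have c: "complex_of_real (Smat B $ a $ b) = - 2 * (\<Sum>q\<in>UNIV. \<Sum>l\<in>UNIV. B q l * cnj (ee q $ a) * cnj (ee l $ b))
        - 2 * (\<Sum>q\<in>UNIV. \<Sum>l\<in>UNIV. cnj (B q l) * ee q $ a * ee l $ b)" for b
    proof -
      define X where "X = (\<Sum>q\<in>UNIV. \<Sum>l\<in>UNIV. B q l * (cnj (ee q $ a) * cnj (ee l $ b)))"
      have "Smat B $ a $ b = - 4 * Re X" unfolding Smat_def X_def by simp
      then have e: "complex_of_real (Smat B $ a $ b) = - 2 * (X + cnj X)"
        by (simp add: complex_eq_iff)
      have "X = (\<Sum>q\<in>UNIV. \<Sum>l\<in>UNIV. B q l * cnj (ee q $ a) * cnj (ee l $ b))"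
        "cnj X = (\<Sum>q\<in>UNIV. \<Sum>l\<in>UNIV. cnj (B q l) * ee q $ a * ee l $ b)"
        by (simp_all add: X_def mult.assoc)
      note X = this[symmetric]
      show ?thesis unfolding X e by (simp add: algebra_simps)
    qed
    have "(cm (Smat B) *v ee m) $ a = (\<Sum>b\<in>UNIV. (- 2 * (\<Sum>q\<in>UNIV. \<Sum>l\<in>UNIV. B q l * cnj (ee q $ a) * cnj (ee l $ b))
        - 2 * (\<Sum>q\<in>UNIV. \<Sum>l\<in>UNIV. cnj (B q l) * ee q $ a * ee l $ b)) * ee m $ b)"
      by (simp add: matrix_vector_mult_def cm_def c)
    also have "\<dots> = - 2 * (\<Sum>q\<in>UNIV. \<Sum>l\<in>UNIV. B q l * cnj (ee q $ a) * bil (vcnj (ee l)) (ee m))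
        - 2 * (\<Sum>q\<in>UNIV. \<Sum>l\<in>UNIV. cnj (B q l) * ee q $ a * bil (ee l) (ee m))"
      by (simp add: bil_def vcnj_def sum_3 sum_6 algebra_simps)
    also have "\<dots> = - (\<Sum>q\<in>UNIV. B q m * cnj (ee q $ a))"
      using exhaust_3[of m] by (elim disjE) (simp_all add: bil_ee sum_3)
    finally show ?thesis by (simp add: vcnj_def)
  qed
  then show ?thesis by (simp add: vec_eq_iff)
qed

lemma J0_Smat: "J0 ** Smat B = - (Smat B ** J0)"
proof -
  have "cm (J0 ** Smat B + Smat B ** J0) *v ee k = 0" for k
  proof -
    have a: "cm J0 *v vcnj (ee q) = \<i> *s vcnj (ee q)" for q
      using T01_ee[of q] T10_vcnj[of J0 "ee q"] by (simp add: T10_def)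
    have b: "cm J0 *v ee q = (- \<i>) *s ee q" for q
      using T01_ee[of q] by (simp add: T01_def)
    show ?thesis
      unfolding cm_add cm_mult matrix_vector_mult_add_rdistrib matrix_vector_mul_assoc[symmetric] b Smat_ee vector_scalar_commute
        mv_uminus_right mv_sum_right a
      by (simp add: vec_eq_iff sum_3 algebra_simps)
  qed
  then show ?thesis using cm_eq_0 eq_neg_iff_add_eq_0 by blast
qed

lemma transpose_Smat:
  assumes "\<And>q l. B l q = - B q l"
  shows "transpose (Smat B) = - Smat B"
proof -
  define Y where "Y a b = (\<Sum>q\<in>UNIV. \<Sum>l\<in>UNIV. B q l * (cnj (ee q $ a) * cnj (ee l $ b)))" for a b
  have sw: "Y b a = - Y a b" for a b
  proof -
    have "Y b a = (\<Sum>l\<in>UNIV. \<Sum>q\<in>UNIV. B q l * (cnj (ee q $ b) * cnj (ee l $ a)))"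
      unfolding Y_def by (rule sum.swap)
    also have "\<dots> = (\<Sum>l\<in>UNIV. \<Sum>q\<in>UNIV. - (B l q * (cnj (ee l $ a) * cnj (ee q $ b))))"
      by (intro sum.cong refl) (subst assms, simp add: mult_ac)
    finally show ?thesis by (simp add: sum_negf Y_def)
  qed
  have "Smat B $ a $ b = - 4 * Re (Y a b)" for a b unfolding Smat_def Y_def by simp
  then have "transpose (Smat B) $ a $ b = (- Smat B) $ a $ b" for a b
    using sw[of b a] by (simp add: transpose_def)
  then show ?thesis by (simp add: vec_eq_iff)
qed

lemma transpose_add: "transpose (A + C) = transpose A + transpose (C :: real^6^6)"
  by (simp add: transpose_def vec_eq_iff)

text \<open>The image of the standard (0,1)-space under this matrix is the graph of - B. The graph
  is isotropic for the Euclidean metric exactly when B is skew, that is, when it is the (0,1)-space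
  of an orthogonal structure.\<close>

definition cayley :: "(3 \<Rightarrow> 3 \<Rightarrow> complex) \<Rightarrow> real^6^6" where
  "cayley B = mat 1 + Smat B"

text \<open>Since S = \<open>Smat B\<close> anticommutes with \<open>J0\<close>, this equals (1 + S)
  (1 - S)^(-1) J0, the Cayley transform of S followed by the standard structure; for skew B it is
  rational in the coordinates B and orthogonal.\<close>

definition orthJ :: "(3 \<Rightarrow> 3 \<Rightarrow> complex) \<Rightarrow> real^6^6" where
  "orthJ B = cayley B ** J0 ** matrix_inv (cayley B)"

text \<open>For skew-symmetric S the vectors v and S v are orthogonal, so v + S v = 0 forces v =
  0.\<close>

lemma det_cayley:
  assumes "\<And>q l. B l q = - B q l"
  shows "det (cayley B) \<noteq> 0"
proof -
  have "v = 0" if v: "cayley B *v v = 0" for v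
  proof -
    have "v \<bullet> (Smat B *v v) = (transpose (Smat B) *v v) \<bullet> v" by (simp add: dot_lmul_matrix[symmetric])
    then have "v \<bullet> (Smat B *v v) = 0" by (simp add: transpose_Smat[OF assms] mv_uminus inner_commute)
    moreover have "v + Smat B *v v = 0" using v by (simp add: cayley_def matrix_vector_mult_add_rdistrib)
    ultimately have "v \<bullet> v = 0" by (metis add.right_neutral inner_add_right inner_zero_right)
    then show ?thesis by simp
  qed
  then obtain A where "A ** cayley B = mat 1" using matrix_left_invertible_ker by blast
  then have "invertible (cayley B)" using invertible_def matrix_left_right_inverse by blast
  then show ?thesis by (simp add: invertible_det_nz)
qed

lemma orthJ:
  assumes "\<And>q l. B l q = - B q l"
  shows "orthJ B ** cayley B = cayley B ** J0" "orthJ B ** orthJ B = - mat 1" "transpose (orthJ B) = - orthJ B"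
proof -
  note inv = matrix_inv_det[OF det_cayley[OF assms]]
  show 1: "orthJ B ** cayley B = cayley B ** J0"
    by (simp add: orthJ_def matrix_mul_assoc[symmetric] inv)
  show "orthJ B ** orthJ B = - mat 1"
  proof -
    have "orthJ B ** orthJ B = (orthJ B ** cayley B) ** J0 ** matrix_inv (cayley B)"
      by (simp add: orthJ_def matrix_mul_assoc)
    also have "\<dots> = cayley B ** (J0 ** J0) ** matrix_inv (cayley B)"
      unfolding 1 by (simp add: matrix_mul_assoc)
    finally show ?thesis by (simp add: J0_J0 mm_simps inv)
  qed
  let ?g = "cayley B" let ?J = "orthJ B"
  \<comment> \<open>K is 1 - S^2 and commutes with \<open>J0\<close>. Hence \<open>K ** J0\<close>,
    which is the transform of \<open>?J\<close> by the congruence with \<open>?g\<close>, is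
    skew-symmetric, and undoing the congruence gives skewness of \<open>?J\<close>.\<close>
  define K where "K = transpose ?g ** ?g"
  have tg: "transpose ?g = mat 1 - Smat B"
    unfolding cayley_def transpose_add transpose_mat transpose_Smat[OF assms] by simp
  have "K = mat 1 - Smat B ** Smat B"
    unfolding K_def tg by (simp add: cayley_def mm_simps)
  moreover have "J0 ** (Smat B ** Smat B) = Smat B ** Smat B ** J0"
  proof -
    have "J0 ** (Smat B ** Smat B) = - (Smat B ** J0 ** Smat B)"
      by (simp only: matrix_mul_assoc J0_Smat mm_simps)
    also have "\<dots> = - (Smat B ** (J0 ** Smat B))" by (simp only: matrix_mul_assoc)
    also have "\<dots> = Smat B ** Smat B ** J0" by (simp only: J0_Smat mm_simps minus_minus matrix_mul_assoc)
    finally show ?thesis .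
  qed
  ultimately have KJ: "K ** J0 = J0 ** K" by (simp add: mm_simps)
  have KT: "transpose K = K" by (simp add: K_def matrix_transpose_mul)
  have a: "transpose ?g ** ?J ** ?g = K ** J0"
    by (simp add: K_def matrix_mul_assoc[symmetric] 1)
  have "transpose ?g ** transpose ?J ** ?g = transpose (K ** J0)"
    unfolding a[symmetric] by (simp add: matrix_transpose_mul matrix_mul_assoc)
  also have "\<dots> = - (K ** J0)"
    by (simp add: matrix_transpose_mul KT J0_skew mm_simps KJ)
  finally have "transpose ?g ** transpose ?J ** ?g = - (transpose ?g ** ?J ** ?g)" by (simp add: a)
  then have "matrix_inv (transpose ?g) ** (transpose ?g ** transpose ?J ** ?g) ** matrix_inv ?g
     = - (matrix_inv (transpose ?g) ** (transpose ?g ** ?J ** ?g) ** matrix_inv ?g)"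
    by (simp add: mm_simps)
  moreover have "matrix_inv (transpose ?g) ** (transpose ?g ** A ** ?g) ** matrix_inv ?g = A" for A
  proof -
    have "matrix_inv (transpose ?g) ** (transpose ?g ** A ** ?g) ** matrix_inv ?g
       = (matrix_inv (transpose ?g) ** transpose ?g) ** A ** (?g ** matrix_inv ?g)" by (simp add: matrix_mul_assoc)
    then show ?thesis using inv matrix_inv_det[of "transpose ?g"] det_cayley[OF assms] by simp
  qed
  ultimately show "transpose ?J = - ?J" by simp
qed

definition sec :: "real^6^6 \<Rightarrow> real^6^6 \<Rightarrow> cu_index \<Rightarrow> real" where
  "sec J H = (\<lambda>i. case i of Inl (a, b) \<Rightarrow> J $ a $ b | Inr (a, b) \<Rightarrow> H $ a $ b)"

lemma J_of_sec [simp]: "J_of (sec J H) = J" and eta_of_sec [simp]: "eta_of (sec J H) = H"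
  by (simp_all add: J_of_def eta_of_def sec_def vec_eq_iff)

lemma smooth_map_sec:
  assumes "msmooth W J" "msmooth W H"
  shows "smooth_map UNIV W (\<lambda>y. sec (J y) (H y))"
  unfolding smooth_map_def
proof
  fix i show "smooth_fn UNIV W (\<lambda>y. sec (J y) (H y) i)"
    using assms by (cases i) (auto simp: sec_def msmooth_def split: prod.splits)
qed

lemma orthogonal_cu_fibre:
  assumes JJ: "J ** J = - mat 1" and T: "transpose J = - J"
  shows "sec J (- J) \<in> cu_fibre"
proof -
  have ac: "almost_complex J" using JJ by (simp add: almost_complex_def)
  have "positive_11 J (- J)" by (rule positive_11_uminus[OF JJ T])
  moreover have "(\<Sum>a\<in>UNIV. \<Sum>b\<in>UNIV. ((- J) $ a $ b)\<^sup>2) = 6"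
  proof -
    have "(\<Sum>a\<in>UNIV. \<Sum>b\<in>UNIV. ((- J) $ a $ b)\<^sup>2) = (\<Sum>a\<in>UNIV. (J ** transpose J) $ a $ a)"
      by (simp add: matrix_matrix_mult_def transpose_def power2_eq_square)
    also have "\<dots> = 6" by (simp add: T mm_simps JJ mat_def)
    finally show ?thesis .
  qed
  ultimately show ?thesis using ac by (simp add: cu_fibre_def)
qed

definition vd :: "complex^6 \<Rightarrow> (pt \<Rightarrow> complex) \<Rightarrow> pt \<Rightarrow> complex" where
  "vd v f y = (\<Sum>c\<in>UNIV. v $ c * cpartial c f y)"

locale orth_family =
  fixes W :: "pt set" and B :: "pt \<Rightarrow> 3 \<Rightarrow> 3 \<Rightarrow> complex"
  assumes W: "open W" and Bs: "csmooth UNIV W (\<lambda>y. B y q l)" and Bskew: "B y l q = - B y q l"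
begin

definition s :: cu_section where "s y = sec (orthJ (B y)) (- orthJ (B y))"

definition Z :: "pt \<Rightarrow> 3 \<Rightarrow> complex^6" where
  "Z y l = ee l - (\<Sum>q\<in>UNIV. B y q l *s vcnj (ee q))"

lemma loc_section: "local_section cu_fibre W s"
proof -
  have "smooth_fn UNIV W (\<lambda>y. Smat (B y) $ a $ b)" for a b
  proof -
    have "csmooth UNIV W (\<lambda>y. \<Sum>q\<in>UNIV. \<Sum>l\<in>UNIV. B y q l * (cnj (ee q $ a) * cnj (ee l $ b)))"
      using W by (intro csmooth_sum csmooth_mult csmooth_const Bs) auto
    then show ?thesis
      using W by (auto simp: Smat_def csmooth_def intro!: smooth_fn_mult smooth_fn_const smooth_fn_uminus)
  qed
  then have "msmooth W (\<lambda>y. cayley (B y))"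
    unfolding cayley_def using W by (intro msmooth_add msmooth_const) (auto simp: msmooth_def)
  then have "msmooth W (\<lambda>y. orthJ (B y))"
    unfolding orthJ_def using W det_cayley[OF Bskew]
    by (intro msmooth_mult msmooth_const msmooth_matrix_inv) auto
  then have "smooth_map UNIV W (\<lambda>y. sec (orthJ (B y)) (- orthJ (B y)))"
    by (intro smooth_map_sec msmooth_uminus)
  moreover have "sec (orthJ (B y)) (- orthJ (B y)) \<in> cu_fibre" for y
    by (rule orthogonal_cu_fibre[OF orthJ(2)[OF Bskew] orthJ(3)[OF Bskew]])
  ultimately show ?thesis
    unfolding local_section_def s_def using W by simp
qed

lemma Z_cayley: "Z y l = cm (cayley (B y)) *v ee l"
  by (simp add: Z_def cayley_def cm_add matrix_vector_mult_add_rdistrib Smat_ee)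

lemma T01_Z: "T01 (orthJ (B y)) (Z y l)"
proof -
  have "cm (orthJ (B y)) ** cm (cayley (B y)) = cm (cayley (B y)) ** cm J0"
    by (simp only: cm_mult[symmetric] orthJ(1)[of "B y", OF Bskew])
  then have "cm (orthJ (B y)) *v Z y l = cm (cayley (B y)) *v (cm J0 *v ee l)"
    by (simp add: Z_cayley matrix_vector_mul_assoc)
  then show ?thesis using T01_ee[of l] by (simp add: T01_def Z_cayley vector_scalar_commute mv_uminus_right vs_alg)
qed

lemma Z_span:
  assumes v: "T01 (orthJ (B y)) v"
  shows "\<exists>c. v = (\<Sum>i\<in>UNIV. c i *s Z y i)"
proof -
  let ?g = "cayley (B y)"
  have inv: "cm ?g ** cm (matrix_inv ?g) = mat 1" "cm (matrix_inv ?g) ** cm ?g = mat 1"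
    using matrix_inv_det[OF det_cayley[OF Bskew]] by (simp_all add: cm_mult[symmetric])
  define w where "w = cm (matrix_inv ?g) *v v"
  have kw: "cm ?g *v w = v" by (simp add: w_def matrix_vector_mul_assoc inv)
  have "cm ?g ** cm J0 = cm (orthJ (B y)) ** cm ?g" by (simp only: cm_mult[symmetric] orthJ(1)[of "B y", OF Bskew])
  then have "cm ?g *v (cm J0 *v w) = cm (orthJ (B y)) *v v" by (metis kw matrix_vector_mul_assoc)
  then have "cm ?g *v (cm J0 *v w) = cm ?g *v ((- \<i>) *s w)"
    using v by (simp add: T01_def kw vector_scalar_commute mv_uminus_right vs_alg)
  then have "cm J0 *v w = (- \<i>) *s w"
    by (metis inv(2) matrix_vector_mul_assoc matrix_vector_mul_lid)
  then have "w = (\<Sum>k\<in>UNIV. (2 * w $ rx k) *s ee k)" by (intro T01_J0_span) (simp add: T01_def)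
  then have "v = (\<Sum>i\<in>UNIV. (2 * w $ rx i) *s Z y i)"
    unfolding Z_cayley vector_scalar_commute[symmetric] mv_sum_right[symmetric] by (metis kw)
  then show ?thesis by - (rule exI, assumption)
qed

text \<open>The bracket of Z_k and Z_l is a combination of the \<open>vcnj (ee q)\<close> with
  coefficients Z_l B_qk - Z_k B_ql. Pairing it with Z_m gives \<open>tau\<close> by
  \<open>tau_bracket\<close>; in the symmetrization the derivatives along Z_k cancel because B is
  skew.\<close>

lemma psi_Z:
  assumes y: "y \<in> W"
  shows "psi (J_of (s y)) (eta_of (s y)) (dJ s y) (Z y k) (Z y l) (Z y m)
    = - 2 * \<i> * (vd (Z y l) (\<lambda>y. B y m k) y + vd (Z y m) (\<lambda>y. B y l k) y)"
proof -
  interpret hermitian_1jet "J_of (s y)" "eta_of (s y)" "dJ s y"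
    by (rule section_hermitian_1jet[OF loc_section y])
  have Jy: "J_of (s y) = orthJ (B y)" "eta_of (s y) = - orthJ (B y)" for y by (simp_all add: s_def)
  define dZ where "dZ c l = - (\<Sum>q\<in>UNIV. cpartial c (\<lambda>y. B y q l) y *s vcnj (ee q))" for c l
  have Zs: "csmooth UNIV W (\<lambda>y. Z y l $ a)" for l a
    unfolding Z_def using W by (auto intro!: csmooth_diff csmooth_const csmooth_sum csmooth_mult Bs)
  have dZ: "cpartial c (\<lambda>y. Z y l $ a) y = dZ c l $ a" for c l a
  proof -
    have "cpartial c (\<lambda>y. ee l $ a - (\<Sum>q\<in>UNIV. B y q l * vcnj (ee q) $ a)) y
       = - (\<Sum>q\<in>UNIV. cpartial c (\<lambda>y. B y q l * vcnj (ee q) $ a) y)"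
      using W y Bs by (simp add: cpartial_diff[of UNIV W] cpartial_const cpartial_sum[of _ UNIV W] csmooth_const csmooth_mult csmooth_sum)
    also have "\<dots> = - (\<Sum>q\<in>UNIV. cpartial c (\<lambda>y. B y q l) y * vcnj (ee q) $ a)"
      using W y Bs by (simp add: cpartial_mult[of UNIV W] cpartial_const csmooth_const)
    finally show ?thesis by (simp add: Z_def dZ_def)
  qed
  have Js: "csmooth UNIV W (\<lambda>y. complex_of_real (s y b))" for b
    by (rule local_section_csmooth[OF loc_section])
  have rel: "cm (dJ s y c) *v Z y l + cm (J_of (s y)) *v dZ c l = (- \<i>) *s dZ c l" for c l
  proof -
    have "(cm (dJ s y c) *v Z y l + cm (J_of (s y)) *v dZ c l) $ a = - \<i> * dZ c l $ a" for a
    proof -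
      have "(\<Sum>b\<in>UNIV. complex_of_real (s y (Inl (a, b))) * Z y l $ b) = - \<i> * Z y l $ a" if "y \<in> W" for y
      proof -
        have "(cm (J_of (s y)) *v Z y l) $ a = - \<i> * Z y l $ a"
          using T01_Z[of y l] by (simp add: T01_def Jy)
        then show ?thesis by (simp add: matrix_vector_mult_def cm_def J_of_def)
      qed
      then have "cpartial c (\<lambda>y. \<Sum>b\<in>UNIV. complex_of_real (s y (Inl (a, b))) * Z y l $ b) y = cpartial c (\<lambda>y. - \<i> * Z y l $ a) y"
        by (intro cpartial_cong[of UNIV W]) (use W y in auto)
      also have "\<dots> = - \<i> * dZ c l $ a"
        using cpartial_cmult[OF Zs _ y, of c "- \<i>"] by (simp add: dZ)
      also have "cpartial c (\<lambda>y. \<Sum>b\<in>UNIV. complex_of_real (s y (Inl (a, b))) * Z y l $ b) y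
         = (\<Sum>b\<in>UNIV. complex_of_real (partial c (\<lambda>y. s y (Inl (a, b))) y) * Z y l $ b + complex_of_real (s y (Inl (a, b))) * dZ c l $ b)"
        using W y Js Zs by (simp add: cpartial_sum[of _ UNIV W] csmooth_mult cpartial_mult[of UNIV W] cpartial_of_real dZ)
      finally show ?thesis
        by (simp add: matrix_vector_mult_def cm_def J_of_def dJ_def sum.distrib)
    qed
    then show ?thesis by (simp add: vec_eq_iff)
  qed
  have hb: "hb (eta_of (s y)) w (Z y m) = \<i> * bil w (Z y m)" for w m
    using T01_Z[of y m] by (simp add: Jy hb_uminus) (simp add: hb_def T01_def bil_simps vs_alg)
  have tau: "tau (J_of (s y)) (eta_of (s y)) (dJ s y) (Z y k) (Z y l) (Z y m) = 2 * \<i> * (vd (Z y k) (\<lambda>y. B y m l) y - vd (Z y l) (\<lambda>y. B y m k) y)" for k l m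
  proof -
    have bz: "bil (vcnj (ee q)) (Z y m) = (if q = m then 1/2 else 0)" for q m
      by (simp add: Z_def bil_simps bil_ee bil_commute[of "vcnj (ee q)" "sum _ _"] bil_sum_left bil_ee')
    have bd: "bil (dZ c l) (Z y m) = - cpartial c (\<lambda>y. B y m l) y / 2" for c l
      using exhaust_3[of m] by (elim disjE) (simp_all add: dZ_def bil_simps bil_sum_left bz sum_3)
    have "tau (J_of (s y)) (eta_of (s y)) (dJ s y) (Z y k) (Z y l) (Z y m)
      = - 4 * (\<i> * (\<Sum>c\<in>UNIV. Z y k $ c * bil (dZ c l) (Z y m) - Z y l $ c * bil (dZ c k) (Z y m)))"
      using tau_bracket[of "Z y" dZ k l m, OF _ rel] T01_Z[of y]
      by (simp add: hb Jy(1)[of y, symmetric] bil_sum_left bil_simps)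
    also have "\<dots> = 2 * \<i> * (vd (Z y k) (\<lambda>y. B y m l) y - vd (Z y l) (\<lambda>y. B y m k) y)"
      by (simp add: bd vd_def sum_subtractf sum_divide_distrib[symmetric] sum_negf algebra_simps)
    finally show ?thesis .
  qed
  have sk: "vd v (\<lambda>y. B y l m) y = - vd v (\<lambda>y. B y m l) y" for v l m
  proof -
    have "cpartial c (\<lambda>y. B y l m) y = - cpartial c (\<lambda>y. B y m l) y" for c
      using cpartial_uminus[OF Bs _ y, of c m l] by (subst Bskew) simp
    then show ?thesis by (simp add: vd_def sum_negf)
  qed
  show ?thesis
    unfolding psi_def tau sk[of "Z y k" l m] by (simp add: algebra_simps)
qed

end

section \<open>Second derivatives of the Nijenhuis expression\<close>

lemma vsmooth_dirm:
  assumes "\<And>c. msmooth W (\<lambda>y. D y c)" "vsmooth W u" "vsmooth W v"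
  shows "vsmooth W (\<lambda>y. dirm (D y) (u y) *v v y)"
proof -
  have "vsmooth W (\<lambda>y. cm (D y c) *v v y)" for c by (rule vsmooth_mv[OF assms(1,3)])
  then have "vsmooth W (\<lambda>y. u y $ c *s (cm (D y c) *v v y))" for c
    using assms(2) by (intro vsmooth_scale) (auto simp: vsmooth_def)
  then show ?thesis
    using vsmooth_open[OF assms(2)] unfolding dirm_mv by (auto simp: vsmooth_def intro!: csmooth_sum)
qed

lemma msmooth_dJ:
  assumes "local_section F W s"
  shows "msmooth W (\<lambda>y. dJ s y c)"
  using assms smooth_fn_partial[of UNIV W _ c]
  by (auto simp: msmooth_def dJ_def local_section_def smooth_map_def)

lemma csmooth_tau:
  assumes s: "local_section F W s" and "vsmooth W u" "vsmooth W v" "vsmooth W w"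
  shows "csmooth UNIV W (\<lambda>y. tau (J_of (s y)) (eta_of (s y)) (dJ s y) (u y) (v y) (w y))"
proof -
  note Js = local_section_msmooth[OF s]
  show ?thesis unfolding tau_def hb_def nij_def
    by (intro csmooth_bil vsmooth_diff vsmooth_mv vsmooth_dirm msmooth_dJ[OF s] Js assms)
qed

lemma csmooth_psi:
  assumes s: "local_section F W s" and "vsmooth W u" "vsmooth W v" "vsmooth W w"
  shows "csmooth UNIV W (\<lambda>y. psi (J_of (s y)) (eta_of (s y)) (dJ s y) (u y) (v y) (w y))"
  unfolding psi_def by (intro csmooth_add csmooth_tau[OF s] assms)

lemma csmooth_cmult: "csmooth I U f \<Longrightarrow> csmooth I U (\<lambda>x. c * f x)"
  by (rule csmooth_mult[OF csmooth_const[OF csmooth_open]])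

text \<open>\<open>tri1\<close> and \<open>tri2\<close> are the two kinds of terms of
  \<open>tau\<close>. In coordinates each is a sum of products of one entry of \<open>J\<close>, one
  of \<open>D\<close> and one of \<open>H\<close>, so statements on second derivatives, smoothness
  and limits reduce to a single product.\<close>

definition tri1 :: "real^6^6 \<Rightarrow> real^6^6 \<Rightarrow> (6 \<Rightarrow> real^6^6) \<Rightarrow> complex^6 \<Rightarrow> complex^6 \<Rightarrow> complex^6 \<Rightarrow> complex" where
  "tri1 J H D u v w = hb H (dirm D (cm J *v u) *v v) w"

definition tri2 :: "real^6^6 \<Rightarrow> real^6^6 \<Rightarrow> (6 \<Rightarrow> real^6^6) \<Rightarrow> complex^6 \<Rightarrow> complex^6 \<Rightarrow> complex^6 \<Rightarrow> complex" where
  "tri2 J H D u v w = hb H (cm J *v (dirm D u *v v)) w"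

lemma tau_tri: "tau J H D u v w = tri1 J H D u v w - tri1 J H D v u w - (tri2 J H D u v w - tri2 J H D v u w)"
  by (simp add: tau_def nij_def tri1_def tri2_def hb_simps mvs)

lemma tri1_expand: "tri1 J H D u v w = (\<Sum>c\<in>UNIV. \<Sum>b\<in>UNIV. \<Sum>e\<in>UNIV. \<Sum>a\<in>UNIV. \<Sum>d\<in>UNIV. (u $ a * v $ b * w $ d) *
     (complex_of_real (J $ e $ a) * complex_of_real (D e $ c $ b) * complex_of_real (H $ c $ d)))"
  unfolding tri1_def hb_def bil_def dirm_def cm_def matrix_vector_mult_def
  by (simp add: sum_distrib_left sum_distrib_right mult_ac)

lemma tri2_expand: "tri2 J H D u v w = (\<Sum>c\<in>UNIV. \<Sum>e\<in>UNIV. \<Sum>b\<in>UNIV. \<Sum>a\<in>UNIV. \<Sum>d\<in>UNIV. (u $ a * v $ b * w $ d) *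
     (complex_of_real (J $ c $ e) * complex_of_real (D a $ e $ b) * complex_of_real (H $ c $ d)))"
  unfolding tri2_def hb_def bil_def dirm_def cm_def matrix_vector_mult_def
  by (simp add: sum_distrib_left sum_distrib_right mult_ac)

text \<open>\<open>d2diff\<close>: the second derivatives at \<open>x\<close> of two functions differ by \<open>g\<close>.\<close>

definition d2diff :: "6 \<Rightarrow> 6 \<Rightarrow> pt set \<Rightarrow> pt \<Rightarrow> (pt \<Rightarrow> complex) \<Rightarrow> (pt \<Rightarrow> complex) \<Rightarrow> complex \<Rightarrow> bool" where
  "d2diff p q W x f' f g \<longleftrightarrow> open W \<and> x \<in> W \<and> csmooth UNIV W f' \<and> csmooth UNIV W f \<and>
     cpartial p (cpartial q f') x - cpartial p (cpartial q f) x = g"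

lemma d2diff_sum:
  assumes "\<And>a. d2diff p q W x (f' a) (f a) (g a)"
  shows "d2diff p q W x (\<lambda>y. \<Sum>a\<in>UNIV. f' a y) (\<lambda>y. \<Sum>a\<in>UNIV. f a y) (\<Sum>a\<in>(UNIV::6 set). g a)"
  using assms unfolding d2diff_def
  by (auto simp: cpartial2_sum[of _ UNIV W] csmooth_sum sum_subtractf[symmetric])

lemma d2diff_add:
  assumes "d2diff p q W x f' f g" "d2diff p q W x f1' f1 g1"
  shows "d2diff p q W x (\<lambda>y. f' y + f1' y) (\<lambda>y. f y + f1 y) (g + g1)"
  using assms unfolding d2diff_def
  by (auto simp: cpartial2_add[of UNIV W] csmooth_add)

lemma d2diff_cmult:
  assumes "d2diff p q W x f' f g"
  shows "d2diff p q W x (\<lambda>y. c * f' y) (\<lambda>y. c * f y) (c * g)"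
  using assms unfolding d2diff_def
  by (auto simp: cpartial2_cmult[of UNIV W] right_diff_distrib[symmetric] intro: csmooth_cmult)

lemma d2diff_diff:
  assumes "d2diff p q W x f' f g" "d2diff p q W x f1' f1 g1"
  shows "d2diff p q W x (\<lambda>y. f' y - f1' y) (\<lambda>y. f y - f1 y) (g - g1)"
  using d2diff_add[OF assms(1) d2diff_cmult[OF assms(2), of "-1"]] by simp

lemma d2diff_triple:
  assumes W: "open W" "x \<in> W" and sm: "csmooth UNIV W f'" "csmooth UNIV W g'" "csmooth UNIV W h'" "csmooth UNIV W f" "csmooth UNIV W g" "csmooth UNIV W h"
    and f: "f' x = f x" "\<And>c. cpartial c f' x = cpartial c f x" "cpartial p (cpartial q f') x = cpartial p (cpartial q f) x"
    and h: "h' x = h x" "\<And>c. cpartial c h' x = cpartial c h x" "cpartial p (cpartial q h') x = cpartial p (cpartial q h) x"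
    and g: "g' x = g x" "\<And>c. cpartial c g' x = cpartial c g x" "cpartial p (cpartial q g') x - cpartial p (cpartial q g) x = r"
  shows "d2diff p q W x (\<lambda>y. f' y * g' y * h' y) (\<lambda>y. f y * g y * h y) (f x * r * h x)"
proof -
  have "cpartial p (cpartial q g') x = cpartial p (cpartial q g) x + r" using g(3) by (simp add: algebra_simps)
  then show ?thesis
    unfolding d2diff_def using W sm
    by (simp add: cpartial2_triple[of UNIV W] csmooth_mult f h g) (simp add: algebra_simps)
qed

text \<open>
  Two sections with the same 2-jet at \<open>x\<close>: the second derivatives of \<open>psi\<close> depend on the third derivatives
  of \<open>J\<close> only through the principal part.
\<close>

locale same_2jet =
  fixes W x and s s' :: cu_section
  assumes s: "local_section cu_fibre W s" and s': "local_section cu_fibre W s'" and x: "x \<in> W"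
    and jet: "length L \<le> 2 \<Longrightarrow> partials L (\<lambda>y. s' y b) x = partials L (\<lambda>y. s y b) x"
begin

definition \<rho> :: "6 \<Rightarrow> 6 \<Rightarrow> 6 \<Rightarrow> real^6^6" where
  "\<rho> p q c = (\<chi> a b. partials [p, q, c] (\<lambda>y. s' y (Inl (a, b))) x - partials [p, q, c] (\<lambda>y. s y (Inl (a, b))) x)"

lemma W: "open W" using s by (simp add: local_section_def)

lemma sm: "smooth_fn UNIV W (\<lambda>y. s y b)" "smooth_fn UNIV W (\<lambda>y. s' y b)"
  using s s' by (auto simp: local_section_def smooth_map_def)

lemma jets: "s' x b = s x b" "partial c (\<lambda>y. s' y b) x = partial c (\<lambda>y. s y b) x"
  "partial p (partial q (\<lambda>y. s' y b)) x = partial p (partial q (\<lambda>y. s y b)) x"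
  using jet[of "[]" b] jet[of "[c]" b] jet[of "[p, q]" b] by simp_all

lemma cpartial2_of_real: "cpartial p (cpartial q (\<lambda>y. complex_of_real (r y))) x = complex_of_real (partial p (partial q r) x)"
proof -
  have "cpartial q (\<lambda>y. complex_of_real (r y)) = (\<lambda>y. complex_of_real (partial q r y))"
    by (simp add: fun_eq_iff cpartial_of_real)
  then show ?thesis by (simp add: cpartial_of_real)
qed

lemma d2diff_JDH:
  "d2diff p q W x (\<lambda>y. complex_of_real (J_of (s' y) $ a $ b) * complex_of_real (dJ s' y e $ c $ d) * complex_of_real (eta_of (s' y) $ f $ g))
     (\<lambda>y. complex_of_real (J_of (s y) $ a $ b) * complex_of_real (dJ s y e $ c $ d) * complex_of_real (eta_of (s y) $ f $ g))
     (complex_of_real (J_of (s x) $ a $ b) * complex_of_real (\<rho> p q e $ c $ d) * complex_of_real (eta_of (s x) $ f $ g))"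
  unfolding J_of_def eta_of_def dJ_def vec_lambda_beta
  by (rule d2diff_triple[OF W x])
    (simp_all add: csmooth_of_real sm smooth_fn_partial jets cpartial_of_real cpartial2_of_real \<rho>_def)

lemma d2diff_tau:
  "d2diff p q W x (\<lambda>y. tau (J_of (s' y)) (eta_of (s' y)) (dJ s' y) u v w) (\<lambda>y. tau (J_of (s y)) (eta_of (s y)) (dJ s y) u v w)
     (tau (J_of (s x)) (eta_of (s x)) (\<rho> p q) u v w)"
  unfolding tau_tri tri1_expand tri2_expand
  by (intro d2diff_diff d2diff_sum d2diff_cmult d2diff_JDH)

lemma d2diff_psi:
  "d2diff p q W x (\<lambda>y. psi (J_of (s' y)) (eta_of (s' y)) (dJ s' y) u v w) (\<lambda>y. psi (J_of (s y)) (eta_of (s y)) (dJ s y) u v w)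
     (psi (J_of (s x)) (eta_of (s x)) (\<rho> p q) u v w)"
  unfolding psi_def by (intro d2diff_add d2diff_tau)

lemma \<rho>_sym: "\<rho> q p c = \<rho> p q c" "\<rho> p c q = \<rho> p q c"
proof -
  have a: "partial q (partial p (partial c (\<lambda>y. t y b))) x = partial p (partial q (partial c (\<lambda>y. t y b))) x"
    if "\<And>b. smooth_fn UNIV W (\<lambda>y. t y b)" for t :: cu_section and b
    by (rule partial_commute[OF smooth_fn_partial[OF that UNIV_I] UNIV_I UNIV_I x])
  have b: "partial p (partial c (partial q (\<lambda>y. t y b))) x = partial p (partial q (partial c (\<lambda>y. t y b))) x"
    if "\<And>b. smooth_fn UNIV W (\<lambda>y. t y b)" for t :: cu_section and b
    by (rule partial_cong[OF _ x UNIV_I], simp add: W, rule partial_commute[OF that UNIV_I UNIV_I])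
  show "\<rho> q p c = \<rho> p q c" "\<rho> p c q = \<rho> p q c" by (simp_all add: \<rho>_def a[of s, OF sm(1)] a[of s', OF sm(2)] b[of s, OF sm(1)] b[of s', OF sm(2)])
qed

text \<open>Both sections satisfy dJ J + J dJ = 0 identically. Differentiating twice and subtracting
  leaves only third derivatives, as the lower jets agree. Thus \<open>\<rho> p q\<close> may take
  the place of the derivative of \<open>J\<close> in \<open>hermitian_1jet\<close>.\<close>

lemma \<rho>_anti: "\<rho> p q c ** J_of (s x) + J_of (s x) ** \<rho> p q c = 0"
proof -
  have "complex_of_real ((\<rho> p q c ** J_of (s x) + J_of (s x) ** \<rho> p q c) $ a $ b) = 0" for a b
  proof -
    have 1: "d2diff p q W x (\<lambda>y. complex_of_real (J_of (s' y) $ i $ j) * complex_of_real (dJ s' y c $ k $ l))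
       (\<lambda>y. complex_of_real (J_of (s y) $ i $ j) * complex_of_real (dJ s y c $ k $ l))
       (complex_of_real (J_of (s x) $ i $ j) * complex_of_real (\<rho> p q c $ k $ l))" for i j k l
    proof -
      have "d2diff p q W x (\<lambda>y. complex_of_real (J_of (s' y) $ i $ j) * complex_of_real (dJ s' y c $ k $ l) * 1)
       (\<lambda>y. complex_of_real (J_of (s y) $ i $ j) * complex_of_real (dJ s y c $ k $ l) * 1)
       (complex_of_real (J_of (s x) $ i $ j) * complex_of_real (\<rho> p q c $ k $ l) * 1)"
        unfolding J_of_def eta_of_def dJ_def vec_lambda_beta
        by (rule d2diff_triple[OF W x])
          (simp_all add: csmooth_of_real csmooth_const W sm smooth_fn_partial jets cpartial_of_real cpartial2_of_real \<rho>_def cpartial_const)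
      then show ?thesis by simp
    qed
    have "d2diff p q W x (\<lambda>y. \<Sum>e\<in>UNIV. complex_of_real (J_of (s' y) $ e $ b) * complex_of_real (dJ s' y c $ a $ e) + complex_of_real (J_of (s' y) $ a $ e) * complex_of_real (dJ s' y c $ e $ b))
       (\<lambda>y. \<Sum>e\<in>UNIV. complex_of_real (J_of (s y) $ e $ b) * complex_of_real (dJ s y c $ a $ e) + complex_of_real (J_of (s y) $ a $ e) * complex_of_real (dJ s y c $ e $ b))
       (\<Sum>e\<in>UNIV. complex_of_real (J_of (s x) $ e $ b) * complex_of_real (\<rho> p q c $ a $ e) + complex_of_real (J_of (s x) $ a $ e) * complex_of_real (\<rho> p q c $ e $ b))" (is "d2diff p q W x ?f' ?f ?g")
      by (intro d2diff_sum d2diff_add 1)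
    then have g: "?g = cpartial p (cpartial q ?f') x - cpartial p (cpartial q ?f) x" by (simp add: d2diff_def)
    have z: "(\<Sum>e\<in>UNIV. complex_of_real (J_of (t y) $ e $ b) * complex_of_real (dJ t y c $ a $ e) + complex_of_real (J_of (t y) $ a $ e) * complex_of_real (dJ t y c $ e $ b)) = 0"
      if "local_section cu_fibre W t" "y \<in> W" for t y
    proof -
      interpret hermitian_1jet "J_of (t y)" "eta_of (t y)" "dJ t y"
        by (rule section_hermitian_1jet[OF that])
      have "complex_of_real ((dJ t y c ** J_of (t y) + J_of (t y) ** dJ t y c) $ a $ b) = 0" using DJ[of c] by simp
      then show ?thesis by (simp add: matrix_matrix_mult_def sum.distrib mult.commute)
    qed
    have "cpartial p (cpartial q ?f') x = cpartial p (cpartial q (\<lambda>y. 0)) x" "cpartial p (cpartial q ?f) x = cpartial p (cpartial q (\<lambda>y. 0)) x"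
      by (rule cpartial2_cong[of UNIV W]; use W x z[OF s] z[OF s'] in simp)+
    then have "?g = 0" using g by simp
    then show ?thesis by (simp add: matrix_matrix_mult_def sum.distrib mult.commute)
  qed
  then have "(\<rho> p q c ** J_of (s x) + J_of (s x) ** \<rho> p q c) $ a $ b = 0" for a b
    by (simp only: of_real_eq_0_iff)
  then show ?thesis by (simp only: vec_eq_iff zero_index simp_thms)
qed

definition dd2 :: "complex^6 \<Rightarrow> complex^6 \<Rightarrow> (pt \<Rightarrow> complex) \<Rightarrow> complex" where
  "dd2 u v f = (\<Sum>p\<in>UNIV. \<Sum>q\<in>UNIV. u $ p * v $ q * cpartial p (cpartial q f) x)"

text \<open>
  The combination of second derivatives in the next lemma is the one in which all third derivatives of
  \<open>J\<close> cancel: it is the curl of the divergence relation \<open>\<Sum>\<^sub>j \<partial>\<^sub>j N\<^sub>i\<^sub>j = \<dots>\<close>.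
\<close>

lemma third_order_cancellation:
  assumes J0: "J_of (s x) = J0" "eta_of (s x) = - J0"
  defines "P t k l m \<equiv> \<lambda>y. psi (J_of (t y)) (eta_of (t y)) (dJ t y) (ee k) (ee l) (ee m)"
  defines "L t \<equiv> - 2 * dd2 (ee 1) (ee 2) (P t 3 1 2) + dd2 (ee 2) (ee 2) (P t 3 1 1) - dd2 (ee 2) (ee 3) (P t 2 1 1)
     + dd2 (ee 1) (ee 1) (P t 3 2 2) - dd2 (ee 1) (ee 3) (P t 1 2 2)"
  shows "L s' = L s"
proof -
  \<comment> \<open>Write N_ij = tau(e_(j+1), e_(j+2), e_i). The entries in \<open>L t\<close> are,
    in order, N_22 - N_11, 2 N_12, -2 N_13, -2 N_21 and 2 N_23. So \<open>L t\<close> is twice the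
    difference of the e_2-derivative of the divergence of row 1 and the e_1-derivative of the
    divergence of row 2; the trace of N drops out. The third derivatives in each divergence cancel
    because \<open>T\<close> is symmetric in its first three indices.\<close>
  define T where "T i j k m l = (\<Sum>p\<in>UNIV. \<Sum>q\<in>UNIV. \<Sum>c\<in>UNIV. ee i $ p * ee j $ q * ee k $ c * bil (cm (\<rho> p q c) *v ee l) (ee m))" for i j k l m
  have T1: "T i j k m l = T j i k m l" for i j k l m
    unfolding T_def by (subst sum.swap) (simp add: \<rho>_sym(1)[of _ _ _] mult_ac)
  have T2: "T i j k m l = T i k j m l" for i j k l m
    unfolding T_def
  proof (rule sum.cong[OF refl])
    fix p
    show "(\<Sum>q\<in>UNIV. \<Sum>c\<in>UNIV. ee i $ p * ee j $ q * ee k $ c * bil (cm (\<rho> p q c) *v ee l) (ee m)) =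
          (\<Sum>q\<in>UNIV. \<Sum>c\<in>UNIV. ee i $ p * ee k $ q * ee j $ c * bil (cm (\<rho> p q c) *v ee l) (ee m))"
      by (subst sum.swap) (simp add: \<rho>_sym(2)[of p _ _] mult_ac)
  qed
  have t: "tau J0 (- J0) (\<rho> p q) (ee k) (ee l) (ee m) = 2 * ((\<Sum>c\<in>UNIV. ee k $ c * bil (cm (\<rho> p q c) *v ee l) (ee m)) - (\<Sum>c\<in>UNIV. ee l $ c * bil (cm (\<rho> p q c) *v ee k) (ee m)))" for p q k l m
  proof -
    interpret h: hermitian_1jet J0 "- J0" "\<rho> p q"
      by unfold_locales (use \<rho>_anti[of p q] J0 in simp)
    have "hb (- J0) w (ee m) = \<i> * bil w (ee m)" for w
      using T01_ee[of m] by (simp add: hb_uminus) (simp add: hb_def T01_def bil_simps vs_alg)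
    then show ?thesis
      by (simp add: tau_def h.nij_T01[OF T01_ee T01_ee] bil_simps dirm_mv bil_sum_left) (simp add: algebra_simps)
  qed
  have sw: "(\<Sum>p\<in>UNIV. \<Sum>q\<in>UNIV. ee i $ p * ee j $ q * (\<Sum>c\<in>UNIV. ee k $ c * bil (cm (\<rho> p q c) *v ee l) (ee m))) = T i j k m l" for i j k l m
    by (simp add: T_def sum_distrib_left mult_ac)
  have "dd2 (ee i) (ee j) (P s' k l m) = dd2 (ee i) (ee j) (P s k l m) +
     2 * (T i j k m l - T i j l m k + T i j k l m - T i j m l k)" for i j k l m
  proof -
    have c: "cpartial p (cpartial q (P s' k l m)) x = cpartial p (cpartial q (P s k l m)) x + psi J0 (- J0) (\<rho> p q) (ee k) (ee l) (ee m)" for p q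
      using d2diff_psi[of p q "ee k" "ee l" "ee m"] unfolding d2diff_def P_def J0 by (simp add: algebra_simps)
    have "dd2 (ee i) (ee j) (P s' k l m) = dd2 (ee i) (ee j) (P s k l m) + (\<Sum>p\<in>UNIV. \<Sum>q\<in>UNIV. ee i $ p * ee j $ q * psi J0 (- J0) (\<rho> p q) (ee k) (ee l) (ee m))"
      unfolding dd2_def c distrib_left sum.distrib ..
    also have "(\<Sum>p\<in>UNIV. \<Sum>q\<in>UNIV. ee i $ p * ee j $ q * psi J0 (- J0) (\<rho> p q) (ee k) (ee l) (ee m))
       = 2 * (T i j k m l - T i j l m k + T i j k l m - T i j m l k)"
      unfolding psi_def t sw[symmetric]
      by (simp add: sum.distrib sum_subtractf sum_distrib_left right_diff_distrib distrib_left mult_ac)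
    finally show ?thesis .
  qed
  note d = this
  have sym: "T 1 2 1 m l = T 1 1 2 m l" "T 2 2 1 m l = T 1 2 2 m l" "T 2 3 2 m l = T 2 2 3 m l"
    "T 2 3 1 m l = T 1 2 3 m l" "T 1 3 1 m l = T 1 1 3 m l" "T 1 3 2 m l = T 1 2 3 m l" for m l
    using T2[of 1 2 1 m l] T2[of 2 2 1 m l] T1[of 2 1 2 m l] T2[of 2 3 2 m l] T2[of 2 3 1 m l] T1[of 2 1 3 m l]
      T2[of 1 3 1 m l] T2[of 1 3 2 m l] by (blast intro: trans)+
  show ?thesis
    unfolding L_def d
    by (simp add: sym algebra_simps)
qed

end

context orth_family
begin

lemma vsmooth_Z: "vsmooth W (\<lambda>y. Z y l)"
  unfolding vsmooth_def Z_def using W by (auto intro!: csmooth_diff csmooth_const csmooth_sum csmooth_mult Bs)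

lemma cpartial2_vanishing_triple:
  assumes "csmooth UNIV W f" "csmooth UNIV W g" "csmooth UNIV W h" "x \<in> W" "f x = 0" "g x = 0" "h x = 0"
  shows "cpartial p (cpartial q (\<lambda>y. f y * g y * h y)) x = 0"
  using cpartial2_triple[OF assms(1-3) UNIV_I UNIV_I assms(4)] assms(5-7) by simp

text \<open>At a point where \<open>B\<close> and \<open>psi\<close> vanish, the constant frame \<open>ee\<close> may be replaced by \<open>Z\<close> up to third order.\<close>

lemma cpartial2_psi_ee:
  assumes x: "x \<in> W" and B0: "\<And>q l. B x q l = 0"
    and 0: "\<And>u v w. psi (J_of (s x)) (eta_of (s x)) (dJ s x) u v w = 0"
  shows "cpartial p (cpartial q (\<lambda>y. psi (J_of (s y)) (eta_of (s y)) (dJ s y) (ee k) (ee l) (ee m))) x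
    = cpartial p (cpartial q (\<lambda>y. psi (J_of (s y)) (eta_of (s y)) (dJ s y) (Z y k) (Z y l) (Z y m))) x"
proof -
  define \<Psi> where "\<Psi> y = psi (J_of (s y)) (eta_of (s y)) (dJ s y)" for y
  define C where "C y r k = (\<Sum>q\<in>UNIV. cnj (B y r q) * B y q k)" for y r k
  \<comment> \<open>U_k adds to Z_k the (1,0)-vector with coefficients B, which removes the part of
    Z_k linear in B; what distinguishes U_k from \<open>ee k\<close> is the quadratic
    \<open>C\<close>. The two summands have pure type, so \<open>psi\<close> of three such vectors
    has only two nonzero terms.\<close>
  define U where "U y k = ee k - (\<Sum>r\<in>UNIV. C y r k *s ee r)" for y k
  have U: "U y k = Z y k + (\<Sum>q\<in>UNIV. B y q k *s vcnj (Z y q))" for y k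
    by (simp add: U_def Z_def C_def sum_3 vec_eq_iff algebra_simps)
  have e: "ee k = U y k + (\<Sum>r\<in>UNIV. C y r k *s ee r)" for y k by (simp add: U_def)
  have mix: "\<Psi> y (U y k) (U y l) (U y m) = \<Psi> y (Z y k) (Z y l) (Z y m) +
     \<Psi> y (\<Sum>q\<in>UNIV. B y q k *s vcnj (Z y q)) (\<Sum>q\<in>UNIV. B y q l *s vcnj (Z y q)) (\<Sum>q\<in>UNIV. B y q m *s vcnj (Z y q))"
    if y: "y \<in> W" for y k l m
  proof -
    interpret hermitian_1jet "J_of (s y)" "eta_of (s y)" "dJ s y"
      by (rule section_hermitian_1jet[OF loc_section y])
    have TZ: "T01 (J_of (s y)) (Z y k)" for k using T01_Z by (simp add: s_def)
    have T: "T10 (J_of (s y)) (\<Sum>q\<in>UNIV. B y q k *s vcnj (Z y q))" for k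
    proof -
      have "T01 (J_of (s y)) (\<Sum>q\<in>UNIV. cnj (B y q k) *s Z y q)" by (intro T01_sum T01_closed TZ)
      then have "T10 (J_of (s y)) (vcnj (\<Sum>q\<in>UNIV. cnj (B y q k) *s Z y q))" by (simp add: T10_vcnj)
      then show ?thesis by (simp add: sum_3)
    qed
    have nz: "psi (J_of (s y)) (eta_of (s y)) (dJ s y) a b c = 0"
      if "(T01 (J_of (s y)) a \<or> T10 (J_of (s y)) a)" "(T01 (J_of (s y)) b \<or> T10 (J_of (s y)) b)" "(T01 (J_of (s y)) c \<or> T10 (J_of (s y)) c)"
        "T01 (J_of (s y)) a \<and> T10 (J_of (s y)) b \<or> T10 (J_of (s y)) a \<and> T01 (J_of (s y)) b \<or> T01 (J_of (s y)) a \<and> T10 (J_of (s y)) c \<or> T10 (J_of (s y)) a \<and> T01 (J_of (s y)) c" for a b c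
    proof (cases "a = 0 \<or> b = 0 \<or> c = 0")
      case True then show ?thesis by (auto simp: psi_simps)
    next
      case False
      have "\<not> (T01 (J_of (s y)) v \<and> T10 (J_of (s y)) v)" if "v \<noteq> 0" for v
      proof
        assume "T01 (J_of (s y)) v \<and> T10 (J_of (s y)) v"
        then have "\<i> *s v = (- \<i>) *s v" unfolding T01_def T10_def by (metis (no_types))
        then show False using that by (simp add: vec_eq_iff)
      qed
      from this[of a] this[of b] this[of c] False that show ?thesis by (intro psi_mixed) argo+
    qed
    show ?thesis
      unfolding \<Psi>_def U psi_simps using TZ T by (simp add: nz)
  qed
  have sm: "csmooth UNIV W (\<lambda>y. \<Psi> y (u y) (v y) (w y))" if "vsmooth W u" "vsmooth W v" "vsmooth W w" for u v w
    unfolding \<Psi>_def by (rule csmooth_psi[OF loc_section that])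
  have ees: "vsmooth W (\<lambda>y. ee k)" for k by (rule vsmooth_const[OF W])
  have vsum: "vsmooth W (\<lambda>y. \<Sum>r\<in>UNIV. f r y)" if "\<And>r. vsmooth W (f r)" for f :: "3 \<Rightarrow> pt \<Rightarrow> complex^6"
    using that W by (auto simp: vsmooth_def intro!: csmooth_sum)
  have Cs: "csmooth UNIV W (\<lambda>y. C y r k)" for r k
    unfolding C_def using W by (intro csmooth_sum csmooth_mult csmooth_cnj Bs) auto
  have Us: "vsmooth W (\<lambda>y. U y k)" for k
    unfolding U_def by (intro vsmooth_diff ees vsum vsmooth_scale Cs)
  have Zs: "vsmooth W (\<lambda>y. vcnj (Z y k))" for k by (intro vsmooth_cnj vsmooth_Z)
  \<comment> \<open>Negligible remainders. They are either cubic in B, or the product of an entry of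
    \<open>C\<close>, which is of second order at \<open>x\<close>, with a value of
    \<open>psi\<close>, which vanishes at \<open>x\<close>.\<close>
  define O3 where "O3 f \<longleftrightarrow> csmooth UNIV W f \<and> cpartial p (cpartial q f) x = 0" for f
  have O3_add: "O3 (\<lambda>y. f y + g y)" if "O3 f" "O3 g" for f g
    using that x by (simp add: O3_def csmooth_add cpartial2_add[of UNIV W])
  have O3_sum: "O3 (\<lambda>y. \<Sum>r\<in>UNIV. f r y)" if "\<And>r. O3 (f r)" for f :: "3 \<Rightarrow> pt \<Rightarrow> complex"
    using that x W by (simp add: O3_def csmooth_sum cpartial2_sum[of _ UNIV W])
  have O3_triple: "O3 (\<lambda>y. f y * g y * h y)" if "csmooth UNIV W f" "csmooth UNIV W g" "csmooth UNIV W h" "f x = 0" "g x = 0" "h x = 0" for f g h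
    unfolding O3_def using cpartial2_vanishing_triple[OF that(1-3) x that(4-6)] that by (auto intro!: csmooth_mult)
  have O3_C: "O3 (\<lambda>y. C y r k * \<Psi> y (u y) (v y) (w y))" if "vsmooth W u" "vsmooth W v" "vsmooth W w" for r k u v w
  proof -
    have "O3 (\<lambda>y. \<Sum>q\<in>UNIV. cnj (B y r q) * B y q k * \<Psi> y (u y) (v y) (w y))"
      by (intro O3_sum O3_triple csmooth_cnj Bs sm that) (simp_all add: B0 \<Psi>_def 0)
    then show ?thesis by (simp add: C_def sum_distrib_right)
  qed
  have O3_B: "O3 (\<lambda>y. B y a k * (B y b l * (B y c m * \<Psi> y (u y) (v y) (w y))))" if "vsmooth W u" "vsmooth W v" "vsmooth W w" for a b c k l m u v w
  proof -
    have "O3 (\<lambda>y. B y a k * B y b l * (B y c m * \<Psi> y (u y) (v y) (w y)))"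
      by (intro O3_triple csmooth_mult Bs sm that) (simp_all add: B0)
    then show ?thesis by (simp add: mult.assoc)
  qed
  define R where "R y = (\<Sum>a\<in>UNIV. \<Sum>b\<in>UNIV. \<Sum>c\<in>UNIV. B y a m * (B y b l * (B y c k * \<Psi> y (vcnj (Z y c)) (vcnj (Z y b)) (vcnj (Z y a)))))
     + (\<Sum>r\<in>UNIV. C y r m * \<Psi> y (U y k) (U y l) (ee r)) + (\<Sum>r\<in>UNIV. C y r l * \<Psi> y (U y k) (ee r) (ee m))
     + (\<Sum>r\<in>UNIV. C y r k * \<Psi> y (ee r) (ee l) (ee m))" for y
  have OR: "O3 R"
    unfolding R_def by (intro O3_add O3_sum O3_C O3_B Us Zs ees)
  have eq: "\<Psi> y (ee k) (ee l) (ee m) = \<Psi> y (Z y k) (Z y l) (Z y m) + R y" if y: "y \<in> W" for y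
  proof -
    have 1: "\<Psi> y (ee k) v w = \<Psi> y (U y k) v w + (\<Sum>r\<in>UNIV. C y r k * \<Psi> y (ee r) v w)" for v w
      by (subst e[of k y]) (simp add: \<Psi>_def psi_simps psi_sum)
    have 2: "\<Psi> y u (ee l) w = \<Psi> y u (U y l) w + (\<Sum>r\<in>UNIV. C y r l * \<Psi> y u (ee r) w)" for u w
      by (subst e[of l y]) (simp add: \<Psi>_def psi_simps psi_sum)
    have 3: "\<Psi> y u v (ee m) = \<Psi> y u v (U y m) + (\<Sum>r\<in>UNIV. C y r m * \<Psi> y u v (ee r))" for u v
      by (subst e[of m y]) (simp add: \<Psi>_def psi_simps psi_sum)
    have 4: "\<Psi> y (\<Sum>q\<in>UNIV. B y q k *s vcnj (Z y q)) (\<Sum>q\<in>UNIV. B y q l *s vcnj (Z y q)) (\<Sum>q\<in>UNIV. B y q m *s vcnj (Z y q))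
      = (\<Sum>a\<in>UNIV. \<Sum>b\<in>UNIV. \<Sum>c\<in>UNIV. B y a m * (B y b l * (B y c k * \<Psi> y (vcnj (Z y c)) (vcnj (Z y b)) (vcnj (Z y a)))))"
      by (simp add: \<Psi>_def psi_simps psi_sum sum_distrib_left)
    have "\<Psi> y (ee k) (ee l) (ee m) = \<Psi> y (U y k) (ee l) (ee m) + (\<Sum>r\<in>UNIV. C y r k * \<Psi> y (ee r) (ee l) (ee m))" by (rule 1)
    also have "\<Psi> y (U y k) (ee l) (ee m) = \<Psi> y (U y k) (U y l) (ee m) + (\<Sum>r\<in>UNIV. C y r l * \<Psi> y (U y k) (ee r) (ee m))" by (rule 2)
    also have "\<Psi> y (U y k) (U y l) (ee m) = \<Psi> y (U y k) (U y l) (U y m) + (\<Sum>r\<in>UNIV. C y r m * \<Psi> y (U y k) (U y l) (ee r))" by (rule 3)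
    finally show ?thesis unfolding mix[OF y] 4 R_def by (simp only: add.assoc)
  qed
  have "cpartial p (cpartial q (\<lambda>y. \<Psi> y (ee k) (ee l) (ee m))) x = cpartial p (cpartial q (\<lambda>y. \<Psi> y (Z y k) (Z y l) (Z y m) + R y)) x"
    by (rule cpartial2_cong[of UNIV W]) (use W x eq in auto)
  also have "\<dots> = cpartial p (cpartial q (\<lambda>y. \<Psi> y (Z y k) (Z y l) (Z y m))) x + cpartial p (cpartial q R) x"
    by (rule cpartial2_add[of UNIV W]) (use OR sm vsmooth_Z x in \<open>auto simp: O3_def\<close>)
  finally show ?thesis using OR by (simp add: O3_def \<Psi>_def)
qed

end

section \<open>A structure that is quasi-integrable to second order only\<close>

definition zc :: "pt \<Rightarrow> 3 \<Rightarrow> pt \<Rightarrow> complex" where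
  "zc x k y = Complex (y (rx k) - x (rx k)) (y (ry k) - x (ry k))"

definition zb :: "pt \<Rightarrow> 3 \<Rightarrow> pt \<Rightarrow> complex" where
  "zb x k y = cnj (zc x k y)"

lemma csmooth_zc: "csmooth UNIV UNIV (zc x k)" and csmooth_zb: "csmooth UNIV UNIV (zb x k)"
proof -
  show "csmooth UNIV UNIV (zc x k)"
    unfolding csmooth_def zc_def by (auto intro!: smooth_fn_diff smooth_fn_const smooth_fn_coordinate)
  then show "csmooth UNIV UNIV (zb x k)" unfolding zb_def by (rule csmooth_cnj)
qed

lemma vd_zc: "vd (ee l) (zc x k) y = 0" "vd (vcnj (ee l)) (zc x k) y = (if k = l then 1 else 0)"
  and vd_zb: "vd (ee l) (zb x k) y = (if k = l then 1 else 0)" "vd (vcnj (ee l)) (zb x k) y = 0"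
proof -
  have p: "partial c (\<lambda>y. y i - r) y = (if c = i then 1 else 0)" for c i :: 6 and r :: real
    by (simp add: partial_diff[of UNIV UNIV] smooth_fn_coordinate smooth_fn_const partial_coordinate partial_const)
  have c1: "cpartial c (zc x k) y = (if c = rx k then 1 else 0) + (if c = ry k then \<i> else 0)" for c
    by (simp add: cpartial_def zc_def p complex_eq_iff)
  have v: "vd v (zc x k) y = v $ rx k + \<i> * v $ ry k" for v
  proof -
    have "vd v (zc x k) y = (\<Sum>c\<in>UNIV. (if c = rx k then v $ c else 0) + (if c = ry k then \<i> * v $ c else 0))"
      unfolding vd_def c1 by (intro sum.cong refl) (auto simp: algebra_simps)
    then show ?thesis by (simp add: sum.distrib)
  qed
  have b: "vd v (zb x k) y = cnj (vd (vcnj v) (zc x k) y)" for v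
  proof -
    have "cpartial c (zb x k) y = cnj (cpartial c (zc x k) y)" for c
      unfolding zb_def by (rule cpartial_cnj[OF csmooth_zc]) auto
    then show ?thesis by (simp add: vd_def vcnj_def)
  qed
  have e: "ee l $ rx k + \<i> * ee l $ ry k = 0" "vcnj (ee l) $ rx k + \<i> * vcnj (ee l) $ ry k = (if k = l then 1 else 0)"
    using exhaust_3[of l] exhaust_3[of k] by (elim disjE; simp add: ee_def vcnj_def rxy)+
  show "vd (ee l) (zc x k) y = 0" "vd (vcnj (ee l)) (zc x k) y = (if k = l then 1 else 0)"
    "vd (ee l) (zb x k) y = (if k = l then 1 else 0)" "vd (vcnj (ee l)) (zb x k) y = 0"
    by (simp_all add: b v e)
qed

lemma vd_add: "csmooth UNIV UNIV f \<Longrightarrow> csmooth UNIV UNIV g \<Longrightarrow> vd v (\<lambda>y. f y + g y) y = vd v f y + vd v g y"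
  and vd_diff: "csmooth UNIV UNIV f \<Longrightarrow> csmooth UNIV UNIV g \<Longrightarrow> vd v (\<lambda>y. f y - g y) y = vd v f y - vd v g y"
  and vd_mult: "csmooth UNIV UNIV f \<Longrightarrow> csmooth UNIV UNIV g \<Longrightarrow> vd v (\<lambda>y. f y * g y) y = vd v f y * g y + f y * vd v g y"
  and vd_uminus: "csmooth UNIV UNIV f \<Longrightarrow> vd v (\<lambda>y. - f y) y = - vd v f y"
  and vd_const: "vd v (\<lambda>y. c) y = 0"
  by (simp_all add: vd_def cpartial_add[of UNIV UNIV] cpartial_diff[of UNIV UNIV] cpartial_mult[of UNIV UNIV] cpartial_uminus[of UNIV UNIV]
      cpartial_const sum.distrib sum_subtractf sum_negf algebra_simps sum_distrib_left)

lemma vd_lin: "vd (u - (\<Sum>q\<in>(UNIV::3 set). c q *s w q)) f y = vd u f y - (\<Sum>q\<in>UNIV. c q * vd (w q) f y)"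
  by (simp add: vd_def sum_3 sum_subtractf algebra_simps sum.distrib sum_distrib_left)

text \<open>
  The quadratic terms make \<open>\<partial>\<^sub>3 \<lambda>\<close> nonzero at \<open>x\<close>, which is what the hidden second-order equation forbids;
  the cubic terms make the structure quasi-integrable along the coordinate axes through \<open>x\<close>.
\<close>

definition c2 :: complex where "c2 = - (1/2)"
definition c4 :: complex where "c4 = 1/4"

definition bf :: "pt \<Rightarrow> 3 \<Rightarrow> pt \<Rightarrow> complex" where
  "bf x r = (if r = 1 then (\<lambda>y. c2 * (zb x 1 y * (1 + zc x 3 y)) - c4 * (zb x 1 y * (zb x 1 y * zb x 2 y)))
     else if r = 2 then (\<lambda>y. c2 * (zb x 2 y * (1 + zc x 3 y)) + c4 * (zb x 1 y * (zb x 2 y * zb x 2 y)))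
     else (\<lambda>y. c2 * (zb x 3 y * (1 + zc x 3 y))))"

text \<open>The identification of skew 3 by 3 matrices with vectors b = \<open>bf\<close>. By
  \<open>psi_Z\<close> the structure is quasi-integrable where the matrix with entries Z_l b_r is a
  multiple of the identity; the intended multiple is \<open>c2 * (1 + zc x 3 y)\<close>, whose
  derivative in the third holomorphic direction is not zero.\<close>

definition Bf :: "pt \<Rightarrow> pt \<Rightarrow> 3 \<Rightarrow> 3 \<Rightarrow> complex" where
  "Bf x y q l = (if l = q + 1 then bf x (q + 2) y else if l = q + 2 then - bf x (q + 1) y else 0)"

lemmas csmooth_intros = csmooth_add csmooth_diff csmooth_mult csmooth_uminus csmooth_zc csmooth_zb csmooth_const

lemma bf_eqs:
  "bf x 1 = (\<lambda>y. c2 * (zb x 1 y * (1 + zc x 3 y)) - c4 * (zb x 1 y * (zb x 1 y * zb x 2 y)))"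
  "bf x 2 = (\<lambda>y. c2 * (zb x 2 y * (1 + zc x 3 y)) + c4 * (zb x 1 y * (zb x 2 y * zb x 2 y)))"
  "bf x 3 = (\<lambda>y. c2 * (zb x 3 y * (1 + zc x 3 y)))"
  by (simp_all add: bf_def)

lemma csmooth_bf: "csmooth UNIV UNIV (bf x r)"
  using exhaust_3[of r] by (elim disjE) (simp_all add: bf_eqs csmooth_intros)

lemma vd_bf:
  "vd (ee 1) (bf x 1) y = c2 * (1 + zc x 3 y) - 2 * c4 * (zb x 1 y * zb x 2 y)" "vd (ee 2) (bf x 1) y = - c4 * (zb x 1 y * zb x 1 y)" "vd (ee 3) (bf x 1) y = 0"
  "vd (ee 1) (bf x 2) y = c4 * (zb x 2 y * zb x 2 y)" "vd (ee 2) (bf x 2) y = c2 * (1 + zc x 3 y) + 2 * c4 * (zb x 1 y * zb x 2 y)" "vd (ee 3) (bf x 2) y = 0"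
  "vd (ee 1) (bf x 3) y = 0" "vd (ee 2) (bf x 3) y = 0" "vd (ee 3) (bf x 3) y = c2 * (1 + zc x 3 y)"
  "vd (vcnj (ee 1)) (bf x r) y = 0" "vd (vcnj (ee 2)) (bf x r) y = 0" "vd (vcnj (ee 3)) (bf x r) y = c2 * zb x r y"
proof -
  note rules = vd_add vd_diff vd_mult vd_const vd_zc vd_zb csmooth_intros
  show "vd (ee 1) (bf x 1) y = c2 * (1 + zc x 3 y) - 2 * c4 * (zb x 1 y * zb x 2 y)" "vd (ee 2) (bf x 1) y = - c4 * (zb x 1 y * zb x 1 y)" "vd (ee 3) (bf x 1) y = 0"
    unfolding bf_eqs by (simp_all add: rules)
  show "vd (ee 1) (bf x 2) y = c4 * (zb x 2 y * zb x 2 y)" "vd (ee 2) (bf x 2) y = c2 * (1 + zc x 3 y) + 2 * c4 * (zb x 1 y * zb x 2 y)" "vd (ee 3) (bf x 2) y = 0"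
    unfolding bf_eqs by (simp_all add: rules)
  show "vd (ee 1) (bf x 3) y = 0" "vd (ee 2) (bf x 3) y = 0" "vd (ee 3) (bf x 3) y = c2 * (1 + zc x 3 y)"
    unfolding bf_eqs by (simp_all add: rules)
  show "vd (vcnj (ee 1)) (bf x r) y = 0" "vd (vcnj (ee 2)) (bf x r) y = 0" "vd (vcnj (ee 3)) (bf x r) y = c2 * zb x r y"
    using exhaust_3[of r] by (elim disjE; simp add: bf_eqs rules)+
qed

lemma Bf_simps: "Bf x y 1 1 = 0" "Bf x y 2 2 = 0" "Bf x y 3 3 = 0" "Bf x y 1 2 = bf x 3 y" "Bf x y 2 1 = - bf x 3 y"
  "Bf x y 2 3 = bf x 1 y" "Bf x y 3 2 = - bf x 1 y" "Bf x y 3 1 = bf x 2 y" "Bf x y 1 3 = - bf x 2 y"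
  by (simp_all add: Bf_def add_3)

lemma orth_family_Bf: "open D \<Longrightarrow> orth_family D (Bf x)"
proof
  assume D: "open D"
  show "open D" by fact
  show "Bf x y l q = - Bf x y q l" for y l q
    using exhaust_3[of l] exhaust_3[of q] by (elim disjE) (simp_all add: Bf_simps)
  have b: "csmooth UNIV D (bf x r)" for r
    by (rule csmooth_subset[OF csmooth_bf]) (use D in auto)
  show "csmooth UNIV D (\<lambda>y. Bf x y q l)" for q l
    unfolding Bf_def using b D csmooth_uminus[OF b] csmooth_const[of UNIV D 0]
    by (cases "l = q + 1"; cases "l = q + 2") simp_all
qed

lemma Smat_0: "Smat (\<lambda>_ _. 0) = 0"
  by (simp add: Smat_def vec_eq_iff)

lemma orthJ_0: "orthJ (\<lambda>_ _. 0) = J0"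
proof -
  have "matrix_inv (mat 1 :: real^6^6) = mat 1" using matrix_inv_det(1)[of "mat 1 :: real^6^6"] by simp
  then show ?thesis by (simp add: orthJ_def cayley_def Smat_0)
qed

lemma zc_center: "zc x k x = 0" "zb x k x = 0"
  by (simp_all add: zc_def zb_def complex_eq_iff)

lemma bf_center: "bf x r x = 0"
  using exhaust_3[of r] by (elim disjE) (simp_all add: bf_eqs zc_center)

text \<open>Of the directions \<open>vcnj (ee q)\<close> in \<open>Z\<close> only q = 3 sees
  \<open>bf\<close>: its cubic terms contain no \<open>zc\<close>, and its quadratic terms only
  \<open>zc x 3\<close>.\<close>

lemma vd_Z_bf:
  fixes D :: "pt set"
  assumes "open D"
  shows "vd (orth_family.Z (Bf x) y l) (bf x r) y = vd (ee l) (bf x r) y - Bf x y 3 l * (c2 * zb x r y)"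
proof -
  interpret orth_family D "Bf x" by (rule orth_family_Bf[OF assms])
  show ?thesis unfolding Z_def vd_lin by (simp add: sum_3 vd_bf)
qed

lemma vd_Bf:
  "vd v (\<lambda>y. Bf x y 1 1) y = 0" "vd v (\<lambda>y. Bf x y 2 2) y = 0" "vd v (\<lambda>y. Bf x y 3 3) y = 0"
  "vd v (\<lambda>y. Bf x y 1 2) y = vd v (bf x 3) y" "vd v (\<lambda>y. Bf x y 2 1) y = - vd v (bf x 3) y"
  "vd v (\<lambda>y. Bf x y 2 3) y = vd v (bf x 1) y" "vd v (\<lambda>y. Bf x y 3 2) y = - vd v (bf x 1) y"
  "vd v (\<lambda>y. Bf x y 3 1) y = vd v (bf x 2) y" "vd v (\<lambda>y. Bf x y 1 3) y = - vd v (bf x 2) y"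
  by (simp_all add: Bf_simps vd_const vd_uminus csmooth_bf)

text \<open>The axes are complex lines, along which only the j-th complex coordinate varies; every
  real coordinate line through \<open>x\<close> lies in one of them. Off the axes terms such as
  \<open>zb x 1 y * zb x 2 y\<close> obstruct quasi-integrability.\<close>

lemma quasi_integrable_on_axes:
  assumes D: "open D" "y \<in> D" and ax: "\<And>k. k \<noteq> j \<Longrightarrow> zc x k y = 0"
  shows "quasi_integrable_at (orth_family.s (Bf x)) D y"
proof -
  interpret orth_family D "Bf x" by (rule orth_family_Bf[OF D(1)])
  \<comment> \<open>This fixes \<open>c4\<close>. On the second axis the quadratic part contributes
    - c2^2 zb_2^2 to Z_1 b_2, on the first axis + c2^2 zb_1^2 to Z_2 b_1; the cubic terms contribute
    c4 zb_2^2 and - c4 zb_1^2.\<close>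
  have c: "c4 = c2 * c2" by (simp add: c2_def c4_def)
  have z: "(zb x 2 y = 0 \<and> zb x 3 y = 0 \<and> zc x 3 y = 0) \<or> (zb x 1 y = 0 \<and> zb x 3 y = 0 \<and> zc x 3 y = 0) \<or> (zb x 1 y = 0 \<and> zb x 2 y = 0)"
    using ax[of 1] ax[of 2] ax[of 3] exhaust_3[of j] by (auto simp: zb_def)
  have diag: "vd (Z y 1) (bf x 1) y = c2 * (1 + zc x 3 y)" "vd (Z y 2) (bf x 2) y = c2 * (1 + zc x 3 y)" "vd (Z y 3) (bf x 3) y = c2 * (1 + zc x 3 y)"
    using z by (auto simp: vd_Z_bf[OF D(1)] vd_bf Bf_simps bf_eqs[THEN fun_cong])
  have off: "vd (Z y 1) (bf x 2) y = 0" "vd (Z y 1) (bf x 3) y = 0" "vd (Z y 2) (bf x 1) y = 0"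
    "vd (Z y 2) (bf x 3) y = 0" "vd (Z y 3) (bf x 1) y = 0" "vd (Z y 3) (bf x 2) y = 0"
    using z by (auto simp: vd_Z_bf[OF D(1)] vd_bf Bf_simps bf_eqs[THEN fun_cong] c)
  note G = diag off
  have p: "psi (J_of (s y)) (eta_of (s y)) (dJ s y) (Z y k) (Z y l) (Z y m) = 0" for k l m
    unfolding psi_Z[OF D(2)] using exhaust_3[of k] exhaust_3[of l] exhaust_3[of m]
    by (elim disjE) (simp_all add: vd_Bf G)
  have sp: "\<exists>c. v = (\<Sum>k\<in>UNIV. c k *s Z y k)" if "T01 (J_of (s y)) v" for v
    using Z_span that by (simp add: s_def)
  show ?thesis
    by (rule quasi_integrable_atI[OF loc_section D(2)]) (rule psi_T01_span[where Z = "Z y", OF sp p])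
qed

section \<open>Jets of sections, and the equations as functions on jets\<close>

lemma jet_in_system:
  assumes "W \<subseteq> D" "x \<in> W" "local_section cu_fibre W s" "quasi_integrable_at s W x"
  shows "jet 1 s x \<in> quasi_integrability_system D"
  using assms unfolding quasi_integrability_system_def by blast

lemma partials_smooth: "smooth_fn UNIV W f \<Longrightarrow> smooth_fn UNIV W (partials L f)"
  by (induction L) (simp_all add: smooth_fn_partial)

lemma jet_continuous:
  assumes s: "local_section F W s"
  shows "continuous_on W (jet k s)"
proof (rule continuous_on_coordinatewise_then_product)
  fix c
  show "continuous_on W (\<lambda>y. jet k s y c)"
  proof (cases c)
    case (Inl a) then show ?thesis by (simp add: jet_def continuous_on_coordinate)
  next
    case (Inr p)
    obtain L b where p: "p = (L, b)" by (cases p)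
    have "continuous_on W (partials L (\<lambda>y. s y b))"
      using s by (intro smooth_fn_continuous[OF partials_smooth]) (simp add: local_section_def smooth_map_def)
    then show ?thesis using Inr p by (cases "length L \<le> k") (simp_all add: jet_def)
  qed
qed

lemma jet_coord_space: "jet k s x \<in> coord_space (jet_coords k)"
  by (auto simp: coord_space_def jet_def jet_coords_def split: sum.splits)

lemma jet_eventually:
  assumes s: "local_section F W s" and x: "x \<in> W" and U: "open_in_coord (jet_coords k) U" "jet k s x \<in> U"
  shows "\<forall>\<^sub>F t in nhds (x i). x(i := t) \<in> W \<and> jet k s (x(i := t)) \<in> U"
proof -
  obtain T where T: "open T" "U = coord_space (jet_coords k) \<inter> T"
    using U(1) by (auto simp: open_in_coord_def openin_open)
  have W: "open W" using s by (simp add: local_section_def)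
  have "open (jet k s -` T \<inter> W)"
    using jet_continuous[OF s] continuous_on_open_vimage[OF W] T(1) by blast
  then have "open_in_coord UNIV (jet k s -` T \<inter> W)" by simp
  then have "\<forall>\<^sub>F t in nhds (x i). x(i := t) \<in> jet k s -` T \<inter> W"
    by (rule fun_upd_eventually) (use U T x in auto)
  then show ?thesis
    by (rule eventually_mono) (use T jet_coord_space in auto)
qed

definition jJ :: "(6, cu_index) jet \<Rightarrow> real^6^6" where
  "jJ j = (\<chi> a b. j (Inr ([], Inl (a, b))))"
definition jH :: "(6, cu_index) jet \<Rightarrow> real^6^6" where
  "jH j = (\<chi> a b. j (Inr ([], Inr (a, b))))"
definition jD :: "(6, cu_index) jet \<Rightarrow> 6 \<Rightarrow> real^6^6" where
  "jD j c = (\<chi> a b. j (Inr ([c], Inl (a, b))))"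

lemma j_jet: "jJ (jet 1 s y) = J_of (s y)" "jH (jet 1 s y) = eta_of (s y)" "jD (jet 1 s y) = dJ s y"
  by (simp_all add: jJ_def jH_def jD_def jet_def J_of_def eta_of_def dJ_def fun_eq_iff)

text \<open>\<open>psi\<close> is polynomial in the jet coordinates, so its real and imaginary parts
  are admissible as functions \<open>\<Phi>\<close> in the definition of the prolongation, on the
  whole coordinate space.\<close>

lemma csmooth_psi_jet:
  assumes "open_in_coord I U"
  shows "csmooth I U (\<lambda>j. psi (jJ j) (jH j) (jD j) u v w)"
proof -
  have "csmooth I U (\<lambda>j. tau (jJ j) (jH j) (jD j) u v w)" for u v w
    unfolding tau_tri tri1_expand tri2_expand jJ_def jH_def jD_def vec_lambda_beta
    using assms by (intro csmooth_diff csmooth_sum csmooth_mult csmooth_const csmooth_of_real smooth_fn_coordinate)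
  then show ?thesis unfolding psi_def by (intro csmooth_add)
qed

lemma open_in_coord_whole: "open_in_coord I (coord_space I)"
  by (simp add: open_in_coord_def)

lemma psi_jet_system:
  assumes "q \<in> quasi_integrability_system D"
  shows "psi (jJ q) (jH q) (jD q) u v w = 0"
proof -
  obtain s x W where q: "q = jet 1 s x" "x \<in> W" "local_section cu_fibre W s" "quasi_integrable_at s W x"
    using assms unfolding quasi_integrability_system_def by blast
  then show ?thesis using quasi_integrable_at_iff[OF q(3,2)] by (simp add: j_jet del: One_nat_def)
qed

lemma local_section_subset: "local_section F W s \<Longrightarrow> open V \<Longrightarrow> V \<subseteq> W \<Longrightarrow> local_section F V s"
  unfolding local_section_def smooth_map_def by (auto intro: smooth_fn_subset[of UNIV W _ V])

theorem not_formally_integrable_chart: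
  assumes D: "open D" and x: "x \<in> D"
  shows "\<not> formally_integrable cu_fibre D (quasi_integrability_system D)"
proof
  let ?Q = "quasi_integrability_system D"
  assume fi: "formally_integrable cu_fibre D ?Q"
  interpret orth_family D "Bf x" by (rule orth_family_Bf[OF D])
  have "zc x k (x(i := t)) = 0" if "i \<noteq> rx k" "i \<noteq> ry k" for k i t
    using that by (simp add: zc_def complex_eq_iff)
  moreover have "\<exists>j. \<forall>k. k \<noteq> j \<longrightarrow> i \<noteq> rx k \<and> i \<noteq> ry k" for i
  proof -
    have "i \<noteq> rx k \<and> i \<noteq> ry k" if "k \<noteq> (if i = 0 \<or> i = 1 then 1 else if i = 2 \<or> i = 3 then 2 else 3)" for k
      using that exhaust_3[of k] exhaust_6[of i] by (elim disjE) (simp_all add: rxy)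
    then show ?thesis by blast
  qed
  ultimately have axes: "\<exists>j. \<forall>k. k \<noteq> j \<longrightarrow> zc x k (x(i := t)) = 0" for i t
    by meson
  have qi: "quasi_integrable_at s D (x(i := t))" if "x(i := t) \<in> D" for i t
    using axes[of i t] quasi_integrable_on_axes[OF D that, of _ x] by blast
  have qx: "quasi_integrable_at s D x" using qi[of 0 "x 0"] x by simp
  \<comment> \<open>The first partial derivative of \<open>\<Phi>\<close> along the section depends
    only on values on a coordinate line through \<open>x\<close>. There the 1-jets of
    \<open>s\<close> lie in the system by \<open>qi\<close>, so \<open>\<Phi>\<close> vanishes
    identically on a piece of the line.\<close>
  have "jet 2 s x \<in> prolongation cu_fibre D ?Q 1"
  proof -
    have "partials L (\<lambda>y. \<Phi> (jet 1 s y)) x = 0"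
      if \<Phi>: "smooth_fn (jet_coords 1) U \<Phi>" "jet 1 s x \<in> U" "\<forall>q\<in>?Q \<inter> U. \<Phi> q = 0" and L: "length L \<le> 1" for U \<Phi> L
    proof (cases L)
      case Nil
      then show ?thesis using \<Phi> jet_in_system[OF subset_refl x loc_section qx] by simp
    next
      case (Cons i M)
      then have Li: "L = [i]" using L by simp
      have "\<forall>\<^sub>F t in nhds (x i). x(i := t) \<in> D \<and> jet 1 s (x(i := t)) \<in> U"
        by (rule jet_eventually[OF loc_section x smooth_fn_open[OF \<Phi>(1)] \<Phi>(2)])
      then have "\<forall>\<^sub>F t in nhds (x i). \<Phi> (jet 1 s (x(i := t))) = 0"
        by (rule eventually_mono) (use \<Phi>(3) jet_in_system[OF subset_refl _ loc_section qi] in blast)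
      then have "deriv (\<lambda>t. \<Phi> (jet 1 s (x(i := t)))) (x i) = deriv (\<lambda>t. 0) (x i)"
        by (intro deriv_cong_ev refl)
      then show ?thesis by (simp add: Li partial_def)
    qed
    then show ?thesis
      unfolding prolongation_def using x loc_section jet_in_system[OF subset_refl x loc_section qx]
      by (simp add: numeral_2_eq_2) blast
  qed
  \<comment> \<open>Surjectivity in the definition of formal integrability, for k = 1: the 2-jet of
    \<open>s\<close> lifts to a 3-jet satisfying the twice differentiated equations.\<close>
  also have "prolongation cu_fibre D ?Q 1 = jet_proj 2 ` prolongation cu_fibre D ?Q 2"
  proof -
    have "jet_proj (1 + 1) ` prolongation cu_fibre D ?Q (1 + 1) = prolongation cu_fibre D ?Q 1"
      using fi unfolding formally_integrable_def by blast
    then show ?thesis by (simp add: numeral_2_eq_2)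
  qed
  finally obtain s' x' W' where j: "jet 2 s x = jet_proj 2 (jet 3 s' x')" and W': "W' \<subseteq> D" "x' \<in> W'"
    and s': "local_section cu_fibre W' s'"
    and \<Phi>: "\<And>U \<Phi> L. smooth_fn (jet_coords 1) U \<Phi> \<Longrightarrow> jet 1 s' x' \<in> U \<Longrightarrow> \<forall>q\<in>?Q \<inter> U. \<Phi> q = 0 \<Longrightarrow>
           length L \<le> 2 \<Longrightarrow> partials L (\<lambda>y. \<Phi> (jet 1 s' y)) x' = 0"
    unfolding prolongation_def by (auto simp: numeral_3_eq_3 numeral_2_eq_2)
  have x': "x' = x"
  proof
    fix a show "x' a = x a"
      using fun_cong[OF j, of "Inl a"] by (simp add: jet_def jet_proj_def jet_coords_def)
  qed
  have jets: "partials L (\<lambda>y. s' y b) x = partials L (\<lambda>y. s y b) x" if "length L \<le> 2" for L b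
    using fun_cong[OF j, of "Inr (L, b)"] that unfolding x' by (simp add: jet_def jet_proj_def jet_coords_def)
  have oW': "open W'" using s' by (simp add: local_section_def)
  interpret j2: same_2jet W' x s s'
    by unfold_locales (use local_section_subset[OF loc_section oW' W'(1)] s' W' x' jets in auto)
  have B0: "Bf x x q l = 0" for q l by (simp add: Bf_def bf_center)
  have "Bf x x = (\<lambda>_ _. 0)" by (simp add: fun_eq_iff B0)
  then have s0: "J_of (s x) = J0" "eta_of (s x) = - J0" by (simp_all add: s_def orthJ_0)
  define P where "P t k l m = (\<lambda>y. psi (J_of (t y)) (eta_of (t y)) (dJ t y) (ee k) (ee l) (ee m))" for t k l m
  define L where "L t = - 2 * j2.dd2 (ee 1) (ee 2) (P t 3 1 2) + j2.dd2 (ee 2) (ee 2) (P t 3 1 1) - j2.dd2 (ee 2) (ee 3) (P t 2 1 1)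
     + j2.dd2 (ee 1) (ee 1) (P t 3 2 2) - j2.dd2 (ee 1) (ee 3) (P t 1 2 2)" for t
  have "L s' = L s"
    unfolding L_def P_def by (rule j2.third_order_cancellation[OF s0])
  moreover have "L s' = 0"
  proof -
    \<comment> \<open>The real and imaginary parts of \<open>psi\<close> vanish on the system, so
      the second prolongation forces all their second derivatives along \<open>s'\<close> to vanish
      at \<open>x\<close>.\<close>
    have "cpartial p (cpartial q (P s' k l m)) x = 0" for p q k l m
    proof -
      let ?U = "coord_space (jet_coords 1) :: (6, cu_index) jet set"
      let ?F = "\<lambda>j. psi (jJ j) (jH j) (jD j) (ee k) (ee l) (ee m)"
      have sm: "smooth_fn (jet_coords 1) ?U (\<lambda>j. Re (?F j))" "smooth_fn (jet_coords 1) ?U (\<lambda>j. Im (?F j))"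
        using csmooth_psi_jet[OF open_in_coord_whole, of "jet_coords 1" "ee k" "ee l" "ee m"] by (auto simp: csmooth_def)
      have "partials [p, q] (\<lambda>y. Re (?F (jet 1 s' y))) x = 0"
        using \<Phi>[OF sm(1) jet_coord_space, of "[p, q]"] by (simp add: psi_jet_system[of _ D] x' del: One_nat_def)
      moreover have "partials [p, q] (\<lambda>y. Im (?F (jet 1 s' y))) x = 0"
        using \<Phi>[OF sm(2) jet_coord_space, of "[p, q]"] by (simp add: psi_jet_system[of _ D] x' del: One_nat_def)
      ultimately show ?thesis by (simp add: cpartial_def P_def j_jet complex_eq_iff del: One_nat_def)
    qed
    then show ?thesis by (simp add: L_def j2.dd2_def)
  qed
  \<comment> \<open>Since \<open>bf x r\<close> is \<open>c2 * zb x r\<close> to first order, the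
    entry with \<open>P s 3 1 2\<close> contributes -6 i and those with \<open>P s 2 1 1\<close> and
    \<open>P s 1 2 2\<close> contribute - i each; in the other two the quadratic terms cancel. The
    term -6 i carries the failure of quasi-integrability off the axes.\<close>
  moreover have "L s = - 8 * \<i>"
  proof -
    have psi0: "psi (J_of (s x)) (eta_of (s x)) (dJ s x) u v w = 0" for u v w
      using quasi_integrable_at_iff[OF loc_section x] qx by blast
    define \<Theta> where "\<Theta> k l m y = - 2 * \<i> * (vd (Z y l) (\<lambda>y. Bf x y m k) y + vd (Z y m) (\<lambda>y. Bf x y l k) y)" for k l m y
    have c: "cpartial p (cpartial q (P s k l m)) x = cpartial p (cpartial q f) x"
      if "\<And>y. \<Theta> k l m y = f y" for p q k l m f
    proof -
      have "cpartial p (cpartial q (P s k l m)) x = cpartial p (cpartial q (\<lambda>y. psi (J_of (s y)) (eta_of (s y)) (dJ s y) (Z y k) (Z y l) (Z y m))) x"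
        unfolding P_def by (rule cpartial2_psi_ee[OF x B0 psi0])
      also have "\<dots> = cpartial p (cpartial q f) x"
        by (rule cpartial2_cong[of UNIV D]) (use D x in \<open>simp_all add: psi_Z that[symmetric] \<Theta>_def\<close>)
      finally show ?thesis .
    qed
    have dd: "j2.dd2 u v (P s k l m) = j2.dd2 u v f" if "\<And>y. \<Theta> k l m y = f y" for u v k l m f
      unfolding j2.dd2_def c[OF that] ..
    note G = vd_Z_bf[OF D] vd_bf Bf_simps
    have cc: "c2 = - (1/2)" "c4 = 1/4" by (simp_all add: c2_def c4_def)
    let ?Z = "zb x" let ?b = "bf x"
    define n where "n = - \<i>"
    have t1: "\<Theta> 3 1 2 y = 2 * \<i> * (?Z 1 y * ?Z 2 y) + n * (?Z 1 y * ?b 2 y) + n * (?Z 2 y * ?b 1 y)" for y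
      unfolding \<Theta>_def vd_Bf by (simp add: G cc n_def algebra_simps)
    have t2: "\<Theta> 3 1 1 y = \<i> * (?Z 2 y * ?Z 2 y) + (2 * \<i>) * (?Z 2 y * ?b 2 y)" for y
      unfolding \<Theta>_def vd_Bf by (simp add: G cc n_def algebra_simps)
    have t3: "\<Theta> 2 1 1 y = (2 * n) * (?Z 3 y * ?b 2 y)" for y
      unfolding \<Theta>_def vd_Bf by (simp add: G cc n_def algebra_simps)
    have t4: "\<Theta> 3 2 2 y = \<i> * (?Z 1 y * ?Z 1 y) + (2 * \<i>) * (?Z 1 y * ?b 1 y)" for y
      unfolding \<Theta>_def vd_Bf by (simp add: G cc n_def algebra_simps)
    have t5: "\<Theta> 1 2 2 y = (2 * n) * (?Z 3 y * ?b 1 y)" for y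
      unfolding \<Theta>_def vd_Bf by (simp add: G cc n_def algebra_simps)
    have dprod: "j2.dd2 u v (\<lambda>y. f y * g y) = vd u f x * vd v g x + vd u g x * vd v f x"
      if "csmooth UNIV UNIV f" "csmooth UNIV UNIV g" "f x = 0" "g x = 0" for u v f g
      unfolding j2.dd2_def vd_def sum_product sum.distrib[symmetric]
      by (intro sum.cong refl) (simp add: cpartial2_mult[of UNIV UNIV] that algebra_simps)
    have dadd: "j2.dd2 u v (\<lambda>y. f y + g y) = j2.dd2 u v f + j2.dd2 u v g"
      if "csmooth UNIV UNIV f" "csmooth UNIV UNIV g" for u v f g
      unfolding j2.dd2_def sum.distrib[symmetric]
      by (intro sum.cong refl) (simp add: cpartial2_add[of UNIV UNIV] that algebra_simps)
    have dcm: "j2.dd2 u v (\<lambda>y. c * f y) = c * j2.dd2 u v f" if "csmooth UNIV UNIV f" for u v f c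
      unfolding j2.dd2_def by (simp add: cpartial2_cmult[of UNIV UNIV] that sum_distrib_left mult_ac)
    note rules = dadd dcm dprod csmooth_mult csmooth_add csmooth_const csmooth_cmult csmooth_zb csmooth_bf zc_center bf_center vd_zb vd_bf
    show ?thesis
      unfolding L_def dd[OF t1] dd[OF t2] dd[OF t3] dd[OF t4] dd[OF t5]
      by (simp add: rules) (simp add: cc n_def algebra_simps)
  qed
  ultimately show False by simp
qed

section \<open>Dimension counts for tableaux\<close>

text \<open>Rank-nullity on a subspace: the orthogonal complement of the kernel within S is mapped
  injectively and onto the image.\<close>

lemma dim_image_kernel:
  fixes f :: "'a::euclidean_space \<Rightarrow> 'b::euclidean_space"
  assumes f: "linear f" and S: "subspace S"
  shows "dim S = dim (f ` S) + dim {v \<in> S. f v = 0}"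
proof -
  define N where "N = {v \<in> S. f v = 0}"
  define M where "M = {y \<in> S. \<forall>x\<in>N. orthogonal x y}"
  have N: "subspace N"
    unfolding N_def using S f by (auto simp: subspace_def linear_add linear_scale linear_0)
  have M: "subspace M"
    unfolding M_def using S by (auto simp: subspace_def orthogonal_def inner_right_distrib)
  have d: "dim M + dim N = dim S"
    unfolding M_def by (rule dim_subspace_orthogonal_to_vectors[OF N S]) (auto simp: N_def)
  have "inj_on f (span M)"
  proof (rule inj_onI)
    fix u v assume uv: "u \<in> span M" "v \<in> span M" "f u = f v"
    then have "u - v \<in> M" using M by (metis span_eq_iff subspace_diff)
    moreover have "u - v \<in> N" using calculation uv(3) f by (simp add: N_def M_def linear_diff)
    ultimately have "orthogonal (u - v) (u - v)" by (auto simp: M_def)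
    then show "u = v" by (simp add: orthogonal_self)
  qed
  then have "dim (f ` M) = dim M" by (rule dim_image_eq[OF f])
  moreover have "f ` S = f ` M"
  proof
    show "f ` S \<subseteq> f ` M"
    proof
      fix w assume "w \<in> f ` S"
      then obtain v where v: "v \<in> S" "w = f v" by blast
      obtain y z where yz: "y \<in> span N" "\<And>w. w \<in> span N \<Longrightarrow> orthogonal z w" "v = y + z"
        using orthogonal_subspace_decomp_exists[of N v] by metis
      have y: "y \<in> N" using yz(1) N by (metis span_eq_iff)
      then have "z \<in> S" using v(1) yz(3) S by (metis (no_types, lifting) N_def add_diff_cancel_left' mem_Collect_eq subspace_diff)
      then have "z \<in> M" using yz(2) by (auto simp: M_def orthogonal_commute span_base)
      moreover have "f v = f z" using y yz(3) f by (simp add: linear_add N_def)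
      ultimately show "w \<in> f ` M" using v(2) by blast
    qed
  qed (auto simp: M_def)
  ultimately show ?thesis using d by (simp add: N_def)
qed

text \<open>Each of the conditions f k v = 0 takes values in T and therefore lowers the dimension by
  at most dim T.\<close>

lemma dim_le_joint_kernel:
  fixes f :: "'k \<Rightarrow> 'a::euclidean_space \<Rightarrow> 'b::euclidean_space"
  assumes "finite K" "subspace S" and f: "\<And>k. k \<in> K \<Longrightarrow> linear (f k)" "\<And>k. k \<in> K \<Longrightarrow> f k ` S \<subseteq> T"
  shows "dim S \<le> card K * dim T + dim {v \<in> S. \<forall>k\<in>K. f k v = 0}"
  using assms
proof (induction K rule: finite_induct)
  case empty
  then show ?case by simp
next
  case (insert k K)
  define S' where "S' = {v \<in> S. \<forall>k\<in>K. f k v = 0}"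
  have "subspace S'"
    using insert.prems unfolding S'_def subspace_def by (auto simp: linear_0 linear_add linear_scale)
  then have "dim S' = dim (f k ` S') + dim {v \<in> S'. f k v = 0}"
    using insert.prems by (intro dim_image_kernel) auto
  moreover have "dim (f k ` S') \<le> dim T"
    using insert.prems by (intro dim_subset) (auto simp: S'_def)
  moreover have "dim S \<le> card K * dim T + dim S'"
    unfolding S'_def by (rule insert.IH) (use insert.prems in auto)
  moreover have "{v \<in> S'. f k v = 0} = {v \<in> S. \<forall>k\<in>insert k K. f k v = 0}"
    by (auto simp: S'_def)
  ultimately show ?case using insert.hyps by (simp add: algebra_simps)
qed

lemma linear_vec_nth': "linear (\<lambda>a::'a::real_vector^'n. a $ i)"
  by (auto intro!: linearI)

lemma dim_Hom:
  fixes T :: "(real^'m) set"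
  assumes T: "subspace T"
  shows "card I * dim T \<le> dim {a::real^'m^'n. \<forall>i. (i \<in> I \<longrightarrow> a $ i \<in> T) \<and> (i \<notin> I \<longrightarrow> a $ i = 0)}"
proof (induction I rule: infinite_finite_induct)
  case (infinite A)
  then show ?case by simp
next
  case empty
  show ?case by simp
next
  case (insert i I)
  let ?W = "\<lambda>I. {a::real^'m^'n. \<forall>i. (i \<in> I \<longrightarrow> a $ i \<in> T) \<and> (i \<notin> I \<longrightarrow> a $ i = 0)}"
  have sub: "subspace (?W I)" for I
    unfolding subspace_def
  proof (intro conjI allI ballI)
    show "0 \<in> ?W I" using T by (simp add: subspace_0)
    fix u assume u: "u \<in> ?W I"
    show "u + v \<in> ?W I" if "v \<in> ?W I" for v using T u that by (auto simp: subspace_add)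
    show "c *\<^sub>R u \<in> ?W I" for c using T u by (auto simp: subspace_scale)
  qed
  have "dim (?W (insert i I)) = dim ((\<lambda>a. a $ i) ` ?W (insert i I)) + dim {a \<in> ?W (insert i I). a $ i = 0}"
    by (rule dim_image_kernel[OF linear_vec_nth' sub])
  moreover have "{a \<in> ?W (insert i I). a $ i = 0} = ?W I"
    using insert.hyps T by (auto simp: subspace_0)
  moreover have "T \<subseteq> (\<lambda>a. a $ i) ` ?W (insert i I)"
  proof
    fix v assume "v \<in> T"
    then have "axis i v \<in> ?W (insert i I)" using T by (auto simp: axis_def subspace_0)
    then show "v \<in> (\<lambda>a. a $ i) ` ?W (insert i I)" by (rule image_eqI[rotated]) (simp add: axis_def)
  qed
  then have "dim T \<le> dim ((\<lambda>a. a $ i) ` ?W (insert i I))" by (rule dim_subset)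
  ultimately show ?case using insert by simp
qed

lemma vector_matrix_sum: "v v* (a :: real^'m^'n) = (\<Sum>i\<in>UNIV. v $ i *\<^sub>R a $ i)"
  by (simp add: vector_matrix_mult_def vec_eq_iff mult.commute)

lemma vm_lin:
  fixes a b :: "real^'m^'n"
  shows "v v* (a + b) = v v* a + v v* b" "v v* (c *\<^sub>R a) = c *\<^sub>R (v v* a)" "v v* (0 :: real^'m^'n) = 0"
  by (simp_all add: vector_matrix_mult_def vec_eq_iff algebra_simps sum.distrib sum_distrib_left)

text \<open>T stands for the tangent space of the fibre and \<open>\<sigma>\<close> for the symbol
  of the system. Its target models the trace-free 3 by 3 matrices, of real dimension 16, the
  codimension of the system.\<close>

locale tableau_count =
  fixes T :: "(real^'m) set" and \<sigma> :: "real^'m^6 \<Rightarrow> complex^8"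
  assumes T: "subspace T" and \<sigma>: "linear \<sigma>"
begin

definition A where "A = {a. (\<forall>i. a $ i \<in> T) \<and> \<sigma> a = 0}"

definition S_E :: "(real^6) set \<Rightarrow> (real^'m^6) set" where
  "S_E E = {a. (\<forall>i. a $ i \<in> T) \<and> (\<forall>v\<in>E. v v* a = 0)}"

lemma subspace_S_E: "subspace (S_E E)"
  using T unfolding S_E_def by (auto simp: subspace_def vm_lin)

text \<open>Without the symbol equations, the maps into T that kill E form a space of dimension (6 -
  dim E) * dim T; the additive form avoids truncated subtraction.\<close>

lemma dim_S_E:
  assumes E: "subspace E"
  shows "6 * dim T \<le> dim E * dim T + dim (S_E E)"
proof -
  obtain Bs where Bs: "Bs \<subseteq> E" "independent Bs" "E \<subseteq> span Bs" "card Bs = dim E"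
    using basis_exists[of E] by metis
  have fin: "finite Bs" using Bs(2) by (simp add: finiteI_independent)
  define S where "S = {a::real^'m^6. \<forall>i. a $ i \<in> T}"
  have S: "subspace S" using T by (auto simp: S_def subspace_def)
  have "6 * dim T \<le> dim S"
    using dim_Hom[OF T, of "UNIV :: 6 set"] by (simp add: S_def)
  also have "\<dots> \<le> card Bs * dim T + dim {a \<in> S. \<forall>b\<in>Bs. b v* a = 0}"
  proof (rule dim_le_joint_kernel[OF fin S])
    show "linear (\<lambda>a::real^'m^6. b v* a)" for b
      by (auto intro!: linearI simp: vm_lin)
    show "(\<lambda>a. b v* a) ` S \<subseteq> T" for b
      unfolding vector_matrix_sum S_def using T by (auto intro!: subspace_sum subspace_scale)
  qed
  also have "{a \<in> S. \<forall>b\<in>Bs. b v* a = 0} = S_E E"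
  proof -
    have "v v* a = 0" if a: "\<forall>b\<in>Bs. b v* a = 0" and v: "v \<in> E" for a :: "real^'m^6" and v
    proof -
      have sub: "subspace {v. v v* a = 0}"
        by (auto simp: subspace_def vector_matrix_mult_def vec_eq_iff algebra_simps sum.distrib sum_distrib_left[symmetric])
      have "span Bs \<subseteq> {v. v v* a = 0}" using a by (intro span_minimal[OF _ sub]) auto
      then show ?thesis using v Bs(3) by auto
    qed
    then show ?thesis using Bs(1) by (auto simp: S_def S_E_def)
  qed
  finally show ?thesis using Bs(4) by simp
qed

lemma dim_annihilator:
  "dim (S_E E) = dim (\<sigma> ` S_E E) + dim {a \<in> A. \<forall>v\<in>E. v v* a = 0}"
proof -
  have "{a \<in> S_E E. \<sigma> a = 0} = {a \<in> A. \<forall>v\<in>E. v v* a = 0}" by (auto simp: A_def S_E_def)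
  then show ?thesis using dim_image_kernel[OF \<sigma> subspace_S_E, of E] by simp
qed

text \<open>Symmetric P with values in T have 21 free components, and by surjectivity the 6 * 16 =
  96 real equations imposed on them are independent.\<close>

lemma dim_prolongation:
  assumes surj: "\<And>n :: complex^8^6. \<exists>P. (\<forall>i j. P $ i $ j \<in> T) \<and> (\<forall>i j. P $ i $ j = P $ j $ i) \<and> (\<forall>i. \<sigma> (P $ i) = n $ i)"
  shows "dim (tableau_prolongation A) + 96 \<le> 21 * dim T"
proof -
  define S where "S = {P::real^'m^6^6. (\<forall>i j. P $ i $ j \<in> T) \<and> (\<forall>i j. P $ i $ j = P $ j $ i)}"
  have S: "subspace S" using T by (auto simp: S_def subspace_def)
  define F :: "real^'m^6^6 \<Rightarrow> complex^8^6" where "F P = (\<chi> i. \<sigma> (P $ i))" for P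
  have F: "linear F"
    using \<sigma> by (auto intro!: linearI simp: F_def vec_eq_iff linear_add linear_scale)
  have "F ` S = UNIV"
  proof -
    have "n \<in> F ` S" for n
    proof -
      obtain P where "(\<forall>i j. P $ i $ j \<in> T) \<and> (\<forall>i j. P $ i $ j = P $ j $ i) \<and> (\<forall>i. \<sigma> (P $ i) = n $ i)"
        using surj[of n] by blast
      then show ?thesis by (intro image_eqI[of _ _ P]) (auto simp: F_def S_def vec_eq_iff)
    qed
    then show ?thesis by blast
  qed
  then have "dim (F ` S) = 96" by simp
  moreover have "{P \<in> S. F P = 0} = tableau_prolongation A"
    by (auto simp: S_def F_def tableau_prolongation_def A_def vec_eq_iff)
  ultimately have dS: "dim S = 96 + dim (tableau_prolongation A)"
    using dim_image_kernel[OF F S] by simp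
  \<comment> \<open>One representative for each unordered pair of indices; in the type
    \<open>6\<close> the numeral 6 denotes 0.\<close>
  define K :: "(6 \<times> 6) set" where "K = {(1,1),(1,2),(1,3),(1,4),(1,5),(1,6),(2,2),(2,3),(2,4),(2,5),(2,6),
    (3,3),(3,4),(3,5),(3,6),(4,4),(4,5),(4,6),(5,5),(5,6),(6,6)}"
  have card: "card K = 21" by (simp add: K_def)
  have all: "(i, j) \<in> K \<or> (j, i) \<in> K" for i j
    using exhaust_6[of i] exhaust_6[of j] unfolding K_def by (elim disjE) simp_all
  have "dim S \<le> card K * dim T + dim {P \<in> S. \<forall>k\<in>K. P $ fst k $ snd k = 0}"
  proof (rule dim_le_joint_kernel[OF _ S])
    show "linear (\<lambda>P::real^'m^6^6. P $ fst k $ snd k)" for k by (auto intro!: linearI)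
    show "(\<lambda>P. P $ fst k $ snd k) ` S \<subseteq> T" for k by (auto simp: S_def)
  qed (simp add: K_def)
  also have "{P \<in> S. \<forall>k\<in>K. P $ fst k $ snd k = 0} = {0}"
  proof -
    have "P = 0" if P: "P \<in> S" "\<forall>k\<in>K. P $ fst k $ snd k = 0" for P
    proof -
      have "P $ i $ j = 0" for i j
      proof (cases "(i, j) \<in> K")
        case True
        then show ?thesis using P(2) by force
      next
        case False
        then have "P $ j $ i = 0" using P(2) all[of i j] by force
        moreover have "P $ i $ j = P $ j $ i" using P(1) unfolding S_def by blast
        ultimately show ?thesis by simp
      qed
      then show ?thesis by (simp add: vec_eq_iff)
    qed
    moreover have "0 \<in> {P \<in> S. \<forall>k\<in>K. P $ fst k $ snd k = 0}" using S by (simp add: subspace_0)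
    ultimately show ?thesis by blast
  qed
  finally show ?thesis using dS card by simp
qed

text \<open>\<open>Inf\<close> of the empty set of naturals is 0, so the bound needs some subspace
  of dimension k; this is the role of \<open>k \<le> 6\<close>.\<close>

lemma generic_annihilator_dim_ge:
  assumes "k \<le> 6" and "\<And>E. subspace E \<Longrightarrow> dim E = k \<Longrightarrow> n \<le> dim {a \<in> A. \<forall>v\<in>E. v v* a = 0}"
  shows "n \<le> generic_annihilator_dim A k"
proof -
  let ?X = "{dim {a \<in> A. \<forall>v\<in>E. v v* a = 0} |E. subspace E \<and> dim E = k}"
  obtain E :: "(real^6) set" where "subspace E" "dim E = k"
    using choose_subspace_of_subspace[of k "UNIV :: (real^6) set"] assms(1) by auto
  then have "?X \<noteq> {}" by blast
  then have "Inf ?X \<in> ?X" by (rule Inf_nat_def1)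
  then show ?thesis using assms(2) unfolding generic_annihilator_dim_def by auto
qed

text \<open>Summation by parts turns the weighted sum of the characters into g_0 + ... + g_5 - 6
  g_6, with g_k the generic annihilator dimensions. The crude bounds (6 - k) t - 16 would only give
  21 t - 96, compatible with Cartan's test; the unit gained at k = 5 is the contradiction.\<close>

lemma not_involutive:
  assumes surj: "\<And>n :: complex^8^6. \<exists>P. (\<forall>i j. P $ i $ j \<in> T) \<and> (\<forall>i j. P $ i $ j = P $ j $ i) \<and> (\<forall>i. \<sigma> (P $ i) = n $ i)"
    and drop: "\<And>E. subspace E \<Longrightarrow> dim E = 5 \<Longrightarrow> \<sigma> ` S_E E \<noteq> UNIV"
  shows "\<not> involutive_tableau A"
proof
  assume inv: "involutive_tableau A"
  let ?g = "\<lambda>k. int (generic_annihilator_dim A k)"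
  let ?t = "int (dim T)"
  have lower: "(6 - int k) * ?t - 16 \<le> ?g k" if k: "k \<le> 6" for k
  proof -
    have "nat ((6 - int k) * ?t - 16) \<le> generic_annihilator_dim A k"
    proof (rule generic_annihilator_dim_ge[OF k])
      fix E :: "(real^6) set" assume E: "subspace E" "dim E = k"
      have "dim (\<sigma> ` S_E E) \<le> 16" using dim_subset_UNIV[of "\<sigma> ` S_E E"] by simp
      then have "6 * dim T \<le> k * dim T + 16 + dim {a \<in> A. \<forall>v\<in>E. v v* a = 0}"
        using dim_S_E[OF E(1)] dim_annihilator[of E] E(2) by simp
      then have "int (6 * dim T) \<le> int (k * dim T + 16 + dim {a \<in> A. \<forall>v\<in>E. v v* a = 0})" by (simp only: of_nat_le_iff)
      then show "nat ((6 - int k) * ?t - 16) \<le> dim {a \<in> A. \<forall>v\<in>E. v v* a = 0}"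
        by (simp add: algebra_simps)
    qed
    then show ?thesis by linarith
  qed
  \<comment> \<open>By \<open>drop\<close> the image of the symbol on a hyperplane annihilator
    misses at least one of the 16 real dimensions.\<close>
  have lower5: "?t - 15 \<le> ?g 5"
  proof -
    have "nat (?t - 15) \<le> generic_annihilator_dim A 5"
    proof (rule generic_annihilator_dim_ge)
      fix E :: "(real^6) set" assume E: "subspace E" "dim E = 5"
      have "subspace (\<sigma> ` S_E E)" by (rule linear_subspace_image[OF \<sigma> subspace_S_E])
      then have "span (\<sigma> ` S_E E) \<noteq> UNIV" using drop[OF E] by (metis span_eq_iff)
      then have "dim (\<sigma> ` S_E E) \<noteq> DIM(complex^8)" using dim_eq_full by metis
      moreover have "dim (\<sigma> ` S_E E) \<le> 16" using dim_subset_UNIV[of "\<sigma> ` S_E E"] by simp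
      ultimately have "dim (\<sigma> ` S_E E) \<le> 15" by simp
      then have "dim T \<le> 15 + dim {a \<in> A. \<forall>v\<in>E. v v* a = 0}"
        using dim_S_E[OF E(1)] dim_annihilator[of E] E(2) by simp
      then show "nat (?t - 15) \<le> dim {a \<in> A. \<forall>v\<in>E. v v* a = 0}" by simp
    qed simp
    then show ?thesis by linarith
  qed
  have g6: "generic_annihilator_dim A 6 = 0"
  proof -
    have "{a \<in> A. \<forall>v\<in>UNIV. v v* a = 0} \<subseteq> {0}"
    proof -
      have "a = 0" if "\<forall>v. v v* a = 0" for a :: "real^'m^6"
      proof -
        have "a $ i = 0" for i
          using that[rule_format, of "axis i 1"] unfolding vector_matrix_sum
          by (simp add: axis_def if_distrib[where f = "\<lambda>c. c *\<^sub>R _"] cong: if_cong)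
        then show ?thesis by (simp add: vec_eq_iff)
      qed
      then show ?thesis by blast
    qed
    then have "dim {a \<in> A. \<forall>v\<in>UNIV. v v* a = 0} = 0"
      using dim_subset[of _ "{0 :: real^'m^6}"] by (metis (no_types, lifting) dim_singleton le_zero_eq)
    moreover have "dim {a \<in> A. \<forall>v\<in>UNIV. v v* a = 0} \<in> {dim {a \<in> A. \<forall>v\<in>E. v v* a = 0} |E. subspace E \<and> dim E = 6}"
      by (intro CollectI exI[of _ UNIV]) simp
    ultimately show ?thesis unfolding generic_annihilator_dim_def by (metis (no_types, lifting) cInf_lower bdd_below_bot le_zero_eq)
  qed
  \<comment> \<open>Truncated subtraction in \<open>cartan_character\<close> can only increase the
    difference, so the inequality goes in the direction needed.\<close>
  have s: "?g (k - 1) - ?g k \<le> int (cartan_character A k)" for k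
    by (simp add: cartan_character_def)
  have "dim (tableau_prolongation A) = (\<Sum>k = 1..6. k * cartan_character A k)"
    using inv by (simp add: involutive_tableau_def)
  also have "{1..6} = {1, 2, 3, 4, 5, 6 :: nat}" by auto
  finally have "int (dim (tableau_prolongation A)) = int (cartan_character A 1) + 2 * int (cartan_character A 2) + 3 * int (cartan_character A 3)
     + 4 * int (cartan_character A 4) + 5 * int (cartan_character A 5) + 6 * int (cartan_character A 6)" by simp
  moreover have "int (dim (tableau_prolongation A)) + 96 \<le> 21 * ?t"
    using dim_prolongation[OF surj] by linarith
  ultimately show False
    using s[of 1] s[of 2] s[of 3] s[of 4] s[of 5] s[of 6] lower[of 0] lower[of 1] lower[of 2] lower[of 3] lower[of 4] lower5 g6
    by simp
qed

end

section \<open>The tableau at a flat jet\<close>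

definition mpart :: "6 \<Rightarrow> (pt \<Rightarrow> real^6^6) \<Rightarrow> pt \<Rightarrow> real^6^6" where
  "mpart c A x = (\<chi> a b. partial c (\<lambda>y. A y $ a $ b) x)"

lemma mpart_mult:
  assumes "msmooth W A" "msmooth W B" "x \<in> W"
  shows "mpart c (\<lambda>y. A y ** B y) x = mpart c A x ** B x + A x ** mpart c B x"
proof -
  have "open W" using assms(1) by (rule msmooth_open)
  then show ?thesis
    using assms by (simp add: mpart_def msmooth_def matrix_matrix_mult_def vec_eq_iff partial_sum[of _ UNIV W] partial_mult[of UNIV W]
      smooth_fn_mult sum.distrib)
qed

lemma mpart_uminus: "msmooth W A \<Longrightarrow> x \<in> W \<Longrightarrow> mpart c (\<lambda>y. - A y) x = - mpart c A x"
  by (simp add: mpart_def msmooth_def vec_eq_iff partial_uminus[of UNIV W])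

lemma mpart_scaleR:
  "smooth_fn UNIV W r \<Longrightarrow> msmooth W B \<Longrightarrow> x \<in> W \<Longrightarrow> mpart c (\<lambda>y. r y *\<^sub>R B y) x = partial c r x *\<^sub>R B x + r x *\<^sub>R mpart c B x"
  by (simp add: mpart_def msmooth_def vec_eq_iff partial_mult[of UNIV W])

lemma mpart_const: "mpart c (\<lambda>y. A) x = 0"
  by (simp add: mpart_def vec_eq_iff partial_const)

lemma mpart_transpose: "mpart c (\<lambda>y. transpose (A y)) x = transpose (mpart c A x)"
  by (simp add: mpart_def transpose_def)

lemma mpart_cong:
  "open W \<Longrightarrow> x \<in> W \<Longrightarrow> (\<And>y. y \<in> W \<Longrightarrow> A y = B y) \<Longrightarrow> mpart c A x = mpart c B x"
  by (auto simp: mpart_def vec_eq_iff intro!: partial_cong[of UNIV W])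

definition dot2 :: "real^6^6 \<Rightarrow> real^6^6 \<Rightarrow> real" where
  "dot2 A B = (\<Sum>a\<in>UNIV. \<Sum>b\<in>UNIV. A $ a $ b * B $ a $ b)"

lemma partial_dot2:
  assumes "msmooth W A" "x \<in> W"
  shows "partial c (\<lambda>y. dot2 (A y) (A y)) x = 2 * dot2 (A x) (mpart c A x)"
proof -
  have "open W" using assms(1) by (rule msmooth_open)
  have A: "smooth_fn UNIV W (\<lambda>y. A y $ a $ b)" for a b using assms(1) by (simp add: msmooth_def)
  have "partial c (\<lambda>y. A y $ a $ b * A y $ a $ b) x = 2 * (A x $ a $ b * partial c (\<lambda>y. A y $ a $ b) x)" for a b
    using partial_mult[OF A[of a b] A[of a b], of c x] assms(2) by simp
  then show ?thesis
    using \<open>open W\<close> A assms(2)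
    by (simp add: dot2_def mpart_def partial_sum[of _ UNIV W] smooth_fn_mult smooth_fn_sum sum_distrib_left)
qed

text \<open>These are the linearizations of the closed conditions on eta in \<open>cu_fibre\<close>;
  positivity is an open condition and contributes no equation.\<close>

lemma section_1jet_eta:
  assumes s: "local_section cu_fibre W s" and x: "x \<in> W"
  defines "J \<equiv> J_of (s x)" and "H \<equiv> eta_of (s x)" and "D c \<equiv> mpart c (\<lambda>y. eta_of (s y)) x"
  shows "transpose (D c) = - D c"
    and "transpose (dJ s x c) ** H ** J + transpose J ** D c ** J + transpose J ** H ** dJ s x c = D c"
    and "dot2 H (D c) = 0"
proof -
  have W: "open W" and F: "\<And>y. y \<in> W \<Longrightarrow> s y \<in> cu_fibre" using s by (auto simp: local_section_def)
  have sm: "msmooth W (\<lambda>y. J_of (s y))" "msmooth W (\<lambda>y. eta_of (s y))" using local_section_msmooth[OF s] .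
  have dJ: "mpart c (\<lambda>y. J_of (s y)) x = dJ s x c" by (simp add: mpart_def dJ_def J_of_def)
  have H: "transpose (eta_of (s y)) = - eta_of (s y)" "transpose (J_of (s y)) ** eta_of (s y) ** J_of (s y) = eta_of (s y)"
    "dot2 (eta_of (s y)) (eta_of (s y)) = 6" if "y \<in> W" for y
    using F[OF that] by (auto simp: cu_fibre_def positive_11_def dot2_def power2_eq_square)
  have "mpart c (\<lambda>y. transpose (eta_of (s y))) x = mpart c (\<lambda>y. - eta_of (s y)) x"
    by (rule mpart_cong[OF W x]) (rule H)
  then show "transpose (D c) = - D c"
    by (simp add: mpart_transpose mpart_uminus[OF sm(2) x] D_def)
  have "mpart c (\<lambda>y. transpose (J_of (s y)) ** eta_of (s y) ** J_of (s y)) x = D c"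
    unfolding D_def by (rule mpart_cong[OF W x]) (rule H)
  then show "transpose (dJ s x c) ** H ** J + transpose J ** D c ** J + transpose J ** H ** dJ s x c = D c"
    using x sm by (simp add: mpart_mult[of W] msmooth_mult msmooth_transpose mpart_transpose dJ D_def H_def J_def mm_simps)
  have "partial c (\<lambda>y. dot2 (eta_of (s y)) (eta_of (s y))) x = partial c (\<lambda>y. 6) x"
    by (rule partial_cong[of UNIV W]) (use W x H in auto)
  then show "dot2 H (D c) = 0"
    by (simp add: partial_dot2[OF sm(2) x] partial_const H_def D_def)
qed

definition vJ :: "real^cu_index \<Rightarrow> real^6^6" where
  "vJ v = (\<chi> a b. v $ Inl (a, b))"

definition vH :: "real^cu_index \<Rightarrow> real^6^6" where
  "vH v = (\<chi> a b. v $ Inr (a, b))"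

text \<open>The tangent space of the fibre at \<open>(J0, [- J0])\<close>.\<close>

definition Tfib :: "(real^cu_index) set" where
  "Tfib = {v. vJ v ** J0 + J0 ** vJ v = 0 \<and> transpose (vH v) = - vH v \<and>
     vH v + J0 ** vH v ** J0 = transpose (vJ v) - vJ v \<and> dot2 J0 (vH v) = 0}"

lemma v_lin: "vJ (u + v) = vJ u + vJ v" "vJ (r *\<^sub>R v) = r *\<^sub>R vJ v" "vJ 0 = 0"
  "vH (u + v) = vH u + vH v" "vH (r *\<^sub>R v) = r *\<^sub>R vH v" "vH 0 = 0"
  by (simp_all add: vJ_def vH_def vec_eq_iff)

lemma dot2_lin: "dot2 A (B + C) = dot2 A B + dot2 A C" "dot2 A (r *\<^sub>R B) = r * dot2 A B" "dot2 (- A) B = - dot2 A B" "dot2 A 0 = 0"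
  by (simp_all add: dot2_def algebra_simps sum.distrib sum_distrib_left sum_negf)

lemma transpose_lin: "transpose (r *\<^sub>R A) = r *\<^sub>R transpose (A :: real^6^6)" "transpose (- A) = - transpose A" "transpose (0 :: real^6^6) = 0"
  "transpose (A - B) = transpose A - transpose (B :: real^6^6)"
  by (simp_all add: transpose_def vec_eq_iff)

lemma mm_zero: "(0 :: real^6^6) ** A = 0" "A ** (0 :: real^6^6) = 0"
  by (simp_all add: matrix_matrix_mult_def vec_eq_iff)

lemma subspace_Tfib: "subspace Tfib"
  unfolding subspace_def
proof (intro conjI allI ballI)
  show "0 \<in> Tfib" by (simp add: Tfib_def v_lin mm_zero transpose_lin dot2_lin)
  fix u assume u: "u \<in> Tfib"
  show "u + v \<in> Tfib" if v: "v \<in> Tfib" for v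
  proof -
    have "vJ u ** J0 + vJ v ** J0 + (J0 ** vJ u + J0 ** vJ v) = (vJ u ** J0 + J0 ** vJ u) + (vJ v ** J0 + J0 ** vJ v)" by simp
    then have 1: "vJ u ** J0 + vJ v ** J0 + (J0 ** vJ u + J0 ** vJ v) = 0"
      using u v by (simp only: Tfib_def mem_Collect_eq) simp
    have "vH u + vH v + (J0 ** vH u ** J0 + J0 ** vH v ** J0) = (vH u + J0 ** vH u ** J0) + (vH v + J0 ** vH v ** J0)" by simp
    then have 2: "vH u + vH v + (J0 ** vH u ** J0 + J0 ** vH v ** J0) = transpose (vJ u) + transpose (vJ v) - (vJ u + vJ v)"
      using u v unfolding Tfib_def by (smt (verit) add_diff_add mem_Collect_eq)
    show ?thesis using u v 1 2 by (simp add: Tfib_def v_lin mm_simps transpose_add dot2_lin)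
  qed
  show "c *\<^sub>R u \<in> Tfib" for c
    using u by (simp add: Tfib_def v_lin mm_simps transpose_lin dot2_lin scaleR_add_right[symmetric] scaleR_diff_right[symmetric])
qed

text \<open>
  For a variation \<open>a\<close> of the derivatives of \<open>(J, [\<eta>])\<close> at a flat jet, \<open>be\<close> gives the coefficients of
  the derivative of \<open>J\<close> in the frame \<open>ee\<close>, and \<open>nn\<close> is the resulting variation of the matrix \<open>N\<close>, up
  to a constant factor.
\<close>

definition be :: "real^cu_index^6 \<Rightarrow> 3 \<Rightarrow> 3 \<Rightarrow> 3 \<Rightarrow> complex" where
  "be a k l m = bil (dirm (\<lambda>c. vJ (a $ c)) (ee k) *v ee l) (ee m)"

definition nn :: "real^cu_index^6 \<Rightarrow> 3 \<Rightarrow> 3 \<Rightarrow> complex" where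
  "nn a m j = be a (j + 1) (j + 2) m - be a (j + 2) (j + 1) m"

text \<open>\<open>sig a = 0\<close> expresses that the symbol \<open>nn a\<close> of \<open>N\<close> is a multiple of the identity.\<close>

definition sig :: "real^cu_index^6 \<Rightarrow> complex^8" where
  "sig a = (\<chi> i. if i = 0 then nn a 1 2 else if i = 1 then nn a 1 3 else if i = 2 then nn a 2 1 else if i = 3 then nn a 2 3
     else if i = 4 then nn a 3 1 else if i = 5 then nn a 3 2 else if i = 6 then nn a 1 1 - nn a 2 2 else nn a 2 2 - nn a 3 3)"

lemma be_sum: "be a k l m = (\<Sum>c\<in>UNIV. ee k $ c * bil (cm (vJ (a $ c)) *v ee l) (ee m))"
  by (simp add: be_def dirm_mv bil_sum_left bil_simps)

lemma cm_scaleR: "cm (r *\<^sub>R A) *v v = complex_of_real r *s (cm A *v v)"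
  by (simp add: cm_def matrix_vector_mult_def vec_eq_iff sum_distrib_left mult.assoc)

lemma be_lin: "be (a + b) k l m = be a k l m + be b k l m" "be (r *\<^sub>R a) k l m = complex_of_real r * be a k l m"
  by (simp_all add: be_sum v_lin cm_add matrix_vector_mult_add_rdistrib cm_scaleR bil_simps sum.distrib algebra_simps sum_distrib_left)

lemma linear_sig: "linear sig"
  by (rule linearI; simp add: sig_def nn_def be_lin vec_eq_iff) (simp_all add: algebra_simps scaleR_conv_of_real)

interpretation tab: tableau_count Tfib sig
  by (rule tableau_count.intro[OF subspace_Tfib linear_sig])

lemma psi_be:
  assumes "\<And>c. vJ (a $ c) ** J0 + J0 ** vJ (a $ c) = 0"
  shows "psi J0 (- J0) (\<lambda>c. vJ (a $ c)) (ee k) (ee l) (ee m) = 2 * (be a k l m - be a l k m + (be a k m l - be a m k l))"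
proof -
  interpret h: hermitian_1jet J0 "- J0" "\<lambda>c. vJ (a $ c)"
    by unfold_locales (rule assms)
  have hb: "hb (- J0) w (ee m) = \<i> * bil w (ee m)" for w m
    using T01_ee[of m] by (simp add: hb_uminus) (simp add: hb_def T01_def bil_simps vs_alg)
  have "tau J0 (- J0) (\<lambda>c. vJ (a $ c)) (ee k) (ee l) (ee m) = 2 * (be a k l m - be a l k m)" for k l m
    unfolding tau_def h.nij_T01[OF T01_ee T01_ee] hb by (simp add: bil_simps be_def algebra_simps)
  then show ?thesis unfolding psi_def by (simp add: algebra_simps)
qed

text \<open>In terms of t k l m = be k l m - be l k m, which is skew in k and l, symmetrization in
  the last two indices yields precisely the off-diagonal entries of \<open>nn\<close> and the
  differences of its diagonal entries.\<close>

lemma sig_0_iff: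
  assumes "\<And>c. vJ (a $ c) ** J0 + J0 ** vJ (a $ c) = 0"
  shows "sig a = 0 \<longleftrightarrow> (\<forall>k l m. psi J0 (- J0) (\<lambda>c. vJ (a $ c)) (ee k) (ee l) (ee m) = 0)"
proof
  define t where "t k l m = be a k l m - be a l k m" for k l m
  have psi: "psi J0 (- J0) (\<lambda>c. vJ (a $ c)) (ee k) (ee l) (ee m) = 2 * (t k l m + t k m l)" for k l m
    unfolding psi_be[OF assms] t_def ..
  have nn: "nn a m 1 = t 2 3 m" "nn a m 2 = t 3 1 m" "nn a m 3 = t 1 2 m" for m
    by (simp_all add: nn_def t_def add_3)
  have sw: "t 3 2 m = - t 2 3 m" "t 1 3 m = - t 3 1 m" "t 2 1 m = - t 1 2 m" "t 1 1 m = 0" "t 2 2 m = 0" "t 3 3 m = 0" for m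
    by (simp_all add: t_def)
  show "\<forall>k l m. psi J0 (- J0) (\<lambda>c. vJ (a $ c)) (ee k) (ee l) (ee m) = 0" if "sig a = 0"
  proof -
    have "sig a $ i = 0" for i using that by simp
    from this[of 0] this[of 1] this[of 2] this[of 3] this[of 4] this[of 5] this[of 6] this[of 7]
    have e: "t 3 1 1 = 0" "t 1 2 1 = 0" "t 2 3 2 = 0" "t 1 2 2 = 0" "t 2 3 3 = 0" "t 3 1 3 = 0" "t 2 3 1 = t 3 1 2" "t 1 2 3 = t 3 1 2"
      by (simp_all add: sig_def nn)
    have "t k l m + t k m l = 0" for k l m
      using exhaust_3[of k] exhaust_3[of l] exhaust_3[of m] by (elim disjE) (simp_all add: e sw)
    then show ?thesis by (simp add: psi)
  qed
  show "sig a = 0" if "\<forall>k l m. psi J0 (- J0) (\<lambda>c. vJ (a $ c)) (ee k) (ee l) (ee m) = 0"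
  proof -
    have p: "t k l m + t k m l = 0" for k l m
    proof -
      have "2 * (t k l m + t k m l) = 0" using that psi[of k l m] by simp
      then show ?thesis by (simp only: mult_eq_0_iff) simp
    qed
    have "t 3 1 1 = 0" "t 2 1 1 = 0" "t 3 2 2 = 0" "t 1 2 2 = 0" "t 2 3 3 = 0" "t 1 3 3 = 0"
      using p[of 3 1 1] p[of 2 1 1] p[of 3 2 2] p[of 1 2 2] p[of 2 3 3] p[of 1 3 3] by simp_all
    moreover have "t 2 3 1 = t 3 1 2" using p[of 3 1 2] sw(1)[of 1] by (simp add: add_eq_0_iff)
    moreover have "t 3 1 2 = t 1 2 3" using p[of 1 2 3] sw(2)[of 2] by (simp add: add_eq_0_iff2)
    ultimately show ?thesis using sw by (simp add: sig_def nn vec_eq_iff)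
  qed
qed

section \<open>The tableau at the 1-jet of the constant structure\<close>

definition s_flat :: cu_section where "s_flat y = sec J0 (- J0)"

lemma jet_flat: "jet 1 s_flat x = (\<lambda>c. case c of Inl a \<Rightarrow> x a | Inr (L, b) \<Rightarrow> if L = [] then sec J0 (- J0) b else 0)"
proof
  have c: "partials L (\<lambda>y::pt. r) x = (if L = [] then r else 0)" if "length L \<le> 1" for L and r :: real
    using that by (cases L) (auto simp: partial_const)
  show "jet 1 s_flat x c = (case c of Inl a \<Rightarrow> x a | Inr (L, b) \<Rightarrow> if L = [] then sec J0 (- J0) b else 0)" for c
    using c by (auto simp: jet_def s_flat_def split: sum.splits prod.splits)
qed

definition jDH :: "(6, cu_index) jet \<Rightarrow> 6 \<Rightarrow> real^6^6" where
  "jDH j c = (\<chi> a b. j (Inr ([c], Inr (a, b))))"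

lemma jDH_jet: "jDH (jet 1 s y) c = mpart c (\<lambda>y. eta_of (s y)) y"
  by (simp add: jDH_def mpart_def jet_def eta_of_def)

definition mlim :: "(real \<Rightarrow> real^6^6) \<Rightarrow> real^6^6 \<Rightarrow> bool" where
  "mlim A L \<longleftrightarrow> (\<forall>a b. ((\<lambda>t. A t $ a $ b) \<longlongrightarrow> L $ a $ b) (at 0))"

lemma mlim_mult: "mlim A L \<Longrightarrow> mlim B M \<Longrightarrow> mlim (\<lambda>t. A t ** B t) (L ** M)"
  and mlim_add: "mlim A L \<Longrightarrow> mlim B M \<Longrightarrow> mlim (\<lambda>t. A t + B t) (L + M)"
  and mlim_uminus: "mlim A L \<Longrightarrow> mlim (\<lambda>t. - A t) (- L)"
  and mlim_transpose: "mlim A L \<Longrightarrow> mlim (\<lambda>t. transpose (A t)) (transpose L)"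
  and mlim_dot2: "mlim A L \<Longrightarrow> mlim B M \<Longrightarrow> ((\<lambda>t. dot2 (A t) (B t)) \<longlongrightarrow> dot2 L M) (at 0)"
  by (auto simp: mlim_def matrix_matrix_mult_def transpose_def dot2_def intro!: tendsto_sum tendsto_mult tendsto_add tendsto_minus)

lemma mlim_psi:
  assumes "mlim J L" "mlim H M" "\<And>c. mlim (\<lambda>t. D t c) (E c)"
  shows "((\<lambda>t. psi (J t) (H t) (D t) u v w) \<longlongrightarrow> psi L M E u v w) (at 0)"
  unfolding psi_def tau_tri tri1_expand tri2_expand
  using assms unfolding mlim_def by (intro tendsto_add tendsto_diff tendsto_sum tendsto_mult tendsto_const tendsto_of_real) auto

lemma mlim_eq:
  assumes "mlim A L" "mlim B M" "\<forall>\<^sub>F t in at 0. A t = B t"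
  shows "L = M"
proof -
  have "L $ a $ b = M $ a $ b" for a b
  proof (rule tendsto_unique[OF at_neq_bot])
    show "((\<lambda>t. A t $ a $ b) \<longlongrightarrow> L $ a $ b) (at 0)" using assms(1) by (simp add: mlim_def)
    have "((\<lambda>t. B t $ a $ b) \<longlongrightarrow> M $ a $ b) (at 0)" using assms(2) by (simp add: mlim_def)
    then show "((\<lambda>t. A t $ a $ b) \<longlongrightarrow> M $ a $ b) (at 0)"
      by (rule Lim_transform_eventually) (use assms(3) in \<open>auto elim!: eventually_mono\<close>)
  qed
  then show ?thesis by (simp add: vec_eq_iff)
qed

lemma psi_scaleR: "psi J H (\<lambda>c. r *\<^sub>R D c) u v w = complex_of_real r * psi J H D u v w"
  unfolding psi_def tau_tri tri1_expand tri2_expand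
  by (simp add: sum_distrib_left algebra_simps)

text \<open>At the flat jet the derivative coordinates vanish, so along a curve their quotients by t
  converge to the tangent vector. The relations satisfied on the system are linear in these
  coordinates; they survive division by t and pass to the limit.\<close>

lemma tableau_flat_subset:
  "tableau (quasi_integrability_system D) (jet 1 s_flat x) \<subseteq> tab.A"
proof
  fix a assume "a \<in> tableau (quasi_integrability_system D) (jet 1 s_flat x)"
  then obtain \<gamma> \<epsilon> where \<epsilon>: "\<epsilon> > 0" and \<gamma>: "\<And>t. \<bar>t\<bar> < \<epsilon> \<Longrightarrow> \<gamma> t \<in> quasi_integrability_system D"
    and \<gamma>0: "\<gamma> 0 = jet 1 s_flat x" and d: "\<And>i. ((\<lambda>t. \<gamma> t i) has_real_derivative vertical_vector a i) (at 0)"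
    unfolding tableau_def tangent_space_def by blast
  have ct: "((\<lambda>t. \<gamma> t i) \<longlongrightarrow> \<gamma> 0 i) (at 0)" for i
    using DERIV_isCont[OF d] by (simp add: isCont_def)
  have dt: "((\<lambda>t. (1 / t) * \<gamma> t (Inr ([c], b))) \<longlongrightarrow> a $ c $ b) (at 0)" for c b
    using d[of "Inr ([c], b)"] unfolding DERIV_def \<gamma>0 jet_flat by (simp add: vertical_vector_def)
  have J: "mlim (\<lambda>t. jJ (\<gamma> t)) J0" "mlim (\<lambda>t. jH (\<gamma> t)) (- J0)"
    using ct[of "Inr ([], Inl (_, _))"] ct[of "Inr ([], Inr (_, _))"] unfolding \<gamma>0 jet_flat by (simp_all add: mlim_def jJ_def jH_def sec_def)
  have DD: "mlim (\<lambda>t. (1 / t) *\<^sub>R jD (\<gamma> t) c) (vJ (a $ c))" "mlim (\<lambda>t. (1 / t) *\<^sub>R jDH (\<gamma> t) c) (vH (a $ c))" for c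
    using dt by (simp_all add: mlim_def jD_def jDH_def vJ_def vH_def)
  have q: "jD q c ** jJ q + jJ q ** jD q c = 0 \<and> transpose (jDH q c) = - jDH q c \<and>
     transpose (jD q c) ** jH q ** jJ q + transpose (jJ q) ** jDH q c ** jJ q + transpose (jJ q) ** jH q ** jD q c = jDH q c \<and>
     dot2 (jH q) (jDH q c) = 0 \<and> psi (jJ q) (jH q) (jD q) u v w = 0"
    if qQ: "q \<in> quasi_integrability_system D" for q c u v w
  proof -
    obtain s x W where q: "q = jet 1 s x" "x \<in> W" "local_section cu_fibre W s"
      using qQ unfolding quasi_integrability_system_def by blast
    interpret hermitian_1jet "J_of (s x)" "eta_of (s x)" "dJ s x" by (rule section_hermitian_1jet[OF q(3,2)])
    show ?thesis
      using DJ[of c] section_1jet_eta[OF q(3,2), of c] psi_jet_system[OF qQ, of u v w]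
      unfolding q(1) jDH_jet j_jet by simp
  qed
  have ev: "\<forall>\<^sub>F t in at 0. t \<noteq> 0 \<and> \<gamma> t \<in> quasi_integrability_system D"
    unfolding eventually_at using \<epsilon> \<gamma> by (intro exI[of _ \<epsilon>]) auto
  have z: "mlim (\<lambda>t. 0) 0" by (simp add: mlim_def)
  have 1: "vJ (a $ c) ** J0 + J0 ** vJ (a $ c) = 0" for c
    by (rule mlim_eq[OF mlim_add[OF mlim_mult[OF DD(1) J(1)] mlim_mult[OF J(1) DD(1)]] z])
      (rule eventually_mono[OF ev], use q in \<open>simp add: mm_simps scaleR_add_right[symmetric]\<close>)
  have 2: "transpose (vH (a $ c)) = - vH (a $ c)" for c
    by (rule mlim_eq[OF mlim_transpose[OF DD(2)] mlim_uminus[OF DD(2)]])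
      (rule eventually_mono[OF ev], use q in \<open>simp add: transpose_lin\<close>)
  have 3: "transpose (vJ (a $ c)) ** (- J0) ** J0 + transpose J0 ** vH (a $ c) ** J0 + transpose J0 ** (- J0) ** vJ (a $ c) = vH (a $ c)" for c
  proof (rule mlim_eq)
    show "mlim (\<lambda>t. transpose ((1 / t) *\<^sub>R jD (\<gamma> t) c) ** jH (\<gamma> t) ** jJ (\<gamma> t) + transpose (jJ (\<gamma> t)) ** ((1 / t) *\<^sub>R jDH (\<gamma> t) c) ** jJ (\<gamma> t)
        + transpose (jJ (\<gamma> t)) ** jH (\<gamma> t) ** ((1 / t) *\<^sub>R jD (\<gamma> t) c))
       (transpose (vJ (a $ c)) ** (- J0) ** J0 + transpose J0 ** vH (a $ c) ** J0 + transpose J0 ** (- J0) ** vJ (a $ c))"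
      by (intro mlim_add mlim_mult mlim_transpose J DD)
    show "mlim (\<lambda>t. (1 / t) *\<^sub>R jDH (\<gamma> t) c) (vH (a $ c))" by (rule DD)
    show "\<forall>\<^sub>F t in at 0. transpose ((1 / t) *\<^sub>R jD (\<gamma> t) c) ** jH (\<gamma> t) ** jJ (\<gamma> t) + transpose (jJ (\<gamma> t)) ** ((1 / t) *\<^sub>R jDH (\<gamma> t) c) ** jJ (\<gamma> t)
        + transpose (jJ (\<gamma> t)) ** jH (\<gamma> t) ** ((1 / t) *\<^sub>R jD (\<gamma> t) c) = (1 / t) *\<^sub>R jDH (\<gamma> t) c"
      by (rule eventually_mono[OF ev]) (use q in \<open>simp add: transpose_lin mm_simps scaleR_add_right[symmetric]\<close>)
  qed
  have 4: "dot2 (- J0) (vH (a $ c)) = 0" for c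
  proof (rule tendsto_unique[OF at_neq_bot mlim_dot2[OF J(2) DD(2)]])
    show "((\<lambda>t. dot2 (jH (\<gamma> t)) ((1 / t) *\<^sub>R jDH (\<gamma> t) c)) \<longlongrightarrow> 0) (at 0)"
      by (rule tendsto_eventually) (rule eventually_mono[OF ev], use q in \<open>simp add: dot2_lin\<close>)
  qed
  have 5: "psi J0 (- J0) (\<lambda>c. vJ (a $ c)) u v w = 0" for u v w
  proof (rule tendsto_unique[OF at_neq_bot mlim_psi[OF J DD(1)]])
    show "((\<lambda>t. psi (jJ (\<gamma> t)) (jH (\<gamma> t)) (\<lambda>c. (1 / t) *\<^sub>R jD (\<gamma> t) c) u v w) \<longlongrightarrow> 0) (at 0)"
      by (rule tendsto_eventually) (rule eventually_mono[OF ev], use q in \<open>simp add: psi_scaleR\<close>)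
  qed
  have "a $ c \<in> Tfib" for c
  proof -
    have "transpose (vJ (a $ c)) ** (- J0) ** J0 = transpose (vJ (a $ c))"
      by (simp add: matrix_mul_assoc[symmetric] mm_simps J0_J0)
    then have "vH (a $ c) + J0 ** vH (a $ c) ** J0 = transpose (vJ (a $ c)) - vJ (a $ c)"
      using 3[of c] by (simp add: J0_skew mm_simps J0_J0 algebra_simps)
    then show ?thesis using 1 2 4[of c] by (simp add: Tfib_def dot2_lin)
  qed
  moreover have "sig a = 0" using sig_0_iff[of a] 1 5 by blast
  ultimately show "a \<in> tab.A" by (simp add: tab.A_def)
qed

lemma positive_11_conjugate:
  assumes d: "det g \<noteq> 0"
  defines "h \<equiv> matrix_inv g"
  shows "(g ** J0 ** h) ** (g ** J0 ** h) = - mat 1"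
    and "positive_11 (g ** J0 ** h) (transpose h ** (- J0) ** h)"
proof -
  have inv: "h ** g = mat 1" "g ** h = mat 1" using matrix_inv_det[OF d] by (simp_all add: h_def)
  have inv': "h ** (g ** C) = C" "g ** (h ** C) = C" for C :: "real^6^6" by (simp_all add: matrix_mul_assoc inv)
  have tinv: "transpose g ** (transpose h ** C) = C" for C :: "real^6^6"
    using arg_cong[OF inv(1), of transpose] by (simp add: matrix_mul_assoc matrix_transpose_mul)
  have J0': "J0 ** (J0 ** C) = - C" for C :: "real^6^6" by (simp add: matrix_mul_assoc J0_J0 mm_simps)
  show "(g ** J0 ** h) ** (g ** J0 ** h) = - mat 1"
    by (simp add: matrix_mul_assoc[symmetric] inv' J0' mm_simps inv)
  show "positive_11 (g ** J0 ** h) (transpose h ** (- J0) ** h)"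
    unfolding positive_11_def
  proof (intro conjI allI impI)
    show "transpose (transpose h ** (- J0) ** h) = - (transpose h ** (- J0) ** h)"
      by (simp add: matrix_transpose_mul transpose_lin J0_skew mm_simps matrix_mul_assoc)
    show "transpose (g ** J0 ** h) ** (transpose h ** (- J0) ** h) ** (g ** J0 ** h) = transpose h ** (- J0) ** h"
      by (simp add: matrix_transpose_mul matrix_mul_assoc[symmetric] tinv inv' J0' J0_skew mm_simps)
    fix v :: "real^6" assume v: "v \<noteq> 0"
    have "h *v v \<noteq> 0"
    proof
      assume "h *v v = 0"
      then have "g *v (h *v v) = 0" by simp
      then show False using v by (simp add: matrix_vector_mul_assoc inv)
    qed
    moreover have "(transpose h ** (- J0) ** h) ** (g ** J0 ** h) = transpose h ** h"
      by (simp add: matrix_mul_assoc[symmetric] inv' J0' mm_simps)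
    then have "(transpose h ** (- J0) ** h) *v ((g ** J0 ** h) *v v) = transpose h *v (h *v v)"
      by (simp only: matrix_vector_mul_assoc)
    then have "v \<bullet> ((transpose h ** (- J0) ** h) *v ((g ** J0 ** h) *v v)) = (h *v v) \<bullet> (h *v v)"
      by (simp only: dot_lmul_matrix[symmetric] vector_transpose_matrix)
    ultimately show "v \<bullet> ((transpose h ** (- J0) ** h) *v ((g ** J0 ** h) *v v)) > 0" by simp
  qed
qed

lemma positive_11_scaleR: "r > 0 \<Longrightarrow> positive_11 J H \<Longrightarrow> positive_11 J (r *\<^sub>R H)"
  unfolding positive_11_def by (auto simp: transpose_lin mm_simps scaleR_matrix_vector_assoc[symmetric])

lemma dot2_J0: "dot2 (- J0) (- J0) = 6"
  by (simp add: dot2_def J0_def sum_6)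

text \<open>The standard structure is transported by a family of linear maps g, affine in the base
  point with value 1 at \<open>x\<close>. The derivatives X of g are chosen so that the resulting
  structure has the prescribed first derivatives, and \<open>sig a = 0\<close> makes it
  quasi-integrable at \<open>x\<close>.\<close>

lemma flat_plus_vertical:
  assumes D: "open D" and x: "x \<in> D" and a: "a \<in> tab.A"
  shows "(\<lambda>c. jet 1 s_flat x c + vertical_vector a c) \<in> quasi_integrability_system D"
proof -
  have aT: "vJ (a $ c) ** J0 + J0 ** vJ (a $ c) = 0" "transpose (vH (a $ c)) = - vH (a $ c)"
    "vH (a $ c) + J0 ** vH (a $ c) ** J0 = transpose (vJ (a $ c)) - vJ (a $ c)" "dot2 J0 (vH (a $ c)) = 0" for c
  proof -
    have "a $ c \<in> Tfib" using a unfolding tab.A_def by blast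
    then show "vJ (a $ c) ** J0 + J0 ** vJ (a $ c) = 0" "transpose (vH (a $ c)) = - vH (a $ c)"
      "vH (a $ c) + J0 ** vH (a $ c) ** J0 = transpose (vJ (a $ c)) - vJ (a $ c)" "dot2 J0 (vH (a $ c)) = 0"
      by (auto simp: Tfib_def)
  qed
  \<comment> \<open>X solves X J0 - J0 X = vJ and X^T J0 + J0 X = vH, the infinitesimal action of
    the linear group on the pair. The first summand solves the equation for J; the second commutes
    with \<open>J0\<close> and adjusts the other one.\<close>
  define X where "X c = (- 1/2) *\<^sub>R (vJ (a $ c) ** J0) - (1/4) *\<^sub>R (J0 ** vH (a $ c) + vH (a $ c) ** J0)" for c
  have J0': "J0 ** (J0 ** C) = - C" for C :: "real^6^6" by (simp add: matrix_mul_assoc J0_J0 mm_simps)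
  have A': "vJ (a $ c) ** J0 = - (J0 ** vJ (a $ c))" for c using aT(1)[of c] by (simp add: eq_neg_iff_add_eq_0)
  have XJ: "X c ** J0 - J0 ** X c = vJ (a $ c)" for c
    unfolding X_def by (simp add: mm_simps matrix_mul_assoc[symmetric] J0_J0 J0' A' scaleR_add_left[symmetric])
  have XH: "transpose (X c) ** J0 + J0 ** X c = vH (a $ c)" for c
  proof -
    have "J0 ** (vH (a $ c) + J0 ** vH (a $ c) ** J0) ** J0 = J0 ** (transpose (vJ (a $ c)) - vJ (a $ c)) ** J0"
      by (simp only: aT(3))
    then have e: "J0 ** (transpose (vJ (a $ c)) ** J0) = J0 ** (vH (a $ c) ** J0) + vH (a $ c) + J0 ** (vJ (a $ c) ** J0)"
      by (simp add: mm_simps matrix_mul_assoc[symmetric] J0_J0 J0' algebra_simps)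
    have "transpose (X c) = (1/2) *\<^sub>R (J0 ** transpose (vJ (a $ c))) - (1/4) *\<^sub>R (vH (a $ c) ** J0 + J0 ** vH (a $ c))"
      unfolding X_def by (simp add: transpose_lin transpose_add matrix_transpose_mul aT(2) J0_skew mm_simps)
    then show ?thesis
      by (simp add: X_def mm_simps matrix_mul_assoc[symmetric] J0_J0 J0' e scaleR_add_right scaleR_diff_right)
  qed
  define g where "g y = mat 1 + (\<Sum>c\<in>UNIV. (y c - x c) *\<^sub>R X c)" for y :: pt
  have gD: "msmooth D g"
    unfolding msmooth_def g_def using D
    by (auto intro!: smooth_fn_add smooth_fn_const smooth_fn_sum smooth_fn_mult smooth_fn_diff smooth_fn_coordinate)
  define W where "W = {y \<in> D. det (g y) \<noteq> 0}"
  have W: "open W" "W \<subseteq> D" unfolding W_def using det_open[OF gD] by auto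
  have gx: "g x = mat 1" by (simp add: g_def)
  have xW: "x \<in> W" by (simp add: W_def x gx)
  have g: "msmooth W g" by (rule msmooth_subset[OF gD W])
  have dg: "mpart c g x = X c" for c
  proof -
    have "((\<lambda>t. g (x(c := t)) $ i $ j) has_real_derivative X c $ i $ j) (at (x c))" for i j
    proof -
      have "(\<Sum>d\<in>UNIV. ((x(c := t)) d - x d) * X d $ i $ j) = (\<Sum>d\<in>UNIV. if d = c then (t - x c) * X c $ i $ j else 0)" for t
        by (rule sum.cong) auto
      then have "g (x(c := t)) $ i $ j = mat 1 $ i $ j + (t - x c) * X c $ i $ j" for t
        by (simp add: g_def)
      then show ?thesis by (auto intro!: derivative_eq_intros)
    qed
    then show ?thesis by (simp add: mpart_def partial_def vec_eq_iff DERIV_imp_deriv)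
  qed
  define h where "h y = matrix_inv (g y)" for y
  have h: "msmooth W h" unfolding h_def by (rule msmooth_matrix_inv[OF g]) (simp add: W_def)
  have inv: "h y ** g y = mat 1" "g y ** h y = mat 1" if "y \<in> W" for y
    using matrix_inv_det[of "g y"] that by (simp_all add: h_def W_def)
  have hx: "h x = mat 1" using inv[OF xW] by (simp add: gx)
  define J where "J y = g y ** J0 ** h y" for y
  define K where "K y = transpose (h y) ** (- J0) ** h y" for y
  have J: "msmooth W J" and K: "msmooth W K"
    unfolding J_def K_def using W(1) by (intro msmooth_mult msmooth_transpose msmooth_const g h; simp)+
  have Jx: "J x = J0" "K x = - J0" by (simp_all add: J_def K_def gx hx)
  have JJ: "J y ** J y = - mat 1" "positive_11 (J y) (K y)" if "y \<in> W" for y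
    using positive_11_conjugate[of "g y"] that by (simp_all add: J_def K_def h_def W_def)
  define N where "N y = dot2 (K y) (K y)" for y
  have N: "N y > 0" if y: "y \<in> W" for y
  proof -
    obtain \<mu> where "(\<Sum>a\<in>UNIV. \<Sum>b\<in>UNIV. ((\<mu> *\<^sub>R K y) $ a $ b)\<^sup>2) = 6"
      using ray_has_unique_normalized_representative[OF JJ(2)[OF y]] by blast
    then have "\<mu>\<^sup>2 * N y = 6" by (simp add: N_def dot2_def sum_distrib_left power2_eq_square algebra_simps)
    then have "0 < \<mu>\<^sup>2 * N y" by simp
    then show ?thesis by (simp add: zero_less_mult_iff not_less[symmetric])
  qed
  have Ns: "smooth_fn UNIV W N"
    unfolding N_def dot2_def using K W(1) by (auto simp: msmooth_def intro!: smooth_fn_sum smooth_fn_mult)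
  define \<mu> where "\<mu> y = sqrt (6 / N y)" for y
  have \<mu>: "smooth_fn UNIV W \<mu>"
    unfolding \<mu>_def using N W(1) by (intro smooth_fn_sqrt smooth_fn_divide smooth_fn_const Ns) (auto simp: less_imp_neq[symmetric] dest: N)
  have \<mu>N: "\<mu> y * \<mu> y * N y = 6" "\<mu> y > 0" if "y \<in> W" for y
    using N[OF that] by (simp_all add: \<mu>_def)
  have Nx: "N x = 6" by (simp add: N_def Jx dot2_J0)
  have \<mu>x: "\<mu> x = 1" by (simp add: \<mu>_def Nx)
  define s where "s y = sec (J y) (\<mu> y *\<^sub>R K y)" for y
  have s: "local_section cu_fibre W s"
    unfolding local_section_def
  proof (intro conjI ballI)
    show "open W" by (rule W)
    show "smooth_map UNIV W s" unfolding s_def by (intro smooth_map_sec J msmooth_scaleR \<mu> K)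
    fix y assume y: "y \<in> W"
    have "(\<Sum>a\<in>UNIV. \<Sum>b\<in>UNIV. ((\<mu> y *\<^sub>R K y) $ a $ b)\<^sup>2) = \<mu> y * \<mu> y * N y"
      by (simp add: N_def dot2_def sum_distrib_left power2_eq_square algebra_simps)
    then show "s y \<in> cu_fibre"
      using JJ[OF y] \<mu>N[OF y] positive_11_scaleR by (simp add: s_def cu_fibre_def almost_complex_def)
  qed
  have dJ: "mpart c J x = vJ (a $ c)" for c
  proof -
    have "mpart c (\<lambda>y. J y ** g y) x = mpart c (\<lambda>y. g y ** J0) x"
      by (rule mpart_cong[OF W(1) xW]) (simp add: J_def matrix_mul_assoc[symmetric] inv)
    then have "mpart c J x + J0 ** X c = X c ** J0"
      using W(1) by (simp add: mpart_mult[OF J g xW] mpart_mult[OF g _ xW] msmooth_const mpart_const dg gx Jx mm_zero)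
    then show ?thesis using XJ[of c] by (simp add: algebra_simps)
  qed
  have dK: "mpart c K x = vH (a $ c)" for c
  proof -
    have "mpart c (\<lambda>y. transpose (g y) ** (K y ** g y)) x = mpart c (\<lambda>y. - J0) x"
    proof (rule mpart_cong[OF W(1) xW])
      fix y assume y: "y \<in> W"
      have "transpose (g y) ** (transpose (h y) ** C) = C" for C
        using arg_cong[OF inv(1)[OF y], of transpose] by (simp add: matrix_mul_assoc matrix_transpose_mul)
      then show "transpose (g y) ** (K y ** g y) = - J0"
        by (simp add: K_def matrix_mul_assoc[symmetric] inv[OF y])
    qed
    then have "transpose (X c) ** (- J0) + (mpart c K x + (- J0) ** X c) = 0"
      by (simp add: mpart_mult[OF msmooth_transpose[OF g] msmooth_mult[OF K g] xW] mpart_mult[OF K g xW] mpart_transpose mpart_const dg gx Jx)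
    then have "mpart c K x = transpose (X c) ** J0 + J0 ** X c" by (simp add: mm_simps algebra_simps)
    then show ?thesis by (simp add: XH)
  qed
  \<comment> \<open>The rescaling to the normalized representative has no first-order effect at
    \<open>x\<close>, because \<open>vH (a $ c)\<close> is orthogonal to \<open>J0\<close> for the
    pairing \<open>dot2\<close>.\<close>
  have d\<mu>: "partial c \<mu> x = 0" for c
  proof -
    have "partial c N x = 0"
      unfolding N_def partial_dot2[OF K xW] dK Jx by (simp add: dot2_lin aT(4))
    moreover have "partial c (\<lambda>y. \<mu> y * \<mu> y * N y) x = partial c (\<lambda>y. 6) x"
      by (rule partial_cong[of UNIV W]) (use W(1) xW \<mu>N(1) in auto)
    ultimately show ?thesis
      using xW by (simp add: partial_mult[OF smooth_fn_mult[OF \<mu> \<mu>] Ns] partial_mult[OF \<mu> \<mu>] partial_const \<mu>x Nx)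
  qed
  have dH: "mpart c (\<lambda>y. \<mu> y *\<^sub>R K y) x = vH (a $ c)" for c
    by (simp add: mpart_scaleR[OF \<mu> K xW] d\<mu> \<mu>x dK)
  have p: "partial c (\<lambda>y. s y b) x = a $ c $ b" for c b
  proof (cases b)
    case (Inl q)
    then show ?thesis
      using arg_cong[OF dJ[of c], of "\<lambda>A. A $ fst q $ snd q"] by (simp add: mpart_def vJ_def s_def sec_def case_prod_unfold)
  next
    case (Inr q)
    then show ?thesis
      using arg_cong[OF dH[of c], of "\<lambda>A. A $ fst q $ snd q"] by (simp add: mpart_def vH_def s_def sec_def case_prod_unfold)
  qed
  have "dJ s x = (\<lambda>c. vJ (a $ c))" by (simp add: dJ_def p vJ_def fun_eq_iff)
  moreover have sx: "s x = sec J0 (- J0)" by (simp add: s_def Jx \<mu>x)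
  moreover have "\<forall>k l m. psi J0 (- J0) (\<lambda>c. vJ (a $ c)) (ee k) (ee l) (ee m) = 0"
    using sig_0_iff[of a] aT(1) a by (simp add: tab.A_def)
  moreover have "\<exists>c. v = (\<Sum>k\<in>UNIV. c k *s ee k)" if "T01 J0 v" for v
    using T01_J0_span[OF that] by - (rule exI, assumption)
  ultimately have "quasi_integrable_at s W x"
    by (intro quasi_integrable_atI[OF s xW]) (simp, rule psi_T01_span[of J0 ee], auto)
  then have "jet 1 s x \<in> quasi_integrability_system D"
    by (rule jet_in_system[OF W(2) xW s])
  moreover have "jet 1 s x = (\<lambda>c. jet 1 s_flat x c + vertical_vector a c)"
  proof
    fix c
    show "jet 1 s x c = jet 1 s_flat x c + vertical_vector a c"
    proof (cases c)
      case (Inl i)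
      then show ?thesis by (simp add: jet_def vertical_vector_def)
    next
      case (Inr q)
      then obtain L b where c: "c = Inr (L, b)" by (cases q) auto
      show ?thesis
        unfolding jet_flat c by (cases L) (auto simp: jet_def vertical_vector_def p sx split: list.split)
    qed
  qed
  ultimately show ?thesis by (simp only:)
qed

lemma vertical_vector_scaleR: "vertical_vector (t *\<^sub>R a) c = t * vertical_vector a c"
  by (simp add: vertical_vector_def split: sum.split list.split prod.split)

lemma tableau_flat:
  assumes D: "open D" and x: "x \<in> D"
  shows "tableau (quasi_integrability_system D) (jet 1 s_flat x) = tab.A"
proof
  show "tab.A \<subseteq> tableau (quasi_integrability_system D) (jet 1 s_flat x)"
  proof
    fix a assume a: "a \<in> tab.A"
    \<comment> \<open>\<open>flat_plus_vertical\<close> places a whole linear space of derivatives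
      inside the system, so a straight line serves as the curve.\<close>
    define \<gamma> where "\<gamma> t = (\<lambda>c. jet 1 s_flat x c + vertical_vector (t *\<^sub>R a) c)" for t
    note v = vertical_vector_scaleR
    have "t *\<^sub>R a \<in> tab.A" for t
      using a linear_sig subspace_Tfib by (auto simp: tab.A_def subspace_scale linear_scale)
    then have "\<gamma> t \<in> quasi_integrability_system D" for t
      unfolding \<gamma>_def by (rule flat_plus_vertical[OF D x])
    moreover have "\<gamma> 0 = jet 1 s_flat x" unfolding \<gamma>_def v by simp
    moreover have "((\<lambda>t. \<gamma> t i) has_real_derivative vertical_vector a i) (at 0)" for i
      unfolding \<gamma>_def v by (auto intro!: derivative_eq_intros)
    ultimately show "a \<in> tableau (quasi_integrability_system D) (jet 1 s_flat x)"
      unfolding tableau_def tangent_space_def by (intro CollectI exI[of _ \<gamma>] exI[of _ 1]) simp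
  qed
qed (rule tableau_flat_subset)

lemma flat_in_system:
  assumes D: "open D" and x: "x \<in> D"
  shows "jet 1 s_flat x \<in> quasi_integrability_system D"
proof -
  have "0 \<in> tab.A" using linear_sig subspace_Tfib by (simp add: tab.A_def subspace_0 linear_0)
  then show ?thesis
    using flat_plus_vertical[OF D x, of 0] vertical_vector_scaleR[of 0 "0 :: real^cu_index^6"] by simp
qed

section \<open>Surjectivity of the prolonged symbol, and its rank drop on hyperplanes\<close>

lemma exhaust_8: "(i::8) = 0 \<or> i = 1 \<or> i = 2 \<or> i = 3 \<or> i = 4 \<or> i = 5 \<or> i = 6 \<or> i = 7"
proof (induction i)
  case (of_int z)
  then have "z \<in> {0, 1, 2, 3, 4, 5, 6, 7}" by auto
  then show ?case by auto
qed

text \<open>Completes a variation A of J to a tangent vector of the fibre. The eta-part must satisfy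
  C + J0 C J0 = A^T - A; half the right-hand side works because J0 A J0 = A for A anticommuting with
  \<open>J0\<close>.\<close>

definition fibre_vector :: "real^6^6 \<Rightarrow> real^cu_index" where
  "fibre_vector A = (\<chi> i. case i of Inl (a, b) \<Rightarrow> A $ a $ b | Inr (a, b) \<Rightarrow> (A $ b $ a - A $ a $ b) / 2)"

lemma fibre_vector_J: "vJ (fibre_vector A) = A"
  and fibre_vector_H: "vH (fibre_vector A) = (1/2) *\<^sub>R (transpose A - A)"
  by (simp_all add: vJ_def vH_def fibre_vector_def transpose_def vec_eq_iff)

lemma fibre_vector_Tfib:
  assumes A: "J0 ** A = - (A ** J0)"
  shows "fibre_vector A \<in> Tfib"
proof -
  have A1: "J0 ** A ** J0 = A"
    using A by (simp add: matrix_mul_assoc[symmetric] J0_J0 mm_simps)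
  have A2: "J0 ** transpose A ** J0 = transpose A"
    using arg_cong[OF A1, of transpose] by (simp add: matrix_transpose_mul J0_skew mm_simps matrix_mul_assoc)
  have tt: "transpose (transpose A - A) = - (transpose A - A)" by (simp add: transpose_lin)
  have d: "dot2 J0 C = 0" if C: "J0 ** C ** J0 = C" for C
  proof -
    have "C $ 1 $ 0 = C $ 0 $ 1" "C $ 3 $ 2 = C $ 2 $ 3" "C $ 5 $ 4 = C $ 4 $ 5"
      using arg_cong[OF C, of "\<lambda>A. A $ 1 $ 0"] arg_cong[OF C, of "\<lambda>A. A $ 3 $ 2"] arg_cong[OF C, of "\<lambda>A. A $ 5 $ 4"]
      by (simp_all add: matrix_matrix_mult_def sum_6 J0_def)
    then show ?thesis by (simp add: dot2_def J0_def sum_6)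
  qed
  have "dot2 J0 (transpose A - A) = 0"
    by (rule d) (simp add: mm_simps A1 A2)
  moreover have "A ** J0 + J0 ** A = 0" by (simp add: A)
  ultimately show ?thesis
    by (simp add: Tfib_def fibre_vector_J fibre_vector_H transpose_lin(1) tt dot2_lin mm_simps A1 A2)
      (simp add: vec_eq_iff diff_divide_distrib)
qed

lemma bil_sum_right: "bil w (\<Sum>k\<in>K. f k) = (\<Sum>k\<in>K. bil w (f k))"
  by (simp add: bil_commute[of w] bil_sum_left)

lemma covector_decomp:
  "F $ d = (\<Sum>p\<in>UNIV. bil (vcnj (ee p)) F * (2 * ee p $ d)) + (\<Sum>p\<in>UNIV. bil (ee p) F * (2 * cnj (ee p $ d)))"
  using exhaust_6[of d]
  by (elim disjE) (simp_all add: sum_3 bil_def sum_6 ee_def vcnj_def rxy field_simps)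

text \<open>
  The second derivatives \<open>\<beta>\<close> solve the equation for the part of \<open>F m j\<close> in the span of the
  \<open>dz\<^sub>p\<close> directly.  For the part in the span of the \<open>d(z\<^sub>p-bar)\<close>, the solution requires
  \<open>\<Sum>\<^sub>j F m j (\<partial>/\<partial>(z\<^sub>j-bar)) = 0\<close>, which is achieved by the choice of \<open>lam\<close>.
\<close>

lemma second_derivatives_exist:
  fixes F :: "3 \<Rightarrow> 3 \<Rightarrow> complex^6"
  shows "\<exists>\<beta> lam. (\<forall>m l c d. \<beta> m l c d = \<beta> m l d c) \<and>
    (\<forall>m j d. (\<Sum>c\<in>UNIV. ee (j + 1) $ c * \<beta> m (j + 2) c d) - (\<Sum>c\<in>UNIV. ee (j + 2) $ c * \<beta> m (j + 1) c d)
       = F m j $ d + (if m = j then lam d else 0))"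
proof -
  define q where "q p = 2 *s ee p" for p
  define r where "r p = 2 *s vcnj (ee p)" for p
  define h where "h m j p = bil (vcnj (ee p)) (F m j)" for m j p
  define l0 where "l0 m = - (\<Sum>j\<in>UNIV. bil (ee j) (F m j))" for m
  define v where "v m j p = bil (ee p) (F m j) + (if m = j then l0 p else 0)" for m j p
  define V where "V m j = (\<Sum>p\<in>UNIV. v m j p *s r p)" for m j
  \<comment> \<open>The first sum reproduces the \<open>q\<close>-part of F and contributes nothing
    else. In the second, the curl yields two copies of \<open>V m j\<close> directly and assembles a
    third one from the trace condition \<open>tr\<close>, whence the factor 1/3. Each bracket is
    symmetric in the two covectors, which makes \<open>\<beta>\<close> symmetric.\<close>
  define b where "b m l d = (\<Sum>p\<in>UNIV. h m (l + 1) p *s (r (l + 2) $ d *s q p + q p $ d *s r (l + 2)))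
      - (1/3) *s (V m (l + 2) $ d *s r (l + 1) + r (l + 1) $ d *s V m (l + 2)
        - V m (l + 1) $ d *s r (l + 2) - r (l + 2) $ d *s V m (l + 1))" for m l d
  have br: "bil (ee k) (r p) = (if k = p then 1 else 0)" and bq: "bil (ee k) (q p) = 0" for k p
    by (simp_all add: r_def q_def bil_simps bil_ee bil_ee')
  have bV: "bil (ee k) (V m j) = v m j k" for k m j
    by (simp add: V_def bil_sum_right bil_simps br if_distrib cong: if_cong)
  have bb: "bil (ee k) (b m l d) = (\<Sum>p\<in>UNIV. h m (l + 1) p * (q p $ d * (if k = l + 2 then 1 else 0)))
      - (1/3) * (V m (l + 2) $ d * (if k = l + 1 then 1 else 0) + r (l + 1) $ d * v m (l + 2) k
        - V m (l + 1) $ d * (if k = l + 2 then 1 else 0) - r (l + 2) $ d * v m (l + 1) k)" for k m l d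
    by (simp only: b_def bil_simps bil_sum_right br bq bV) simp
  have tr: "v m 3 3 = - v m 1 1 - v m 2 2" for m
    using exhaust_3[of m] by (elim disjE) (simp_all add: v_def l0_def sum_3)
  have key: "bil (ee (j + 1)) (b m (j + 2) d) - bil (ee (j + 2)) (b m (j + 1) d)
      = (\<Sum>p\<in>UNIV. h m j p * q p $ d) + V m j $ d" for m j d
  proof -
    have "V m j $ d = (\<Sum>p\<in>UNIV. v m j p * r p $ d)" for j by (simp add: V_def)
    then show ?thesis
      using exhaust_3[of j] by (elim disjE) (simp_all add: bb add_3 sum_3 tr field_simps)
  qed
  have Vd: "(\<Sum>p\<in>UNIV. h m j p * q p $ d) + V m j $ d = F m j $ d + (if m = j then \<Sum>p\<in>UNIV. l0 p * r p $ d else 0)" for m j d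
    unfolding covector_decomp[of "F m j" d]
    by (simp add: V_def v_def h_def q_def r_def vcnj_def sum.distrib algebra_simps)
  define \<beta> where "\<beta> m l c d = b m l d $ c" for m l c d
  have "\<beta> m l c d = \<beta> m l d c" for m l c d
    by (simp add: \<beta>_def b_def algebra_simps)
  moreover have "(\<Sum>c\<in>UNIV. ee (j + 1) $ c * \<beta> m (j + 2) c d) - (\<Sum>c\<in>UNIV. ee (j + 2) $ c * \<beta> m (j + 1) c d)
       = F m j $ d + (if m = j then \<Sum>p\<in>UNIV. l0 p * r p $ d else 0)" for m j d
    using key[of j m d] unfolding Vd by (simp add: \<beta>_def bil_def)
  ultimately show ?thesis
    by (intro exI[of _ \<beta>] exI[of _ "\<lambda>d. \<Sum>p\<in>UNIV. l0 p * r p $ d"]) blast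
qed

text \<open>Prescribing \<open>sig\<close> leaves a common diagonal term of \<open>nn\<close> free,
  and this freedom, \<open>lam\<close>, is what solvability for the symmetric second derivatives
  needs.\<close>

lemma sig_surj:
  fixes n :: "complex^8^6"
  shows "\<exists>P. (\<forall>i j. P $ i $ j \<in> Tfib) \<and> (\<forall>i j. P $ i $ j = P $ j $ i) \<and> (\<forall>i. sig (P $ i) = n $ i)"
proof -
  \<comment> \<open>A matrix realizing the eight prescribed components, normalized to have third
    diagonal entry 0; the first two are then n_6 + n_7 and n_7.\<close>
  define F :: "3 \<Rightarrow> 3 \<Rightarrow> complex^6" where "F m j = (\<chi> d. if m = j then (if m = 1 then n $ d $ 6 + n $ d $ 7 else if m = 2 then n $ d $ 7 else 0)
     else if (m, j) = (1, 2) then n $ d $ 0 else if (m, j) = (1, 3) then n $ d $ 1 else if (m, j) = (2, 1) then n $ d $ 2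
     else if (m, j) = (2, 3) then n $ d $ 3 else if (m, j) = (3, 1) then n $ d $ 4 else n $ d $ 5)" for m j
  obtain \<beta> lam where sym: "\<And>m l c d. \<beta> m l c d = \<beta> m l d c"
    and eq: "\<And>m j d. (\<Sum>c\<in>UNIV. ee (j + 1) $ c * \<beta> m (j + 2) c d) - (\<Sum>c\<in>UNIV. ee (j + 2) $ c * \<beta> m (j + 1) c d)
       = F m j $ d + (if m = j then lam d else 0)"
    using second_derivatives_exist[of F] by blast
  \<comment> \<open>The factor - 2 compensates the sign in \<open>Smat_ee\<close> and the pairing
    1/2 of \<open>ee\<close> with its conjugate.\<close>
  define P :: "real^cu_index^6^6" where "P = (\<chi> d c. fibre_vector (Smat (\<lambda>m l. - 2 * \<beta> m l c d)))"
  have "bil (cm (vJ (P $ d $ c)) *v ee l) (ee m) = \<beta> m l c d" for m l c d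
    using exhaust_3[of m]
    by (elim disjE) (simp_all add: P_def fibre_vector_J Smat_ee bil_simps bil_sum_left bil_ee sum_3)
  then have nn: "nn (P $ d) m j = F m j $ d + (if m = j then lam d else 0)" for m j d
    unfolding eq[symmetric] by (simp add: nn_def be_sum)
  have "sig (P $ d) $ i = n $ d $ i" for d i
    using exhaust_8[of i] by (elim disjE) (simp_all add: sig_def nn F_def)
  moreover have "P $ i $ j = P $ j $ i" for i j
    using sym[of _ _ i j] by (simp add: P_def)
  moreover have "P $ i $ j \<in> Tfib" for i j
    by (simp add: P_def fibre_vector_Tfib J0_Smat)
  ultimately show ?thesis by (intro exI[of _ P]) (simp add: vec_eq_iff)
qed

text \<open>An element killing a hyperplane has rank one, a = xi tensor t, so each row of
  \<open>nn a\<close> is a cross product with zeta and thus orthogonal to it. Each such row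
  relation, together with elimination of the trace, constrains \<open>sig\<close>.\<close>

lemma sig_drop:
  assumes E: "subspace E" "dim E = 5"
  shows "sig ` tab.S_E E \<noteq> UNIV"
proof -
  have "dim E < DIM(real^6)" using E(2) by simp
  then obtain \<xi> where \<xi>: "\<xi> \<noteq> 0" "\<And>y. y \<in> span E \<Longrightarrow> orthogonal \<xi> y"
    using orthogonal_to_subspace_exists[of E] by blast
  have "E = {v. \<xi> \<bullet> v = 0}"
  proof (rule subspace_dim_equal[OF E(1) subspace_hyperplane])
    show "E \<subseteq> {v. \<xi> \<bullet> v = 0}" using \<xi>(2) span_base by (force simp: orthogonal_def)
    show "dim {v. \<xi> \<bullet> v = 0} \<le> dim E" by (simp add: dim_hyperplane[OF \<xi>(1)] E(2))
  qed
  note E_eq = this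
  define \<zeta> where "\<zeta> k = (\<Sum>c\<in>UNIV. ee k $ c * complex_of_real (\<xi> $ c))" for k
  define b where "b t l m = bil (cm (vJ t) *v ee l) (ee m)" for t l m
  have be: "\<exists>t. \<forall>k l m. be a k l m = \<zeta> k * b t l m" if a: "a \<in> tab.S_E E" for a
  proof -
    define t where "t = (1 / (\<xi> \<bullet> \<xi>)) *\<^sub>R (\<xi> v* a)"
    \<comment> \<open>Subtracting the component along \<open>\<xi>\<close> moves a basis vector into
      \<open>E\<close>, where \<open>a\<close> vanishes.\<close>
    have "a $ i = \<xi> $ i *\<^sub>R t" for i
    proof -
      define v where "v = axis i 1 - (\<xi> $ i / (\<xi> \<bullet> \<xi>)) *\<^sub>R \<xi>"
      have "v \<in> E"
        using \<xi>(1) by (simp add: E_eq v_def inner_diff_right inner_axis)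
      then have "v v* a = 0" using a unfolding tab.S_E_def by blast
      moreover have "axis i 1 v* a = a $ i"
        by (simp add: vector_matrix_sum axis_def if_distrib[where f = "\<lambda>c. c *\<^sub>R _"] cong: if_cong)
      moreover have "axis i 1 v* a = v v* a + (\<xi> $ i / (\<xi> \<bullet> \<xi>)) *\<^sub>R (\<xi> v* a)"
        unfolding vm_lin[symmetric] by (simp add: v_def vector_matrix_sum scaleR_diff_left sum_subtractf scaleR_sum_right mult_ac)
      ultimately show ?thesis by (simp add: t_def)
    qed
    then have "be a k l m = \<zeta> k * b t l m" for k l m
      by (simp add: be_sum \<zeta>_def b_def v_lin cm_scaleR bil_simps sum_distrib_right mult.assoc)
    then show ?thesis by blast
  qed
  have nz: "\<zeta> 1 \<noteq> 0 \<or> \<zeta> 2 \<noteq> 0 \<or> \<zeta> 3 \<noteq> 0"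
  proof (rule ccontr)
    assume "\<not> ?thesis"
    then have "\<xi> $ i = 0" for i
      using exhaust_6[of i] by (elim disjE) (simp_all add: \<zeta>_def sum_6 ee_def rxy complex_eq_iff)
    then show False using \<xi>(1) by (simp add: vec_eq_iff)
  qed
  \<comment> \<open>Both relations come from sum_j N_ij zeta_j = 0: \<open>r1\<close> is zeta_1
    times row 2 minus zeta_2 times row 1, in which the diagonal entries occur only through N_11 -
    N_22, and \<open>r2\<close> is row 1 alone when zeta_1 = 0.\<close>
  have r1: "\<zeta> 1 * \<zeta> 1 * sig a $ 2 + \<zeta> 1 * \<zeta> 3 * sig a $ 3 = \<zeta> 2 * \<zeta> 2 * sig a $ 0 + \<zeta> 2 * \<zeta> 3 * sig a $ 1 + \<zeta> 2 * \<zeta> 1 * sig a $ 6"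
    and r2: "\<zeta> 1 = 0 \<Longrightarrow> \<zeta> 2 * sig a $ 0 + \<zeta> 3 * sig a $ 1 = 0" if a: "a \<in> tab.S_E E" for a
  proof -
    obtain t where t: "\<And>k l m. be a k l m = \<zeta> k * b t l m" using be[OF a] by blast
    have s: "sig a $ 0 = nn a 1 2" "sig a $ 1 = nn a 1 3" "sig a $ 2 = nn a 2 1" "sig a $ 3 = nn a 2 3" "sig a $ 6 = nn a 1 1 - nn a 2 2"
      by (simp_all add: sig_def)
    show "\<zeta> 1 * \<zeta> 1 * sig a $ 2 + \<zeta> 1 * \<zeta> 3 * sig a $ 3 = \<zeta> 2 * \<zeta> 2 * sig a $ 0 + \<zeta> 2 * \<zeta> 3 * sig a $ 1 + \<zeta> 2 * \<zeta> 1 * sig a $ 6"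
      unfolding s by (simp add: nn_def t add_3 algebra_simps)
    show "\<zeta> 2 * sig a $ 0 + \<zeta> 3 * sig a $ 1 = 0" if "\<zeta> 1 = 0"
      unfolding s using that by (simp add: nn_def t add_3 algebra_simps)
  qed
  show ?thesis
  proof
    assume "sig ` tab.S_E E = UNIV"
    then have ex: "\<exists>a\<in>tab.S_E E. sig a = v" for v by (metis UNIV_I imageE)
    show False
    proof (cases "\<zeta> 1 = 0")
      case True
      obtain a where "a \<in> tab.S_E E" "sig a = axis 0 1" using ex by blast
      then have "\<zeta> 2 = 0" using r2[OF _ True, of a] by (simp add: axis_def)
      moreover obtain a where "a \<in> tab.S_E E" "sig a = axis 1 1" using ex by blast
      then have "\<zeta> 3 = 0" using r2[OF _ True, of a] by (simp add: axis_def)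
      ultimately show False using True nz by simp
    next
      case False
      obtain a where "a \<in> tab.S_E E" "sig a = axis 2 1" using ex by blast
      then show False using r1[of a] False by (simp add: axis_def)
    qed
  qed
qed

theorem not_involutive_chart:
  assumes D: "open D" and x: "x \<in> D"
  shows "\<not> involutive cu_fibre D (quasi_integrability_system D)"
proof
  assume "involutive cu_fibre D (quasi_integrability_system D)"
  then have "involutive_tableau (tableau (quasi_integrability_system D) (jet 1 s_flat x))"
    using flat_in_system[OF D x] unfolding involutive_def by blast
  then show False
    using tab.not_involutive[OF sig_surj sig_drop] by (simp only: tableau_flat[OF D x])
qed

text \<open>Both properties are demanded in all charts of the atlas and fail in every chart with
  nonempty domain; a point of the manifold provides one.\<close>

theorem proposition10:
  fixes M :: "'p topology" and A :: "('p set \<times> ('p \<Rightarrow> 6 \<Rightarrow> real)) set"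
  assumes "smooth_manifold M A" and "topspace M \<noteq> {}"
  shows "\<not> quasi_integrability_formally_integrable A \<and> \<not> quasi_integrability_involutive A"
proof -
  have "(\<Union>(U, \<phi>)\<in>A. U) \<noteq> {}" using assms unfolding smooth_manifold_def by metis
  then obtain U \<phi> p where U: "(U, \<phi>) \<in> A" "p \<in> U" by auto
  moreover have "open (\<phi> ` U)" using assms(1) U(1) unfolding smooth_manifold_def by blast
  ultimately have "\<not> formally_integrable cu_fibre (\<phi> ` U) (quasi_integrability_system (\<phi> ` U))"
    "\<not> involutive cu_fibre (\<phi> ` U) (quasi_integrability_system (\<phi> ` U))"
    using not_formally_integrable_chart not_involutive_chart by blast+
  then show ?thesis
    using U(1) unfolding quasi_integrability_formally_integrable_def quasi_integrability_involutive_def by blast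
qed

end
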